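(* Let $G$ be a finitely generated recursively presented group with undecidable word problem. Then there exists a $G$-effectively closed subshift (over some finite alphabet) which is not sofic.
   Context: Let $G$ be a finitely generated group and $S\subset G$ a finite generating set closed under inverses and containing $1_G$. Words in $S^*$ represent elements of $G$; write $u=_G v$ if they represent the same element. $\mathtt{WP}(G)=\{w\in S^*: w=_G 1_G\}$ is the word problem. $G$ is recursively presented if it has a presentation $\langle S\mid R\rangle$ with $S$ finite and $R\subset S^*$ recursively enumerable. For a finite alphabet $A$, $A^G$ has the product topology and the left shift action $(\sigma_g x)_h=x_{g^{-1}h}$. A subshift is a closed shift-invariant subset of some $A^G$. Put $[a]_g=\{x\in A^G: x_g=a\}$. A subshift $X \subset A^G$ is of finite type (SFT) if there is a finite set $\mathcal F$ of patterns (elements $p\in A^F$ with $F\subset G$ finite) such that $X=\bigcap_{p\in\mathcal F,\,g\in G}\big(A^G\setminus\bigcap_{h\in F_p}[p_h]_{gh}\big)$, where $F_p$ is the support of $p$. A subshift $Y$ is sofic if there is an SFT $Z$ on $G$ and a continuous shift-commuting surjection $Z\to Y$. A pattern coding over $A$ is a finite set $c$ of pairs $(w,a)$ with $w\in S^*$, $a\in A$. For a set $\mathcal C$ of pattern codings, $X_{\mathcal C}=\bigcap_{g\in G,\,c\in\mathcal C}\big(A^G\setminus\bigcap_{(w,a)\in c}[a]_{gw}\big)$. A subshift $X\subset A^G$ is $G$-effectively closed if $X=X_{\mathcal C}$ for some set of pattern codings $\mathcal C$ that is recursively enumerable by a Turing machine with oracle $\mathtt{WP}(G)$. *)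

theory Defs
  imports "HOL-Analysis.Function_Topology" "HOL-Algebra.Generated_Groups"
begin

section \<open>Turing machines with an oracle\<close>

text \<open>
  Deterministic multi-tape machines. Input letters occur literally as tape symbols, so no encoding
  of words by numbers is involved; \<open>Aux\<close> provides further work symbols.
\<close>

datatype 'c tape_symbol = Blank | Letter 'c | Aux nat

datatype direction = MoveLeft | Stay | MoveRight

text \<open>
  A tape is a pair \<open>(l, r)\<close>: \<open>r\<close> lists the cells from the scanned one to the right, \<open>l\<close> those to the
  left of the scanned one, nearest first. All cells not listed are blank, so tapes are infinite in
  both directions.
\<close>

type_synonym 'c tape = "'c tape_symbol list \<times> 'c tape_symbol list"

definition scan :: "'c tape_symbol list \<Rightarrow> 'c tape_symbol" where
  "scan cells = (case cells of [] \<Rightarrow> Blank | s # _ \<Rightarrow> s)"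

fun write_and_move :: "'c tape_symbol \<times> direction \<Rightarrow> 'c tape \<Rightarrow> 'c tape" where
  "write_and_move (s, MoveLeft) (l, r) = (tl l, scan l # s # tl r)"
| "write_and_move (s, Stay) (l, r) = (l, s # tl r)"
| "write_and_move (s, MoveRight) (l, r) = (s # l, tl r)"

text \<open>
  In a state \<open>q\<close> from \<open>tm_queries\<close> the machine consults the oracle and enters \<open>tm_answer q b\<close>, where
  \<open>b\<close> is the oracle's answer; the tapes are left unchanged.
\<close>

record 'c tm =
  tm_tapes :: nat
  tm_states :: "nat set"
  tm_symbols :: "'c tape_symbol set"
  tm_start :: nat
  tm_accept :: nat
  tm_reject :: nat
  tm_queries :: "nat set"
  tm_trans :: "nat \<Rightarrow> 'c tape_symbol list \<Rightarrow> nat \<times> ('c tape_symbol \<times> direction) list"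
  tm_answer :: "nat \<Rightarrow> bool \<Rightarrow> nat"

definition oracle_tm :: "'c set \<Rightarrow> 'c tm \<Rightarrow> bool" where
  "oracle_tm \<Sigma> M \<longleftrightarrow>
     1 \<le> tm_tapes M \<and>
     finite (tm_states M) \<and> finite (tm_symbols M) \<and>
     Blank \<in> tm_symbols M \<and> Letter ` \<Sigma> \<subseteq> tm_symbols M \<and>
     tm_start M \<in> tm_states M \<and> tm_accept M \<in> tm_states M \<and> tm_reject M \<in> tm_states M \<and>
     tm_accept M \<noteq> tm_reject M \<and>
     tm_queries M \<subseteq> tm_states M \<and>
     (\<forall>q\<in>tm_queries M. \<forall>b. tm_answer M q b \<in> tm_states M) \<and>
     (\<forall>q\<in>tm_states M. \<forall>ss. length ss = tm_tapes M \<and> set ss \<subseteq> tm_symbols M \<longrightarrow>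
        (case tm_trans M q ss of (q', acts) \<Rightarrow>
           q' \<in> tm_states M \<and> length acts = tm_tapes M \<and> fst ` set acts \<subseteq> tm_symbols M))"

definition plain_tm :: "'c set \<Rightarrow> 'c tm \<Rightarrow> bool" where
  "plain_tm \<Sigma> M \<longleftrightarrow> oracle_tm \<Sigma> M \<and> tm_queries M = {}"

type_synonym 'c tm_config = "nat \<times> 'c tape list"

text \<open>
  The last tape is the oracle tape. The word asked about is the maximal block of nonblank symbols
  that starts at the scanned cell and extends to the right.
\<close>

definition query_positive :: "'c list set \<Rightarrow> 'c tape list \<Rightarrow> bool" where
  "query_positive \<O> ts \<longleftrightarrow> takeWhile (\<lambda>s. s \<noteq> Blank) (snd (last ts)) \<in> map Letter ` \<O>"

fun tm_step :: "'c tm \<Rightarrow> 'c list set \<Rightarrow> 'c tm_config \<Rightarrow> 'c tm_config" where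
  "tm_step M \<O> (q, ts) =
     (if q = tm_accept M \<or> q = tm_reject M then (q, ts)
      else if q \<in> tm_queries M then (tm_answer M q (query_positive \<O> ts), ts)
      else (case tm_trans M q (map (scan \<circ> snd) ts) of
              (q', acts) \<Rightarrow> (q', map2 write_and_move acts ts)))"

definition tm_init :: "'c tm \<Rightarrow> 'c list \<Rightarrow> 'c tm_config" where
  "tm_init M w = (tm_start M, ([], map Letter w) # replicate (tm_tapes M - 1) ([], []))"

definition tm_accepts :: "'c tm \<Rightarrow> 'c list set \<Rightarrow> 'c list \<Rightarrow> bool" where
  "tm_accepts M \<O> w \<longleftrightarrow> (\<exists>n. fst ((tm_step M \<O> ^^ n) (tm_init M w)) = tm_accept M)"

definition tm_rejects :: "'c tm \<Rightarrow> 'c list set \<Rightarrow> 'c list \<Rightarrow> bool" where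
  "tm_rejects M \<O> w \<longleftrightarrow> (\<exists>n. fst ((tm_step M \<O> ^^ n) (tm_init M w)) = tm_reject M)"

definition re_with_oracle :: "'c list set \<Rightarrow> 'c set \<Rightarrow> 'c list set \<Rightarrow> bool" where
  "re_with_oracle \<O> \<Sigma> L \<longleftrightarrow> L \<subseteq> lists \<Sigma> \<and>
     (\<exists>M. oracle_tm \<Sigma> M \<and> (\<forall>w\<in>lists \<Sigma>. tm_accepts M \<O> w \<longleftrightarrow> w \<in> L))"

text \<open>Plain machines never consult the oracle, so the oracle \<open>{}\<close> below is a dummy.\<close>

definition recursively_enumerable :: "'c set \<Rightarrow> 'c list set \<Rightarrow> bool" where
  "recursively_enumerable \<Sigma> L \<longleftrightarrow> L \<subseteq> lists \<Sigma> \<and>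
     (\<exists>M. plain_tm \<Sigma> M \<and> (\<forall>w\<in>lists \<Sigma>. tm_accepts M {} w \<longleftrightarrow> w \<in> L))"

definition decidable :: "'c set \<Rightarrow> 'c list set \<Rightarrow> bool" where
  "decidable \<Sigma> L \<longleftrightarrow> L \<subseteq> lists \<Sigma> \<and>
     (\<exists>M. plain_tm \<Sigma> M \<and>
        (\<forall>w\<in>lists \<Sigma>. if w \<in> L then tm_accepts M {} w else tm_rejects M {} w))"


section \<open>Words and presentations\<close>

definition finite_symmetric_generators :: "('g, 'm) monoid_scheme \<Rightarrow> 'g set \<Rightarrow> bool" where
  "finite_symmetric_generators G S \<longleftrightarrow>
     finite S \<and> S \<subseteq> carrier G \<and> generate G S = carrier G \<and>
     (\<forall>s\<in>S. inv\<^bsub>G\<^esub> s \<in> S) \<and> \<one>\<^bsub>G\<^esub> \<in> S"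

definition word_value :: "('g, 'm) monoid_scheme \<Rightarrow> 'g list \<Rightarrow> 'g" where
  "word_value G w = foldr (\<lambda>s g. s \<otimes>\<^bsub>G\<^esub> g) w \<one>\<^bsub>G\<^esub>"

definition word_problem :: "('g, 'm) monoid_scheme \<Rightarrow> 'g set \<Rightarrow> 'g list set" where
  "word_problem G S = {w \<in> lists S. word_value G w = \<one>\<^bsub>G\<^esub>}"

text \<open>
  Equality of words in the group presented by generators \<open>S\<close> and relators \<open>R\<close>. Since \<open>S\<close> is
  symmetric, the letter \<open>inv s\<close> plays the role of the formal inverse of the letter \<open>s\<close>; the group
  itself enters only through this involution on \<open>S\<close>.
\<close>

inductive presented_eq ::
  "('g, 'm) monoid_scheme \<Rightarrow> 'g set \<Rightarrow> 'g list set \<Rightarrow> 'g list \<Rightarrow> 'g list \<Rightarrow> bool"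
  for G S R where
  refl: "w \<in> lists S \<Longrightarrow> presented_eq G S R w w"
| sym: "presented_eq G S R u v \<Longrightarrow> presented_eq G S R v u"
| trans: "presented_eq G S R u v \<Longrightarrow> presented_eq G S R v w \<Longrightarrow> presented_eq G S R u w"
| cancel: "s \<in> S \<Longrightarrow> presented_eq G S R [s, inv\<^bsub>G\<^esub> s] []"
| relator: "r \<in> R \<Longrightarrow> presented_eq G S R r []"
| congruence: "x \<in> lists S \<Longrightarrow> y \<in> lists S \<Longrightarrow> presented_eq G S R u v \<Longrightarrow>
    presented_eq G S R (x @ u @ y) (x @ v @ y)"

definition is_presentation :: "('g, 'm) monoid_scheme \<Rightarrow> 'g set \<Rightarrow> 'g list set \<Rightarrow> bool" where
  "is_presentation G S R \<longleftrightarrow>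
     finite_symmetric_generators G S \<and> R \<subseteq> lists S \<and>
     (\<forall>u\<in>lists S. \<forall>v\<in>lists S. word_value G u = word_value G v \<longleftrightarrow> presented_eq G S R u v)"

definition recursively_presented :: "('g, 'm) monoid_scheme \<Rightarrow> bool" where
  "recursively_presented G \<longleftrightarrow> (\<exists>S R. is_presentation G S R \<and> recursively_enumerable S R)"


section \<open>Subshifts\<close>

definition configs :: "('g, 'm) monoid_scheme \<Rightarrow> 'a set \<Rightarrow> ('g \<Rightarrow> 'a) set" where
  "configs G A = (\<Pi>\<^sub>E g\<in>carrier G. A)"

definition config_topology :: "('g, 'm) monoid_scheme \<Rightarrow> 'a set \<Rightarrow> ('g \<Rightarrow> 'a) topology" where
  "config_topology G A = product_topology (\<lambda>_. discrete_topology A) (carrier G)"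

definition shift :: "('g, 'm) monoid_scheme \<Rightarrow> 'g \<Rightarrow> ('g \<Rightarrow> 'a) \<Rightarrow> ('g \<Rightarrow> 'a)" where
  "shift G g x = (\<lambda>h\<in>carrier G. x (inv\<^bsub>G\<^esub> g \<otimes>\<^bsub>G\<^esub> h))"

definition cylinder :: "('g, 'm) monoid_scheme \<Rightarrow> 'a set \<Rightarrow> 'a \<Rightarrow> 'g \<Rightarrow> ('g \<Rightarrow> 'a) set" where
  "cylinder G A a g = {x \<in> configs G A. x g = a}"

definition subshift :: "('g, 'm) monoid_scheme \<Rightarrow> 'a set \<Rightarrow> ('g \<Rightarrow> 'a) set \<Rightarrow> bool" where
  "subshift G A X \<longleftrightarrow> finite A \<and> closedin (config_topology G A) X \<and>
     (\<forall>g\<in>carrier G. \<forall>x\<in>X. shift G g x \<in> X)"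

text \<open>A pattern is a partial map; its domain is the support.\<close>

definition pattern :: "('g, 'm) monoid_scheme \<Rightarrow> 'a set \<Rightarrow> ('g \<rightharpoonup> 'a) \<Rightarrow> bool" where
  "pattern G A p \<longleftrightarrow> finite (dom p) \<and> dom p \<subseteq> carrier G \<and> ran p \<subseteq> A"

text \<open>
  The intersections of the mathematical definitions are taken inside \<open>A\<^sup>G\<close>: the empty family of
  patterns defines \<open>A\<^sup>G\<close>, and the empty pattern forbids every configuration. The same convention
  applies to pattern codings.
\<close>

definition avoiding :: "('g, 'm) monoid_scheme \<Rightarrow> 'a set \<Rightarrow> ('g \<rightharpoonup> 'a) set \<Rightarrow> ('g \<Rightarrow> 'a) set" where
  "avoiding G A \<F> = {x \<in> configs G A. \<forall>p\<in>\<F>. \<forall>g\<in>carrier G.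
     \<not> (\<forall>h\<in>dom p. x \<in> cylinder G A (the (p h)) (g \<otimes>\<^bsub>G\<^esub> h))}"

definition finite_type :: "('g, 'm) monoid_scheme \<Rightarrow> 'a set \<Rightarrow> ('g \<Rightarrow> 'a) set \<Rightarrow> bool" where
  "finite_type G A X \<longleftrightarrow> subshift G A X \<and>
     (\<exists>\<F>. finite \<F> \<and> (\<forall>p\<in>\<F>. pattern G A p) \<and> X = avoiding G A \<F>)"

text \<open>Alphabets of covering shifts of finite type may be taken to be finite sets of naturals.\<close>

definition sofic :: "('g, 'm) monoid_scheme \<Rightarrow> 'a set \<Rightarrow> ('g \<Rightarrow> 'a) set \<Rightarrow> bool" where
  "sofic G A Y \<longleftrightarrow> subshift G A Y \<and>
     (\<exists>(B :: nat set) Z \<phi>. finite_type G B Z \<and>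
        continuous_map (subtopology (config_topology G B) Z)
                       (subtopology (config_topology G A) Y) \<phi> \<and>
        (\<forall>g\<in>carrier G. \<forall>z\<in>Z. \<phi> (shift G g z) = shift G g (\<phi> z)) \<and>
        \<phi> ` Z = Y)"


section \<open>Pattern codings and effectively closed subshifts\<close>

type_synonym ('g, 'a) coding = "('g list \<times> 'a) set"

definition pattern_coding :: "'g set \<Rightarrow> 'a set \<Rightarrow> ('g, 'a) coding \<Rightarrow> bool" where
  "pattern_coding S A c \<longleftrightarrow> finite c \<and> c \<subseteq> lists S \<times> A"

definition coded_shift ::
  "('g, 'm) monoid_scheme \<Rightarrow> 'a set \<Rightarrow> ('g, 'a) coding set \<Rightarrow> ('g \<Rightarrow> 'a) set" where
  "coded_shift G A \<C> = {x \<in> configs G A. \<forall>c\<in>\<C>. \<forall>g\<in>carrier G.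
     \<not> (\<forall>(w, a)\<in>c. x \<in> cylinder G A a (g \<otimes>\<^bsub>G\<^esub> word_value G w))}"

text \<open>
  A coding \<open>{(w\<^sub>1, a\<^sub>1), \<dots>, (w\<^sub>n, a\<^sub>n)}\<close> is given to a machine as the word \<open>w\<^sub>1 a\<^sub>1 \<dots> w\<^sub>n a\<^sub>n\<close> over the
  disjoint union of \<open>S\<close> and \<open>A\<close>, the letters from \<open>A\<close> acting as delimiters. A set of codings is
  represented by the words for all listings of its members, in any order and with repetitions.
\<close>

definition coding_word :: "('g list \<times> 'a) list \<Rightarrow> ('g + 'a) list" where
  "coding_word cs = concat (map (\<lambda>(w, a). map Inl w @ [Inr a]) cs)"

definition coding_language :: "('g, 'a) coding set \<Rightarrow> ('g + 'a) list set" where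
  "coding_language \<C> = {coding_word cs |cs. set cs \<in> \<C>}"

definition effectively_closed ::
  "('g, 'm) monoid_scheme \<Rightarrow> 'g set \<Rightarrow> 'a set \<Rightarrow> ('g \<Rightarrow> 'a) set \<Rightarrow> bool" where
  "effectively_closed G S A X \<longleftrightarrow> subshift G A X \<and>
     (\<exists>\<C>. (\<forall>c\<in>\<C>. pattern_coding S A c) \<and>
        re_with_oracle (map Inl ` word_problem G S) (S <+> A) (coding_language \<C>) \<and>
        X = coded_shift G A \<C>)"

end

theory Submission
  imports Defs "HOL-Library.Nat_Bijection" "HOL-Library.Countable"
begin

text \<open>
  The witness is the subshift of all configurations over \<open>{0, 1}\<close> with at most one \<open>1\<close>.

  It is effectively closed relative to the word problem: a configuration has two ones exactly if some
  pair \<open>(u, 1), (v, 1)\<close> occurs in it where \<open>u\<close> is trivial and \<open>v\<close> is not, and an oracle machine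
  recognises the codings that contain such a pair.

  It is not sofic, because soficity would make the word problem decidable. Let \<open>Z\<close> be a covering
  shift of finite type over \<open>B\<close>, with factor map \<open>\<phi>\<close>. By compactness, \<open>\<phi> z \<one> = 1\<close> says that \<open>z\<close> avoids a finite set \<open>Q\<close>
  of patterns at the identity. As \<open>\<phi>\<close> commutes with shifts and no configuration in the image has two
  ones, a word \<open>w\<close> is nontrivial if and only if no point of \<open>Z\<close> avoids \<open>Q\<close> both at the identity and at \<open>w\<close>. Such a
  point can be described without knowing the group: it is a labelling of words by letters of \<open>B\<close> that
  gives equal labels to words differing by a relator, and violates none of countably many finite
  constraints. So nontriviality of \<open>w\<close> is the unsatisfiability of a system of clauses that can be
  enumerated along with the relators; by Koenig's lemma it is witnessed by a finite subsystem, hence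
  semidecidable. Triviality of \<open>w\<close> is the unsatisfiability of a system of the same kind, with two
  labels and the demand that \<open>w\<close> and the empty word be labelled differently. Searching for both
  refutations in parallel decides the word problem (\<open>decidable_word_problem\<close>,
  \<open>sofic_at_most_one_decidable\<close>).

  Turning the search into a Turing machine takes three steps. Loop programs on registers give a class of
  functions closed under everything the search needs, including list recursion and running the
  machine that enumerates the relators for a given number of steps (\<open>computable_refuted\<close>,
  \<open>plain_tm_acceptance_computable\<close>). Register programs run on a multitape machine with one
  tape per register (\<open>simulation\<close>). An unbounded search over a computable test is then a decision procedure
  whenever it is known to succeed (\<open>decidable_by_search\<close>).
\<close>

section \<open>Loop programs\<close>

text \<open>
  Loop programs use \<open>Skip\<close>, \<open>Inc\<close>, \<open>Seq\<close>, \<open>IfDec\<close> and \<open>Loop\<close>. The other commands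
  control a machine: reading the input, the unbounded search, and stopping it when a register is
  positive. \<open>Mark\<close> is the second half of \<open>Inc\<close>, which takes two moves on a tape.
\<close>

datatype cmd =
    Skip
  | Inc nat
  | Mark nat
  | Seq cmd cmd
  | IfDec nat cmd cmd
  | Loop nat cmd
  | Forever cmd
  | AcceptIf nat
  | RejectIf nat
  | ReadAll

instance cmd :: countable
  by countable_datatype

fun regs :: "cmd \<Rightarrow> nat set" where
  "regs (Inc r) = {r}"
| "regs (Seq c d) = regs c \<union> regs d"
| "regs (IfDec r c d) = insert r (regs c \<union> regs d)"
| "regs (Loop r c) = insert r (regs c)"
| "regs _ = {}"

text \<open>
  The counter of a loop does not occur in its body. This makes every loop run as often as its
  counter says on entry.
\<close>

fun loop_program :: "cmd \<Rightarrow> bool" where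
  "loop_program Skip \<longleftrightarrow> True"
| "loop_program (Inc r) \<longleftrightarrow> True"
| "loop_program (Seq c d) \<longleftrightarrow> loop_program c \<and> loop_program d"
| "loop_program (IfDec r c d) \<longleftrightarrow> loop_program c \<and> loop_program d"
| "loop_program (Loop r c) \<longleftrightarrow> r \<notin> regs c \<and> loop_program c"
| "loop_program _ \<longleftrightarrow> False"

text \<open>
  Clearing the counter of a loop at once has the same effect as decrementing it in every round,
  provided that the body leaves it alone. Commands outside loop programs get a default value.
\<close>

fun exec :: "cmd \<Rightarrow> (nat \<Rightarrow> nat) \<Rightarrow> nat \<Rightarrow> nat" where
  "exec (Inc r) s = s(r := Suc (s r))"
| "exec (Seq c d) s = exec d (exec c s)"
| "exec (IfDec r c d) s = (if s r = 0 then exec d s else exec c (s(r := s r - 1)))"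
| "exec (Loop r c) s = (exec c ^^ s r) (s(r := 0))"
| "exec _ s = s"

text \<open>
  Input and output are in register \<open>b\<close>; the registers above \<open>b\<close> are a workspace that is empty
  before and after. Programs that obey this can be chained, or run at a higher base, without saving
  registers.
\<close>

definition loop_computes :: "cmd \<Rightarrow> nat \<Rightarrow> (nat \<Rightarrow> nat) \<Rightarrow> bool" where
  "loop_computes c b f \<longleftrightarrow> loop_program c \<and> regs c \<subseteq> {b..} \<and>
     (\<forall>s. (\<forall>i>b. s i = 0) \<longrightarrow> exec c s = s(b := f (s b)))"

definition loopable :: "(nat \<Rightarrow> nat) \<Rightarrow> bool" where
  "loopable f \<longleftrightarrow> (\<forall>b. \<exists>c. loop_computes c b f)"

lemma loopableI:
  assumes "\<And>b. loop_program (c b)" "\<And>b. regs (c b) \<subseteq> {b..}"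
    and "\<And>b s. (\<And>i. i > b \<Longrightarrow> s i = 0) \<Longrightarrow> exec (c b) s = s(b := f (s b))"
  shows "loopable f"
  unfolding loopable_def loop_computes_def using assms by blast

lemma loopableE:
  assumes "loopable f"
  obtains c where "\<And>b. loop_program (c b)" "\<And>b. regs (c b) \<subseteq> {b..}"
    and "\<And>b s. (\<And>i. i > b \<Longrightarrow> s i = 0) \<Longrightarrow> exec (c b) s = s(b := f (s b))"
  using assms unfolding loopable_def loop_computes_def by metis

lemma loopable_id: "loopable (\<lambda>x. x)"
  by (rule loopableI[where c = "\<lambda>b. Skip"]) auto

lemma exec_Loop_Skip [simp]: "exec (Loop r Skip) s = s(r := 0)"
proof -
  have "(exec Skip ^^ n) s = s" for n s by (induction n) auto
  then show ?thesis by simp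
qed

lemma loopable_0: "loopable (\<lambda>x. 0)"
  by (rule loopableI[where c = "\<lambda>b. Loop b Skip"]) (auto simp del: exec.simps)

lemma loopable_Suc: "loopable Suc"
  by (rule loopableI[where c = Inc]) auto

lemma loopable_comp:
  assumes "loopable f" "loopable g"
  shows "loopable (\<lambda>x. g (f x))"
proof -
  from assms obtain cf cg where
    "\<And>b. loop_program (cf b)" "\<And>b. regs (cf b) \<subseteq> {b..}"
    "\<And>b s. (\<And>i. i > b \<Longrightarrow> s i = 0) \<Longrightarrow> exec (cf b) s = s(b := f (s b))"
    "\<And>b. loop_program (cg b)" "\<And>b. regs (cg b) \<subseteq> {b..}"
    "\<And>b s. (\<And>i. i > b \<Longrightarrow> s i = 0) \<Longrightarrow> exec (cg b) s = s(b := g (s b))"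
    by (elim loopableE) blast
  then show ?thesis
    by (intro loopableI[where c = "\<lambda>b. Seq (cf b) (cg b)"]) auto
qed

lemma exec_move:
  "r \<noteq> t \<Longrightarrow> exec (Loop r (Inc t)) s = s(r := 0, t := s t + s r)"
proof -
  have "(exec (Inc t) ^^ n) s = s(t := s t + n)" for n s
    by (induction n) (auto simp: fun_eq_iff)
  then show "r \<noteq> t \<Longrightarrow> ?thesis" by simp
qed

lemma exec_move2:
  "distinct [r, t, u] \<Longrightarrow>
    exec (Loop r (Seq (Inc t) (Inc u))) s = s(r := 0, t := s t + s r, u := s u + s r)"
proof -
  have "t \<noteq> u \<Longrightarrow> (exec (Seq (Inc t) (Inc u)) ^^ n) s = s(t := s t + n, u := s u + n)" for n s
    by (induction n) (auto simp: fun_eq_iff)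
  then show "distinct [r, t, u] \<Longrightarrow> ?thesis" by simp
qed

lemma exec_Loop: "exec (Loop r c) s = (exec c ^^ s r) (s(r := 0))"
  by simp

definition copy_cmd :: "nat \<Rightarrow> nat \<Rightarrow> nat \<Rightarrow> cmd" where
  "copy_cmd r t u = Seq (Loop r (Seq (Inc t) (Inc u))) (Loop u (Inc r))"

lemma exec_copy:
  assumes "distinct [r, t, u]" "s u = 0"
  shows "exec (copy_cmd r t u) s = s(t := s t + s r)"
  unfolding copy_cmd_def exec.simps(2)
  using assms by (subst exec_move2, simp, subst exec_move) (auto simp: fun_eq_iff)

lemma copy_cmd_props:
  "distinct [r, t, u] \<Longrightarrow> loop_program (copy_cmd r t u)" "regs (copy_cmd r t u) = {r, t, u}"
  by (auto simp: copy_cmd_def)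

text \<open>
  This evaluates \<open>m + (1 + \<dots> + (m + n))\<close>: register \<open>b+1\<close> runs through the summands while register
  \<open>b+2\<close> counts them down.
\<close>

definition encode_cmd :: "nat \<Rightarrow> cmd" where
  "encode_cmd b = Seq (Loop (b+1) (Seq (Inc b) (Inc (b+2))))
     (Seq (Loop (b+2) (Seq (Inc (b+1)) (copy_cmd (b+1) b (b+3)))) (Loop (b+1) Skip))"

lemma exec_encode:
  assumes "s b = 0" "s (b+1) = m" "s (b+2) = n" "\<And>i. i > b+2 \<Longrightarrow> s i = 0"
  shows "exec (encode_cmd b) s = s(b := prod_encode (m, n), b+1 := 0, b+2 := 0)"
proof -
  let ?body = "Seq (Inc (b+1)) (copy_cmd (b+1) b (b+3))"
  let ?s1 = "s(b := m, b+1 := 0, b+2 := 0)"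
  have it: "(exec ?body ^^ k) ?s1 = s(b := m + triangle k, b+1 := k, b+2 := 0)" for k
  proof (induction k)
    case 0
    then show ?case by (simp add: fun_eq_iff)
  next
    case (Suc k)
    have "(exec ?body ^^ Suc k) ?s1 = exec ?body (s(b := m + triangle k, b+1 := k, b+2 := 0))"
      using Suc by (simp only: funpow.simps comp_apply)
    also have "\<dots> = s(b := m + triangle (Suc k), b+1 := Suc k, b+2 := 0)"
      unfolding exec.simps(1,2)
      using assms by (subst exec_copy) (auto simp: fun_eq_iff)
    finally show ?case .
  qed
  have 1: "exec (Loop (b+1) (Seq (Inc b) (Inc (b+2)))) s = s(b := m, b+1 := 0, b+2 := m + n)"
    using assms by (subst exec_move2) (auto simp: fun_eq_iff)
  have 2: "exec (Loop (b+2) ?body) (s(b := m, b+1 := 0, b+2 := m + n))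
      = s(b := m + triangle (m + n), b+1 := m + n, b+2 := 0)"
    using it[of "m + n"] by (simp only: exec_Loop fun_upd_same fun_upd_upd)
  show ?thesis
    by (simp only: encode_cmd_def exec.simps(2) exec_Loop_Skip 1 2)
      (simp add: prod_encode_def fun_eq_iff add.commute)
qed

lemma encode_cmd_props: "loop_program (encode_cmd b)" "regs (encode_cmd b) \<subseteq> {b..}"
  by (auto simp: encode_cmd_def copy_cmd_props)

lemma loopable_pair:
  assumes "loopable f" "loopable g"
  shows "loopable (\<lambda>x. prod_encode (f x, g x))"
proof -
  from assms obtain cf cg where
    f: "\<And>b. loop_program (cf b)" "\<And>b. regs (cf b) \<subseteq> {b..}"
    "\<And>b s. (\<And>i. i > b \<Longrightarrow> s i = 0) \<Longrightarrow> exec (cf b) s = s(b := f (s b))" and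
    g: "\<And>b. loop_program (cg b)" "\<And>b. regs (cg b) \<subseteq> {b..}"
    "\<And>b s. (\<And>i. i > b \<Longrightarrow> s i = 0) \<Longrightarrow> exec (cg b) s = s(b := g (s b))"
    by (elim loopableE) blast
  define c where "c b = Seq (copy_cmd b (b+1) (b+2)) (Seq (cf (b+1))
    (Seq (Loop b (Inc (b+2))) (Seq (cg (b+2)) (encode_cmd b))))" for b
  show ?thesis
  proof (rule loopableI[where c = c])
    fix b
    show "loop_program (c b)"
      by (simp add: c_def f g copy_cmd_props encode_cmd_props)
    show "regs (c b) \<subseteq> {b..}"
      using f(2)[of "b+1"] g(2)[of "b+2"] encode_cmd_props[of b]
      by (auto simp: c_def copy_cmd_props)
    fix s :: "nat \<Rightarrow> nat"
    assume z: "\<And>i. i > b \<Longrightarrow> s i = 0"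
    let ?x = "s b"
    have 1: "exec (copy_cmd b (b+1) (b+2)) s = s(b+1 := ?x)"
      using z by (subst exec_copy) auto
    have 2: "exec (cf (b+1)) (s(b+1 := ?x)) = s(b+1 := f ?x)"
      using z by (subst f(3)) auto
    have 3: "exec (Loop b (Inc (b+2))) (s(b+1 := f ?x)) = s(b := 0, b+1 := f ?x, b+2 := ?x)"
      using z by (subst exec_move) (auto simp: fun_eq_iff)
    have 4: "exec (cg (b+2)) (s(b := 0, b+1 := f ?x, b+2 := ?x))
        = s(b := 0, b+1 := f ?x, b+2 := g ?x)"
      using z by (subst g(3)) auto
    have 5: "exec (encode_cmd b) (s(b := 0, b+1 := f ?x, b+2 := g ?x))
        = s(b := prod_encode (f ?x, g ?x))"
      using z by (subst exec_encode[where m = "f ?x" and n = "g ?x"]) (auto simp: fun_eq_iff)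
    show "exec (c b) s = s(b := prod_encode (f (s b), g (s b)))"
      by (simp only: c_def exec.simps(2) 1 2 3 4 5)
  qed
qed

text \<open>
  Counting up to the code along the Cantor enumeration, in which \<open>(m, n)\<close> is followed by
  \<open>(m+1, n-1)\<close> if \<open>n\<close> is positive, and by \<open>(0, m+1)\<close> otherwise.
\<close>

definition decode_cmd :: "nat \<Rightarrow> cmd" where
  "decode_cmd b = Loop b (IfDec (b+2) (Inc (b+1)) (Seq (Loop (b+1) (Inc (b+2))) (Inc (b+2))))"

lemma decode_cmd_props: "loop_program (decode_cmd b)" "regs (decode_cmd b) \<subseteq> {b..}"
  by (auto simp: decode_cmd_def)

lemma exec_decode:
  assumes "\<And>i. i > b \<Longrightarrow> s i = 0"
  shows "exec (decode_cmd b) s =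
    s(b := 0, b+1 := fst (prod_decode (s b)), b+2 := snd (prod_decode (s b)))"
proof -
  let ?body = "IfDec (b+2) (Inc (b+1)) (Seq (Loop (b+1) (Inc (b+2))) (Inc (b+2)))"
  have "\<exists>m n. prod_encode (m, n) = k \<and>
      (exec ?body ^^ k) (s(b := 0)) = s(b := 0, b+1 := m, b+2 := n)" for k
  proof (induction k)
    case 0
    show ?case using assms by (intro exI[of _ 0]) (auto simp: prod_encode_def fun_eq_iff)
  next
    case (Suc k)
    then obtain m n where k: "prod_encode (m, n) = k"
      and e: "(exec ?body ^^ k) (s(b := 0)) = s(b := 0, b+1 := m, b+2 := n)" by blast
    have *: "(exec ?body ^^ Suc k) (s(b := 0)) = exec ?body (s(b := 0, b+1 := m, b+2 := n))"
      using e by (simp only: funpow.simps comp_apply)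
    show ?case
    proof (cases n)
      case 0
      have mv: "exec (Loop (b+1) (Inc (b+2))) (s(b := 0, b+1 := m, b+2 := 0))
          = s(b := 0, b+1 := 0, b+2 := m)"
        by (subst exec_move) (auto simp: fun_eq_iff)
      have "exec ?body (s(b := 0, b+1 := m, b+2 := n)) = s(b := 0, b+1 := 0, b+2 := Suc m)"
        using mv 0 by (simp del: exec.simps(4) add: fun_eq_iff)
      moreover have "prod_encode (0, Suc m) = Suc k"
        using k 0 by (simp add: prod_encode_def)
      ultimately show ?thesis using * by metis
    next
      case (Suc n')
      have "exec ?body (s(b := 0, b+1 := m, b+2 := n)) = s(b := 0, b+1 := Suc m, b+2 := n')"
        using Suc by (simp del: exec.simps(4) add: fun_eq_iff)
      moreover have "prod_encode (Suc m, n') = Suc k"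
        using k Suc by (simp add: prod_encode_def)
      ultimately show ?thesis using * by metis
    qed
  qed
  then obtain m n where "prod_encode (m, n) = s b"
      "(exec ?body ^^ s b) (s(b := 0)) = s(b := 0, b+1 := m, b+2 := n)" by blast
  then show ?thesis unfolding decode_cmd_def exec_Loop
    by (metis fst_conv prod_encode_inverse snd_conv)
qed

lemma loopable_fst: "loopable (\<lambda>x. fst (prod_decode x))"
proof (rule loopableI[where c = "\<lambda>b. Seq (decode_cmd b) (Seq (Loop (b+2) Skip) (Loop (b+1) (Inc b)))"])
  fix b and s :: "nat \<Rightarrow> nat"
  show "regs (Seq (decode_cmd b) (Seq (Loop (b+2) Skip) (Loop (b+1) (Inc b)))) \<subseteq> {b..}"
    using decode_cmd_props(2)[of b] by auto
  assume z: "\<And>i. i > b \<Longrightarrow> s i = 0"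
  show "exec (Seq (decode_cmd b) (Seq (Loop (b+2) Skip) (Loop (b+1) (Inc b)))) s
      = s(b := fst (prod_decode (s b)))"
    using z by (simp only: exec.simps(2) exec_decode[of b s, OF z] exec_Loop_Skip exec_move)
      (auto simp: fun_eq_iff exec_move)
qed (simp add: decode_cmd_props)

lemma loopable_snd: "loopable (\<lambda>x. snd (prod_decode x))"
proof (rule loopableI[where c = "\<lambda>b. Seq (decode_cmd b) (Seq (Loop (b+1) Skip) (Loop (b+2) (Inc b)))"])
  fix b and s :: "nat \<Rightarrow> nat"
  show "regs (Seq (decode_cmd b) (Seq (Loop (b+1) Skip) (Loop (b+2) (Inc b)))) \<subseteq> {b..}"
    using decode_cmd_props(2)[of b] by auto
  assume z: "\<And>i. i > b \<Longrightarrow> s i = 0"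
  show "exec (Seq (decode_cmd b) (Seq (Loop (b+1) Skip) (Loop (b+2) (Inc b)))) s
      = s(b := snd (prod_decode (s b)))"
    using z by (simp only: exec.simps(2) exec_decode[of b s, OF z] exec_Loop_Skip exec_move)
      (auto simp: fun_eq_iff exec_move)
qed (simp add: decode_cmd_props)

text \<open>
  The counter is moved to register \<open>b\<close>, below the workspace of the body, which runs at \<open>b+1\<close>.
\<close>

lemma loopable_iterate:
  assumes "loopable f"
  shows "loopable (\<lambda>x. (f ^^ snd (prod_decode x)) (fst (prod_decode x)))"
proof -
  from assms obtain cf where
    f: "\<And>b. loop_program (cf b)" "\<And>b. regs (cf b) \<subseteq> {b..}"
    "\<And>b s. (\<And>i. i > b \<Longrightarrow> s i = 0) \<Longrightarrow> exec (cf b) s = s(b := f (s b))"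
    by (elim loopableE) blast
  define c where "c b = Seq (decode_cmd b) (Seq (Loop (b+2) (Inc b))
    (Seq (Loop b (cf (b+1))) (Loop (b+1) (Inc b))))" for b
  show ?thesis
  proof (rule loopableI[where c = c])
    fix b
    show "loop_program (c b)"
      using f(2)[of "b+1"] by (auto simp: c_def f(1) decode_cmd_props)
    show "regs (c b) \<subseteq> {b..}"
      using f(2)[of "b+1"] decode_cmd_props(2)[of b] by (auto simp: c_def)
    fix s :: "nat \<Rightarrow> nat"
    assume z: "\<And>i. i > b \<Longrightarrow> s i = 0"
    let ?m = "fst (prod_decode (s b))" and ?n = "snd (prod_decode (s b))"
    have 1: "exec (Loop (b+2) (Inc b)) (s(b := 0, b+1 := ?m, b+2 := ?n)) = s(b := ?n, b+1 := ?m)"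
      using z by (subst exec_move) (auto simp: fun_eq_iff)
    have it: "(exec (cf (b+1)) ^^ k) (s(b := 0, b+1 := m)) = s(b := 0, b+1 := (f ^^ k) m)" for k m
    proof (induction k)
      case (Suc k)
      then show ?case using z by (simp add: f(3) fun_eq_iff)
    qed simp
    have 2: "exec (Loop b (cf (b+1))) (s(b := ?n, b+1 := ?m)) = s(b := 0, b+1 := (f ^^ ?n) ?m)"
    proof -
      have "exec (Loop b (cf (b+1))) (s(b := ?n, b+1 := ?m)) = (exec (cf (b+1)) ^^ ?n) (s(b := 0, b+1 := ?m))"
        unfolding exec_Loop by (simp add: fun_upd_twist)
      then show ?thesis by (simp only: it)
    qed
    have 3: "exec (Loop (b+1) (Inc b)) (s(b := 0, b+1 := (f ^^ ?n) ?m)) = s(b := (f ^^ ?n) ?m)"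
      using z by (subst exec_move) (auto simp: fun_eq_iff)
    show "exec (c b) s = s(b := (f ^^ ?n) ?m)"
      by (simp only: c_def exec.simps(2) exec_decode[of b s, OF z] 1 2 3)
  qed
qed

section \<open>Computable functions on encoded data\<close>

text \<open>
  Injectivity is all that is asked of an encoding: computability below speaks about codes of actual
  values only, so no decoder is needed.
\<close>

class codable =
  fixes enc :: "'a \<Rightarrow> nat"
  assumes enc_eq_iff [simp]: "enc x = enc y \<longleftrightarrow> x = y"

instantiation nat :: codable
begin
definition enc_nat :: "nat \<Rightarrow> nat" where [simp]: "enc_nat n = n"
instance by standard simp
end

instantiation bool :: codable
begin
definition enc_bool :: "bool \<Rightarrow> nat" where "enc_bool b = of_bool b"
instance by standard (simp add: enc_bool_def)
end

instantiation prod :: (codable, codable) codable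
begin
definition enc_prod :: "'a \<times> 'b \<Rightarrow> nat" where
  "enc_prod p = prod_encode (enc (fst p), enc (snd p))"
instance by standard (auto simp: enc_prod_def prod_eq_iff)
end

lemma inj_enc: "inj enc"
  by (simp add: inj_def)

instantiation list :: (codable) codable
begin
definition enc_list :: "'a list \<Rightarrow> nat" where
  "enc_list xs = list_encode (map enc xs)"
instance
  by standard (simp add: enc_list_def inj_map_eq_map[OF inj_enc] list_encode_eq)
end

lemma enc_Nil [simp]: "enc [] = 0"
  by (simp add: enc_list_def)

lemma enc_Cons: "enc (x # xs) = Suc (prod_encode (enc x, enc xs))"
  by (simp add: enc_list_def)

lemma enc_nat_list: "enc (xs :: nat list) = list_encode xs"
proof -
  have "map enc xs = xs" by (induction xs) auto
  then show ?thesis by (simp add: enc_list_def)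
qed

text \<open>
  Loop programs always halt, so these functions are total; for functions on the naturals they are
  the primitive recursive ones. The closure properties below are stated for functions of an environment
  \<open>x\<close>, which makes them usable as introduction rules for composite terms.
\<close>

definition computable :: "('a::codable \<Rightarrow> 'b::codable) \<Rightarrow> bool" where
  "computable f \<longleftrightarrow> (\<exists>g. loopable g \<and> (\<forall>x. g (enc x) = enc (f x)))"

lemma computableI: "loopable g \<Longrightarrow> (\<And>x. g (enc x) = enc (f x)) \<Longrightarrow> computable f"
  unfolding computable_def by blast

lemma computableE:
  assumes "computable f"
  obtains g where "loopable g" "\<And>x. g (enc x) = enc (f x)"
  using assms unfolding computable_def by blast

named_theorems computable_intros

lemma computable_id [computable_intros]: "computable (\<lambda>x. x)"
  by (rule computableI[OF loopable_id]) simp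

lemma loopable_const: "loopable (\<lambda>x. n)"
proof (induction n)
  case (Suc n)
  then show ?case by (rule loopable_comp[OF _ loopable_Suc])
qed (rule loopable_0)

lemma computable_const [computable_intros]: "computable (\<lambda>x. c)"
  by (rule computableI[OF loopable_const]) simp

lemma computable_comp: "computable f \<Longrightarrow> computable g \<Longrightarrow> computable (\<lambda>x. g (f x))"
  by (metis (no_types, lifting) computable_def loopable_comp)

lemma computable_Pair [computable_intros]:
  assumes "computable f" "computable g"
  shows "computable (\<lambda>x. (f x, g x))"
proof -
  obtain f' where "loopable f'" "\<And>x. f' (enc x) = enc (f x)"
    using computableE[OF assms(1)] by metis
  moreover obtain g' where "loopable g'" "\<And>x. g' (enc x) = enc (g x)"
    using computableE[OF assms(2)] by metis
  ultimately show ?thesis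
    by (intro computableI[OF loopable_pair[of f' g']]) (auto simp: enc_prod_def)
qed

lemma computable_fst [computable_intros]: "computable f \<Longrightarrow> computable (\<lambda>x. fst (f x))"
  by (erule computable_comp) (rule computableI[OF loopable_fst], simp add: enc_prod_def)

lemma computable_snd [computable_intros]: "computable f \<Longrightarrow> computable (\<lambda>x. snd (f x))"
  by (erule computable_comp) (rule computableI[OF loopable_snd], simp add: enc_prod_def)

lemma computable_Suc [computable_intros]: "computable f \<Longrightarrow> computable (\<lambda>x. Suc (f x))"
  by (erule computable_comp) (rule computableI[OF loopable_Suc], simp)

lemma computable_funpow1:
  fixes f :: "'a::codable \<Rightarrow> 'a"
  assumes "computable f"
  shows "computable (\<lambda>p. (f ^^ snd p) (fst p))"
proof -
  obtain f' where f: "loopable f'" "\<And>x. f' (enc x) = enc (f x)"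
    using assms unfolding computable_def by blast
  have "(f' ^^ n) (enc x) = enc ((f ^^ n) x)" for n x
    by (induction n) (auto simp: f)
  with f(1) show ?thesis
    by (intro computableI[OF loopable_iterate[OF f(1)]]) (simp add: enc_prod_def)
qed

lemma computable_comp2:
  assumes "computable (\<lambda>p. g (fst p) (snd p))" "computable a" "computable b"
  shows "computable (\<lambda>x. g (a x) (b x))"
  using computable_comp[OF computable_Pair[OF assms(2,3)] assms(1)] by simp

lemma computable_comp3:
  assumes "computable (\<lambda>p. g (fst p) (fst (snd p)) (snd (snd p)))"
    and "computable a" "computable b" "computable c"
  shows "computable (\<lambda>x. g (a x) (b x) (c x))"
  using computable_comp[OF computable_Pair[OF assms(2) computable_Pair[OF assms(3,4)]] assms(1)]
  by simp

lemma computable_funpow [computable_intros]: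
  fixes g :: "'a::codable \<Rightarrow> 'b::codable \<Rightarrow> 'b"
  assumes "computable (\<lambda>p. g (fst p) (snd p))" "computable n" "computable z"
  shows "computable (\<lambda>x. (g x ^^ n x) (z x))"
proof -
  \<comment> \<open>The step depends on the environment, which is therefore carried along in the iterated pair.\<close>
  let ?h = "\<lambda>p. (fst p, g (fst p) (snd p))"
  have "(?h ^^ k) (x, a) = (x, (g x ^^ k) a)" for k x a
    by (induction k) auto
  moreover have "computable (\<lambda>x. snd ((?h ^^ snd ((x, z x), n x)) (fst ((x, z x), n x))))"
    by (rule computable_snd, rule computable_comp[OF _ computable_funpow1])
      (intro computable_intros computable_comp2[OF assms(1)] assms(2,3))+
  ultimately show ?thesis by simp
qed

lemma computable_enc [computable_intros]: "computable f \<Longrightarrow> computable (\<lambda>x. enc (f x))"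
  by (erule computable_comp) (rule computableI[OF loopable_id], simp)

lemma computable_if [computable_intros]:
  assumes "computable b" "computable f" "computable g"
  shows "computable (\<lambda>x. if b x then f x else g x)"
proof -
  \<comment> \<open>Zero or one application of a constant function selects a branch.\<close>
  have "computable (\<lambda>x. ((\<lambda>_. f x) ^^ enc (b x)) (g x))"
    by (intro computable_intros assms computable_comp[OF _ assms(2)])
  moreover have "((\<lambda>_. f x) ^^ enc (b x)) (g x) = (if b x then f x else g x)" for x
    by (simp add: enc_bool_def)
  ultimately show ?thesis by simp
qed

lemma computable_not [computable_intros]: "computable b \<Longrightarrow> computable (\<lambda>x. \<not> b x)"
proof -
  assume "computable b"
  then have "computable (\<lambda>x. if b x then False else True)" by (intro computable_intros)
  moreover have "(\<lambda>x. if b x then False else True) = (\<lambda>x. \<not> b x)" by auto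
  ultimately show ?thesis by simp
qed

lemma computable_conj [computable_intros]:
  "computable b \<Longrightarrow> computable c \<Longrightarrow> computable (\<lambda>x. b x \<and> c x)"
proof -
  assume "computable b" "computable c"
  then have "computable (\<lambda>x. if b x then c x else False)" by (intro computable_intros)
  moreover have "(\<lambda>x. if b x then c x else False) = (\<lambda>x. b x \<and> c x)" by auto
  ultimately show ?thesis by simp
qed

lemma computable_disj [computable_intros]:
  "computable b \<Longrightarrow> computable c \<Longrightarrow> computable (\<lambda>x. b x \<or> c x)"
proof -
  assume "computable b" "computable c"
  then have "computable (\<lambda>x. if b x then True else c x)" by (intro computable_intros)
  moreover have "(\<lambda>x. if b x then True else c x) = (\<lambda>x. b x \<or> c x)" by auto
  ultimately show ?thesis by simp
qed

lemma computable_pred [computable_intros]: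
  assumes "computable f" shows "computable (\<lambda>x. f x - (1::nat))"
proof -
  have "((\<lambda>p. (Suc (fst p), fst p)) ^^ n) (0, 0::nat) = (n, n - 1)" for n
    by (induction n) auto
  then have "(\<lambda>x. f x - (1::nat)) = (\<lambda>x. snd (((\<lambda>p. (Suc (fst p), fst p)) ^^ f x) (0, 0::nat)))"
    by simp
  moreover have "computable \<dots>"
    by (intro computable_intros assms)
  ultimately show ?thesis by simp
qed

lemma computable_diff [computable_intros]:
  assumes "computable f" "computable g" shows "computable (\<lambda>x. f x - (g x :: nat))"
proof -
  have "((\<lambda>a. a - 1) ^^ n) m = m - n" for n m :: nat
    by (induction n) auto
  then have "(\<lambda>x. f x - g x) = (\<lambda>x. ((\<lambda>a. a - 1) ^^ g x) (f x))"
    by simp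
  moreover have "computable \<dots>"
    by (intro computable_intros assms)
  ultimately show ?thesis by simp
qed

lemma computable_is_zero:
  assumes "computable f" shows "computable (\<lambda>x. f x = (0::nat))"
proof -
  have "((\<lambda>_. False) ^^ n) True = (n = 0)" for n
    by (cases n) auto
  moreover have "computable (\<lambda>x. ((\<lambda>_. False) ^^ f x) True)"
    by (intro computable_intros assms)
  ultimately show ?thesis by simp
qed

lemma computable_le [computable_intros]:
  assumes "computable f" "computable g" shows "computable (\<lambda>x. f x \<le> (g x :: nat))"
  using computable_is_zero[OF computable_diff[OF assms]] by simp

lemma computable_eq [computable_intros]:
  assumes "computable f" "computable g" shows "computable (\<lambda>x. f x = g x)"
proof -
  have "computable (\<lambda>x. enc (f x) \<le> enc (g x) \<and> enc (g x) \<le> enc (f x))"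
    by (intro computable_intros assms)
  then show ?thesis by (simp flip: order_eq_iff)
qed

lemma computable_Cons [computable_intros]:
  assumes "computable f" "computable g" shows "computable (\<lambda>x. f x # g x)"
proof -
  obtain f' where "loopable f'" "\<And>x. f' (enc x) = enc (f x)" using computableE[OF assms(1)] by metis
  moreover obtain g' where "loopable g'" "\<And>x. g' (enc x) = enc (g x)" using computableE[OF assms(2)] by metis
  ultimately show ?thesis
    by (intro computableI[OF loopable_comp[OF loopable_pair[of f' g'] loopable_Suc]])
       (auto simp: enc_Cons)
qed

lemma computable_natE:
  assumes "computable (h :: nat \<Rightarrow> nat)" shows "loopable h"
proof -
  obtain g where "loopable g" "\<And>x. g (enc x) = enc (h x)" using computableE[OF assms] by metis
  moreover from this have "g = h" by (auto simp: fun_eq_iff)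
  ultimately show ?thesis by simp
qed

lemma loopable_pred: "loopable (\<lambda>n. n - 1)"
  by (rule computable_natE) (intro computable_intros)

lemma computable_hd [computable_intros]:
  assumes "computable f" shows "computable (\<lambda>x. hd (f x))"
proof -
  let ?d = "enc (hd [] :: 'b)"
  have "computable (\<lambda>n::nat. fst (prod_decode (n - 1)))"
    by (rule computableI[OF loopable_comp[OF loopable_pred loopable_fst]]) simp
  from computable_if[OF computable_is_zero[OF computable_id] computable_const[of ?d] this]
  have "loopable (\<lambda>n. if n = 0 then ?d else fst (prod_decode (n - 1)))"
    by (rule computable_natE)
  then have "computable (hd :: 'b list \<Rightarrow> 'b)"
  proof (rule computableI)
    show "(if enc x = 0 then ?d else fst (prod_decode (enc x - 1))) = enc (hd x)" for x :: "'b list"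
      by (cases x) (auto simp: enc_Cons)
  qed
  with assms show ?thesis by (rule computable_comp)
qed

lemma computable_tl [computable_intros]:
  assumes "computable f" shows "computable (\<lambda>x. tl (f x))"
proof -
  \<comment> \<open>The code 0 of the empty list decodes to a pair of zeros, so the empty list is its own tail.\<close>
  have "prod_encode (0, 0) = 0"
    by (simp add: prod_encode_def)
  then have "prod_decode 0 = (0, 0)"
    by (metis prod_encode_inverse)
  then have "snd (prod_decode (enc x - 1)) = enc (tl x)" for x :: "'b list"
    by (cases x) (auto simp: enc_Cons)
  then have "computable (tl :: 'b list \<Rightarrow> 'b list)"
    by (intro computableI[OF loopable_comp[OF loopable_pred loopable_snd]])
  with assms show ?thesis by (rule computable_comp)
qed

lemma length_le_enc: "length xs \<le> enc xs"
proof (induction xs)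
  case (Cons a xs)
  have "enc xs \<le> prod_encode (enc a, enc xs)"
    by (rule le_prod_encode_2)
  with Cons show ?case by (simp add: enc_Cons)
qed simp

text \<open>
  The state of the iteration is the rest of the list together with the accumulator. The code of a
  list bounds its length, and rounds after the list is used up change nothing.
\<close>

lemma computable_fold [computable_intros]:
  assumes "computable (\<lambda>p. f (fst p) (fst (snd p)) (snd (snd p)))" "computable l" "computable z"
  shows "computable (\<lambda>x. fold (f x) (l x) (z x))"
proof -
  let ?step = "\<lambda>x p. if fst p = [] then p else (tl (fst p), f x (hd (fst p)) (snd p))"
  have it: "(?step x ^^ n) (xs, a) = (drop n xs, fold (f x) (take n xs) a)" for x n xs a
  proof (induction n arbitrary: xs a)
    case (Suc n)
    show ?case
    proof (cases xs)
      case Nil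
      have "(?step x ^^ Suc n) ([], a) = (?step x ^^ n) ([], a)"
        by (simp add: funpow_Suc_right del: funpow.simps)
      then show ?thesis using Nil Suc[of "[]" a] by simp
    next
      case (Cons y ys)
      then have "(?step x ^^ Suc n) (xs, a) = (?step x ^^ n) (ys, f x y a)"
        by (simp only: funpow_Suc_right comp_apply) simp
      then show ?thesis using Cons Suc[of ys "f x y a"] by simp
    qed
  qed simp
  have "computable (\<lambda>x. snd ((?step x ^^ enc (l x)) (l x, z x)))"
    by (intro computable_intros computable_comp3[OF assms(1)] assms(2,3))
  moreover have "snd ((?step x ^^ enc (l x)) (l x, z x)) = fold (f x) (l x) (z x)" for x
    unfolding it by (simp add: length_le_enc)
  ultimately show ?thesis by simp
qed

lemma computable_rev [computable_intros]:
  assumes "computable l" shows "computable (\<lambda>x. rev (l x))"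
proof -
  have "computable (\<lambda>x. fold (\<lambda>a acc. a # acc) (l x) [])"
    by (intro computable_intros assms)
  then show ?thesis by (simp add: fold_Cons_rev)
qed

lemma computable_append [computable_intros]:
  assumes "computable l" "computable m" shows "computable (\<lambda>x. l x @ m x)"
proof -
  have "computable (\<lambda>x. fold (\<lambda>a acc. a # acc) (rev (l x)) (m x))"
    by (intro computable_intros assms)
  then show ?thesis by (simp add: fold_Cons_rev)
qed

lemma computable_map [computable_intros]:
  assumes "computable (\<lambda>p. f (fst p) (snd p))" "computable l"
  shows "computable (\<lambda>x. map (f x) (l x))"
proof -
  have "fold (\<lambda>a acc. f x a # acc) xs ys = rev (map (f x) xs) @ ys" for x xs ys
    by (induction xs arbitrary: ys) auto
  moreover have "computable (\<lambda>x. rev (fold (\<lambda>a acc. f x a # acc) (l x) []))"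
    by (intro computable_intros computable_comp2[OF assms(1)] assms(2))
  ultimately show ?thesis by simp
qed

lemma computable_concat [computable_intros]:
  assumes "computable l" shows "computable (\<lambda>x. concat (l x))"
proof -
  have "fold (\<lambda>a acc. acc @ a) xss ys = ys @ concat xss" for xss and ys :: "'b list"
    by (induction xss arbitrary: ys) auto
  moreover have "computable (\<lambda>x. fold (\<lambda>a acc. acc @ a) (l x) [])"
    by (intro computable_intros assms)
  ultimately show ?thesis by simp
qed

lemma computable_ball [computable_intros]:
  assumes "computable (\<lambda>p. P (fst p) (snd p))" "computable l"
  shows "computable (\<lambda>x. \<forall>a\<in>set (l x). P x a)"
proof -
  have "fold (\<lambda>a acc. acc \<and> P x a) xs b = (b \<and> (\<forall>a\<in>set xs. P x a))" for x xs b
    by (induction xs arbitrary: b) auto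
  moreover have "computable (\<lambda>x. fold (\<lambda>a acc. acc \<and> P x a) (l x) True)"
    by (intro computable_intros computable_comp2[OF assms(1)] assms(2))
  ultimately show ?thesis by simp
qed

lemma computable_bex [computable_intros]:
  assumes "computable (\<lambda>p. P (fst p) (snd p))" "computable l"
  shows "computable (\<lambda>x. \<exists>a\<in>set (l x). P x a)"
proof -
  have "computable (\<lambda>x. \<not> (\<forall>a\<in>set (l x). \<not> P x a))"
    by (intro computable_intros computable_comp2[OF assms(1)] assms(2))
  then show ?thesis by simp
qed

lemma computable_ex_less [computable_intros]:
  fixes n :: "'a::codable \<Rightarrow> nat"
  assumes "computable (\<lambda>p. P (fst p) (snd p))" "computable n"
  shows "computable (\<lambda>x. \<exists>k<n x. P x k)"
proof -
  have "((\<lambda>l. length l # l) ^^ m) [] = rev [0..<m]" for m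
    by (induction m) auto
  moreover have len: "computable (\<lambda>x. length (g x))" if "computable g" for g :: "'x::codable \<Rightarrow> nat list"
  proof -
    have "fold (\<lambda>_. Suc) xs m = length xs + m" for xs :: "nat list" and m
      by (induction xs arbitrary: m) auto
    moreover have "computable (\<lambda>x. fold (\<lambda>_ a. Suc a) (g x) 0)"
      by (intro computable_intros that)
    ultimately show ?thesis by simp
  qed
  moreover have "computable (\<lambda>x. \<exists>k\<in>set (((\<lambda>l. length l # l) ^^ n x) []). P x k)"
    by (intro computable_intros len computable_comp2[OF assms(1)] assms(2))
  ultimately show ?thesis by (simp add: Bex_def lessThan_def)
qed

lemma computable_nth_eq [computable_intros]:
  assumes "computable l" "computable i" "computable a"
  shows "computable (\<lambda>x. i x < length (l x) \<and> l x ! i x = a x)"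
proof -
  have "computable (\<lambda>x. (tl ^^ i x) (l x) \<noteq> [] \<and> hd ((tl ^^ i x) (l x)) = a x)"
    by (intro computable_intros assms)
  moreover have "(tl ^^ n) xs = drop n xs" for n and xs :: "'b list"
    by (induction n) (auto simp: drop_Suc tl_drop)
  ultimately show ?thesis
    by (simp add: hd_drop_conv_nth not_le cong: conj_cong)
qed

lemma computable_n_lists [computable_intros]:
  assumes "computable n" "computable l"
  shows "computable (\<lambda>x. List.n_lists (n x) (l x))"
proof -
  have "((\<lambda>acc. concat (map (\<lambda>ys. map (\<lambda>y. y # ys) xs) acc)) ^^ m) [[]] = List.n_lists m xs"
    for m and xs :: "'b list"
    by (induction m) auto
  moreover have "computable (\<lambda>x. ((\<lambda>acc. concat (map (\<lambda>ys. map (\<lambda>y. y # ys) (l x)) acc)) ^^ n x) [[]])"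
    by (intro computable_intros assms(1) computable_comp[OF _ assms(2)])
  ultimately show ?thesis by simp
qed

lemma computable_zip [computable_intros]:
  assumes "computable l" "computable m"
  shows "computable (\<lambda>x. zip (l x) (m x))"
proof -
  let ?f = "\<lambda>a p. if fst p = [] then p else (tl (fst p), (a, hd (fst p)) # snd p)"
  have it: "snd (fold ?f xs (ys, out)) = rev (zip xs ys) @ out"
    for xs :: "'b list" and ys :: "'c list" and out
  proof (induction xs arbitrary: ys out)
    case (Cons x xs)
    then show ?case by (cases ys) auto
  qed simp
  have "computable (\<lambda>x. rev (snd (fold ?f (l x) (m x, []))))"
    by (intro computable_intros assms)
  then show ?thesis by (simp add: it)
qed

lemma computable_prod_decode [computable_intros]:
  assumes "computable f" shows "computable (\<lambda>x. prod_decode (f x))"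
proof -
  have "computable prod_decode"
    by (rule computableI[OF loopable_id]) (simp add: enc_prod_def)
  with assms show ?thesis by (rule computable_comp)
qed

lemma computable_list_decode [computable_intros]:
  assumes "computable f" shows "computable (\<lambda>x. list_decode (f x))"
proof -
  have "computable list_decode"
    by (rule computableI[OF loopable_id]) (simp add: enc_nat_list)
  with assms show ?thesis by (rule computable_comp)
qed

text \<open>
  A finite table is a nested conditional.
\<close>

lemma computable_table:
  assumes "finite D" "computable l"
  shows "computable (\<lambda>x. if l x \<in> D then f (l x) else d)"
  using assms(1)
proof (induction D)
  case (insert a D)
  have "computable (\<lambda>x. if l x = a then f a else if l x \<in> D then f (l x) else d)"
    by (intro computable_if computable_eq computable_const insert assms(2))
  moreover have "(if y = a then f a else if y \<in> D then f y else d)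
      = (if y \<in> insert a D then f y else d)" for y
    by simp
  ultimately show ?case by simp
qed (simp add: computable_const)

section \<open>Running programs on Turing machines\<close>

text \<open>
  The control state of the machine is the stack of commands that remain to be executed. Being
  countable, these states can be numbered.
\<close>

datatype control = Accept | Reject | Run "cmd list"

instance control :: countable
  by countable_datatype

definition keep :: "'c tape_symbol list \<Rightarrow> ('c tape_symbol \<times> direction) list" where
  "keep ss = map (\<lambda>s. (s, Stay)) ss"

text \<open>
  Register \<open>r\<close> is held on tape \<open>r\<close>, as the number of consecutive symbols \<open>Aux 0\<close> from the head to the right.
  Decrementing erases the scanned symbol and steps right; incrementing steps left and then
  writes a symbol. Tape 0 holds the input, and \<open>h\<close> gives the command to be executed for each letter read.
\<close>

fun control_step :: "('c \<Rightarrow> cmd) \<Rightarrow> control \<Rightarrow> 'c tape_symbol list \<Rightarrow>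
    control \<times> ('c tape_symbol \<times> direction) list" where
  "control_step h (Run (Skip # ks)) ss = (Run ks, keep ss)"
| "control_step h (Run (Inc r # ks)) ss = (Run (Mark r # ks), (keep ss)[r := (ss ! r, MoveLeft)])"
| "control_step h (Run (Mark r # ks)) ss = (Run ks, (keep ss)[r := (Aux 0, Stay)])"
| "control_step h (Run (Seq c d # ks)) ss = (Run (c # d # ks), keep ss)"
| "control_step h (Run (IfDec r c d # ks)) ss =
     (if ss ! r = Aux 0 then (Run (c # ks), (keep ss)[r := (Blank, MoveRight)])
      else (Run (d # ks), keep ss))"
| "control_step h (Run (Loop r c # ks)) ss =
     (if ss ! r = Aux 0 then (Run (c # Loop r c # ks), (keep ss)[r := (Blank, MoveRight)])
      else (Run ks, keep ss))"
| "control_step h (Run (Forever c # ks)) ss = (Run (c # Forever c # ks), keep ss)"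
| "control_step h (Run (AcceptIf r # ks)) ss = (if ss ! r = Aux 0 then Accept else Run ks, keep ss)"
| "control_step h (Run (RejectIf r # ks)) ss = (if ss ! r = Aux 0 then Reject else Run ks, keep ss)"
| "control_step h (Run (ReadAll # ks)) ss =
     (case ss ! 0 of
        Letter a \<Rightarrow> (Run (h a # ReadAll # ks), (keep ss)[0 := (Blank, MoveRight)])
      | _ \<Rightarrow> (Run ks, keep ss))"
| "control_step h q ss = (Reject, keep ss)"

text \<open>
  The stacks that occur while \<open>c\<close> is executed on top of \<open>ks\<close>. There are finitely many, although a loop
  pushes itself again and again.
\<close>

fun conts :: "cmd \<Rightarrow> cmd list \<Rightarrow> cmd list set" where
  "conts (Inc r) ks = {Inc r # ks, Mark r # ks}"
| "conts (Seq c d) ks = insert (Seq c d # ks) (conts c (d # ks) \<union> conts d ks)"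
| "conts (IfDec r c d) ks = insert (IfDec r c d # ks) (conts c ks \<union> conts d ks)"
| "conts (Loop r c) ks = insert (Loop r c # ks) (conts c (Loop r c # ks))"
| "conts (Forever c) ks = insert (Forever c # ks) (conts c (Forever c # ks))"
| "conts c ks = {c # ks}"

fun reads :: "cmd \<Rightarrow> bool" where
  "reads ReadAll \<longleftrightarrow> True"
| "reads (Seq c d) \<longleftrightarrow> reads c \<or> reads d"
| "reads (IfDec r c d) \<longleftrightarrow> reads c \<or> reads d"
| "reads (Loop r c) \<longleftrightarrow> reads c"
| "reads (Forever c) \<longleftrightarrow> reads c"
| "reads _ \<longleftrightarrow> False"

lemma finite_conts [simp]: "finite (conts c ks)"
  by (induction c arbitrary: ks) auto

lemma self_in_conts: "c # ks \<in> conts c ks"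
  by (cases c) auto

text \<open>
  Reading is excluded because it pushes commands that do not occur in the program.
\<close>

lemma conts_closed:
  "\<not> reads c \<Longrightarrow> x \<in> conts c ks \<Longrightarrow>
    fst (control_step h (Run x) ss) \<in> Run ` insert ks (conts c ks) \<union> {Accept, Reject}"
proof (induction c arbitrary: ks)
  case (Seq c d)
  have "d # ks \<in> conts d ks" by (rule self_in_conts)
  moreover have "c # d # ks \<in> conts c (d # ks)" by (rule self_in_conts)
  ultimately show ?case using Seq.IH(1)[of "d # ks"] Seq.IH(2)[of ks] Seq.prems by auto
next
  case (IfDec r c d)
  consider "x = IfDec r c d # ks" | "x \<in> conts c ks" | "x \<in> conts d ks"
    using IfDec.prems by auto
  then show ?case
  proof cases
    case 1
    then show ?thesis using self_in_conts[of c ks] self_in_conts[of d ks]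
      by (cases "ss ! r = Aux 0") auto
  next
    case 2
    then show ?thesis using IfDec.IH(1)[of ks] IfDec.prems by auto
  next
    case 3
    then show ?thesis using IfDec.IH(2)[of ks] IfDec.prems by auto
  qed
next
  case (Loop r c)
  consider "x = Loop r c # ks" | "x \<in> conts c (Loop r c # ks)"
    using Loop.prems by auto
  then show ?case
  proof cases
    case 1
    then show ?thesis using self_in_conts[of c "Loop r c # ks"]
      by (cases "ss ! r = Aux 0") auto
  next
    case 2
    then show ?thesis using Loop.IH[of "Loop r c # ks"] Loop.prems by auto
  qed
next
  case (Forever c)
  then show ?case using Forever.IH[of "Forever c # ks"] self_in_conts[of c "Forever c # ks"] by auto
qed auto

lemma length_control_step: "length (snd (control_step h q ss)) = length ss"
  by (induction h q ss rule: control_step.induct) (auto simp: keep_def split: tape_symbol.splits)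

lemma keep_symbols:
  "fst ` set (keep ss) \<subseteq> insert Blank (insert (Aux 0) (set ss))"
  "fst ` set ((keep ss)[r := (Blank, d)]) \<subseteq> insert Blank (insert (Aux 0) (set ss))"
  "fst ` set ((keep ss)[r := (Aux 0, d)]) \<subseteq> insert Blank (insert (Aux 0) (set ss))"
  "fst ` set ((keep ss)[r := (ss ! r, d)]) \<subseteq> insert Blank (insert (Aux 0) (set ss))"
proof -
  have keep: "fst ` set (keep ss) \<subseteq> set ss" by (auto simp: keep_def)
  have upd: "fst ` set ((keep ss)[r := (s, d)]) \<subseteq> insert s (set ss)" for s
    using set_update_subset_insert[of "keep ss" r "(s, d)"] by (auto simp: keep_def)
  show "fst ` set (keep ss) \<subseteq> insert Blank (insert (Aux 0) (set ss))"
    by (rule order_trans[OF keep]) auto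
  show "fst ` set ((keep ss)[r := (Blank, d)]) \<subseteq> insert Blank (insert (Aux 0) (set ss))"
    by (rule order_trans[OF upd]) auto
  show "fst ` set ((keep ss)[r := (Aux 0, d)]) \<subseteq> insert Blank (insert (Aux 0) (set ss))"
    by (rule order_trans[OF upd]) auto
  show "fst ` set ((keep ss)[r := (ss ! r, d)]) \<subseteq> insert Blank (insert (Aux 0) (set ss))"
  proof (cases "r < length ss")
    case True
    then show ?thesis by (intro order_trans[OF upd]) auto
  next
    case False
    then have "(keep ss)[r := (ss ! r, d)] = keep ss" by (simp add: list_update_beyond keep_def)
    then show ?thesis using order_trans[OF keep, of "insert Blank (insert (Aux 0) (set ss))"] by auto
  qed
qed

text \<open>
  With the previous lemmas this makes the command machine a legitimate machine: states, symbols and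
  the number of actions stay within the declared bounds.
\<close>

lemma symbols_control_step:
  "fst ` set (snd (control_step h q ss)) \<subseteq> insert Blank (insert (Aux 0) (set ss))"
proof (induction h q ss rule: control_step.induct)
  case (10 h ks ss)
  then show ?case using keep_symbols[of ss] by (cases "ss ! 0") simp_all
qed (use keep_symbols in \<open>simp_all only: control_step.simps snd_conv if_distrib[of snd] split: if_split\<close>, (intro conjI impI keep_symbols)+)

definition cmd_machine :: "nat \<Rightarrow> 'c set \<Rightarrow> ('c \<Rightarrow> cmd) \<Rightarrow> cmd \<Rightarrow> 'c tm" where
  "cmd_machine k \<Sigma> h c =
     \<lparr>tm_tapes = k,
      tm_states = to_nat ` ({Accept, Reject} \<union> Run ` ({[], [ReadAll, c]} \<union> conts c [] \<union>
        (\<Union>a\<in>\<Sigma>. conts (h a) [ReadAll, c]))),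
      tm_symbols = insert Blank (insert (Aux 0) (Letter ` \<Sigma>)),
      tm_start = to_nat (Run [ReadAll, c]),
      tm_accept = to_nat Accept,
      tm_reject = to_nat Reject,
      tm_queries = {},
      tm_trans = (\<lambda>q ss. map_prod to_nat id (control_step h (from_nat q) ss)),
      tm_answer = (\<lambda>_ _. 0)\<rparr>"

lemma plain_cmd_machine:
  assumes "finite \<Sigma>" "k > 0" "\<not> reads c" "\<And>a. a \<in> \<Sigma> \<Longrightarrow> \<not> reads (h a)"
  shows "plain_tm \<Sigma> (cmd_machine k \<Sigma> h c)"
proof -
  let ?Q = "{Accept, Reject} \<union> Run ` ({[], [ReadAll, c]} \<union> conts c [] \<union>
        (\<Union>a\<in>\<Sigma>. conts (h a) [ReadAll, c]))"
  have cl: "fst (control_step h q ss) \<in> ?Q"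
    if q: "q \<in> ?Q" and ss: "length ss = k" "set ss \<subseteq> insert Blank (insert (Aux 0) (Letter ` \<Sigma>))" for q ss
  proof -
    consider "q = Accept" | "q = Reject" | "q = Run []" | "q = Run [ReadAll, c]"
      | x where "q = Run x" "x \<in> conts c []"
      | a x where "q = Run x" "a \<in> \<Sigma>" "x \<in> conts (h a) [ReadAll, c]" using q by auto
    then show ?thesis
    proof cases
      case 4
      have "ss ! 0 \<in> insert Blank (insert (Aux 0) (Letter ` \<Sigma>))"
        using ss(1) \<open>k > 0\<close> by (intro subsetD[OF ss(2)] nth_mem) simp
      then consider "ss ! 0 = Blank" | "ss ! 0 = Aux 0" | a where "a \<in> \<Sigma>" "ss ! 0 = Letter a"
        by auto
      then show ?thesis
      proof cases
        case (3 a)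
        then show ?thesis using 4 self_in_conts[of "h a" "[ReadAll, c]"] by auto
      qed (use 4 self_in_conts[of c "[]"] in auto)
    next
      case (5 x)
      then show ?thesis using conts_closed[OF assms(3), of x "[]" h ss] by auto
    next
      case (6 a x)
      then show ?thesis using conts_closed[OF assms(4), of a x "[ReadAll, c]" h ss] by auto
    qed auto
  qed
  have tr: "case map_prod to_nat id (control_step h (from_nat q) ss) of
      (q', acts) \<Rightarrow> q' \<in> to_nat ` ?Q \<and> length acts = k \<and>
        fst ` set acts \<subseteq> insert Blank (insert (Aux 0) (Letter ` \<Sigma>))"
    if q: "q \<in> to_nat ` ?Q" and ss: "length ss = k" "set ss \<subseteq> insert Blank (insert (Aux 0) (Letter ` \<Sigma>))" for q ss
  proof -
    obtain q0 where q0: "q = to_nat q0" "q0 \<in> ?Q" using q by blast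
    obtain q' acts where e: "control_step h q0 ss = (q', acts)" by fastforce
    have "q' \<in> ?Q" using cl[OF q0(2) ss] unfolding e fst_conv .
    moreover have "length acts = k" using length_control_step[of h q0 ss] ss(1) unfolding e by simp
    moreover have "fst ` set acts \<subseteq> insert Blank (insert (Aux 0) (Letter ` \<Sigma>))"
      using symbols_control_step[of h q0 ss] ss(2) unfolding e by auto
    ultimately show ?thesis
      unfolding q0(1) from_nat_to_nat e map_prod_simp prod.case id_apply by blast
  qed
  have "finite ?Q" using assms(1) by auto
  then have "finite (to_nat ` ?Q)" by blast
  then show ?thesis
    using tr assms(1,2)
    by (simp add: plain_tm_def oracle_tm_def cmd_machine_def image_Un) blast
qed

definition reg_value :: "'c tape \<Rightarrow> nat" where
  "reg_value t = length (takeWhile (\<lambda>s. s = Aux 0) (snd t))"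

definition unread :: "'c tape \<Rightarrow> 'c tape_symbol list" where
  "unread t = takeWhile (\<lambda>s. s \<noteq> Blank) (snd t)"

text \<open>
  Tape 0 holds no register; it holds the unread part \<open>w\<close> of the input.
\<close>

definition represents :: "nat \<Rightarrow> 'c tape list \<Rightarrow> (nat \<Rightarrow> nat) \<Rightarrow> 'c list \<Rightarrow> bool" where
  "represents k ts s w \<longleftrightarrow> 0 < k \<and> length ts = k \<and> (\<forall>i. 0 < i \<and> i < k \<longrightarrow> reg_value (ts ! i) = s i) \<and>
     unread (ts ! 0) = map Letter w"

definition stay :: "'c tape \<Rightarrow> 'c tape" where
  "stay t = write_and_move (scan (snd t), Stay) t"

lemma reg_value_stay [simp]: "reg_value (stay t) = reg_value t"
  by (cases t) (auto simp: stay_def reg_value_def scan_def split: list.splits)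

lemma unread_stay [simp]: "unread (stay t) = unread t"
  by (cases t) (auto simp: stay_def unread_def scan_def split: list.splits)

lemma scan_Aux0_iff: "scan (snd t) = Aux 0 \<longleftrightarrow> reg_value t > 0"
  by (auto simp: reg_value_def scan_def split: list.splits)

lemma reg_value_dec:
  "scan (snd t) = Aux 0 \<Longrightarrow> reg_value (write_and_move (Blank, MoveRight) t) = reg_value t - 1"
  by (cases t) (auto simp: reg_value_def scan_def split: list.splits)

lemma reg_value_inc:
  "reg_value (write_and_move (Aux 0, Stay) (write_and_move (scan (snd t), MoveLeft) t)) = Suc (reg_value t)"
  by (cases t) (auto simp: reg_value_def scan_def split: list.splits)

lemma unread_advance:
  "unread t = a # w \<Longrightarrow> unread (write_and_move (Blank, MoveRight) t) = w"
  by (cases t; cases "snd t") (auto simp: unread_def split: if_splits)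

lemma map2_keep: "map2 write_and_move (keep (map (scan \<circ> snd) ts)) ts = map stay ts"
  by (rule nth_equalityI) (auto simp: keep_def stay_def)

lemma map2_keep_update:
  "r < length ts \<Longrightarrow> map2 write_and_move ((keep (map (scan \<circ> snd) ts))[r := a]) ts
    = (map stay ts)[r := write_and_move a (ts ! r)]"
  by (rule nth_equalityI) (auto simp: keep_def stay_def nth_list_update)

lemma represents_stay: "represents k ts s w \<Longrightarrow> represents k (map stay ts) s w"
  by (auto simp: represents_def)

lemma represents_update:
  "represents k ts s w \<Longrightarrow> 0 < r \<Longrightarrow> r < k \<Longrightarrow> reg_value t = v \<Longrightarrow>
    represents k ((map stay ts)[r := t]) (s(r := v)) w"
  by (auto simp: represents_def nth_list_update)

text \<open>
  The machine decreases the counter of a loop round by round, whereas \<open>exec\<close> clears it at once. The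
  two agree because the body neither reads nor changes the counter.
\<close>

lemma exec_frame:
  "loop_program c \<Longrightarrow> r \<notin> regs c \<Longrightarrow> exec c (s(r := v)) = (exec c s)(r := v)"
proof (induction c arbitrary: s)
  case (Inc r')
  then show ?case by (auto simp: fun_eq_iff)
next
  case (IfDec r' c d)
  then have "r \<noteq> r'" by simp
  then have r': "(s(r := v)) r' = s r'"
    and tw: "s(r := v, r' := s r' - 1) = s(r' := s r' - 1, r := v)"
    by (simp, intro fun_upd_twist)
  from IfDec show ?case
    by (simp only: exec.simps r' tw regs.simps loop_program.simps insert_iff Un_iff de_Morgan_disj
        simp_thms split: if_split) blast
next
  case (Loop r' c)
  then have "r \<noteq> r'" by simp
  then have r': "(s(r := v)) r' = s r'" and tw: "s(r := v, r' := 0) = s(r' := 0, r := v)"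
    by (simp, intro fun_upd_twist)
  have "(exec c ^^ n) (s(r := v)) = ((exec c ^^ n) s)(r := v)" for n s
    by (induction n) (use Loop in auto)
  then show ?case by (simp only: exec.simps r' tw)
qed auto

locale cmd_simulation =
  fixes k :: nat and \<Sigma> :: "'c set" and h :: "'c \<Rightarrow> cmd" and c0 :: cmd
begin

abbreviation M :: "'c tm" where "M \<equiv> cmd_machine k \<Sigma> h c0"

definition reach :: "control \<Rightarrow> 'c tape list \<Rightarrow> control \<Rightarrow> 'c tape list \<Rightarrow> bool" where
  "reach q ts q' ts' \<longleftrightarrow> (\<exists>n. (tm_step M {} ^^ n) (to_nat q, ts) = (to_nat q', ts'))"

lemma reach_trans:
  assumes "reach q ts q' ts'" "reach q' ts' q'' ts''" shows "reach q ts q'' ts''"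
proof -
  obtain m n where "(tm_step M {} ^^ m) (to_nat q, ts) = (to_nat q', ts')"
    "(tm_step M {} ^^ n) (to_nat q', ts') = (to_nat q'', ts'')"
    using assms unfolding reach_def by blast
  then have "(tm_step M {} ^^ (n + m)) (to_nat q, ts) = (to_nat q'', ts'')"
    by (simp add: funpow_add)
  then show ?thesis unfolding reach_def by blast
qed

lemma reach_step:
  assumes "control_step h (Run x) (map (scan \<circ> snd) ts) = (q', acts)"
  shows "reach (Run x) ts q' (map2 write_and_move acts ts)"
proof -
  have "tm_step M {} (to_nat (Run x), ts) = (to_nat q', map2 write_and_move acts ts)"
    using assms by (simp add: cmd_machine_def)
  then show ?thesis unfolding reach_def by (intro exI[of _ 1]) simp
qed

lemma reach_keep:
  assumes "control_step h (Run x) (map (scan \<circ> snd) ts) = (q', keep (map (scan \<circ> snd) ts))"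
  shows "reach (Run x) ts q' (map stay ts)"
  using reach_step[OF assms] by (simp add: map2_keep)

lemma reach_update:
  assumes "control_step h (Run x) (map (scan \<circ> snd) ts) = (q', (keep (map (scan \<circ> snd) ts))[r := a])"
    and "r < length ts"
  shows "reach (Run x) ts q' ((map stay ts)[r := write_and_move a (ts ! r)])"
  using reach_step[OF assms(1)] by (simp add: map2_keep_update assms(2))

text \<open>
  \<open>IfDec\<close> and \<open>Loop\<close> treat a positive register alike; the premise \<open>step\<close> abstracts from the command.
\<close>

lemma reach_Dec:
  assumes rep: "represents k ts s w" and r: "0 < r" "r < k" and pos: "s r > 0"
    and step: "\<And>ss. ss ! r = Aux 0 \<Longrightarrow>
      control_step h (Run x) ss = (q', (keep ss)[r := (Blank, MoveRight)])"
  shows "\<exists>ts'. reach (Run x) ts q' ts' \<and> represents k ts' (s(r := s r - 1)) w"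
proof -
  have len: "r < length ts" and val: "reg_value (ts ! r) = s r"
    using rep r by (auto simp: represents_def)
  have sc: "scan (snd (ts ! r)) = Aux 0" using val pos by (simp add: scan_Aux0_iff)
  have "reach (Run x) ts q' ((map stay ts)[r := write_and_move (Blank, MoveRight) (ts ! r)])"
    using sc len by (intro reach_update step) auto
  moreover have "represents k ((map stay ts)[r := write_and_move (Blank, MoveRight) (ts ! r)])
      (s(r := s r - 1)) w"
    using reg_value_dec[OF sc] val by (intro represents_update rep r) simp
  ultimately show ?thesis by blast
qed

lemma reach_Zero:
  assumes rep: "represents k ts s w" and r: "0 < r" "r < k" and zero: "s r = 0"
    and step: "\<And>ss. ss ! r \<noteq> Aux 0 \<Longrightarrow> control_step h (Run x) ss = (q', keep ss)"
  shows "\<exists>ts'. reach (Run x) ts q' ts' \<and> represents k ts' s w"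
proof -
  have len: "r < length ts" and val: "reg_value (ts ! r) = s r"
    using rep r by (auto simp: represents_def)
  have sc: "scan (snd (ts ! r)) \<noteq> Aux 0" using val zero by (simp add: scan_Aux0_iff)
  have "reach (Run x) ts q' (map stay ts)"
    using sc len by (intro reach_keep step) auto
  then show ?thesis using represents_stay[OF rep] by blast
qed

lemma reach_always:
  assumes rep: "represents k ts s w"
    and step: "\<And>ss. control_step h (Run x) ss = (q', keep ss)"
  shows "\<exists>ts'. reach (Run x) ts q' ts' \<and> represents k ts' s w"
  using reach_keep[OF step] represents_stay[OF rep] by blast

lemma simulation:
  assumes "loop_program c" "regs c \<subseteq> {0<..<k}" "represents k ts s w"
  shows "\<exists>ts'. reach (Run (c # ks)) ts (Run ks) ts' \<and> represents k ts' (exec c s) w"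
  using assms
proof (induction c arbitrary: ks ts s)
  case Skip
  then show ?case using reach_always[of ts s w "Skip # ks" "Run ks"] by simp
next
  case (Inc r)
  then have r: "0 < r" "r < k" and len: "r < length ts" and val: "reg_value (ts ! r) = s r"
    by (auto simp: represents_def)
  let ?t = "write_and_move (scan (snd (ts ! r)), MoveLeft) (ts ! r)"
  let ?ts1 = "(map stay ts)[r := ?t]"
  let ?ts2 = "(map stay ?ts1)[r := write_and_move (Aux 0, Stay) (?ts1 ! r)]"
  have 1: "reach (Run (Inc r # ks)) ts (Run (Mark r # ks)) ?ts1"
    using len by (intro reach_update) simp_all
  have 2: "reach (Run (Mark r # ks)) ?ts1 (Run ks) ?ts2"
    using len by (intro reach_update) simp_all
  have "represents k ?ts1 (s(r := reg_value ?t)) w"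
    using Inc r by (intro represents_update) auto
  then have "represents k ?ts2 (s(r := reg_value ?t, r := Suc (s r))) w"
    by (rule represents_update[OF _ r]) (use len in \<open>simp add: reg_value_inc val\<close>)
  then have "represents k ?ts2 (exec (Inc r) s) w"
    by (simp only: exec.simps fun_upd_upd)
  with reach_trans[OF 1 2] show ?case by blast
next
  case (Seq c d)
  obtain ts0 where 0: "reach (Run (Seq c d # ks)) ts (Run (c # d # ks)) ts0" "represents k ts0 s w"
    using reach_always[OF Seq.prems(3), of "Seq c d # ks" "Run (c # d # ks)"] by auto
  obtain ts1 where 1: "reach (Run (c # d # ks)) ts0 (Run (d # ks)) ts1" "represents k ts1 (exec c s) w"
    using Seq.IH(1)[OF _ _ 0(2), of "d # ks"] Seq.prems by auto
  obtain ts2 where 2: "reach (Run (d # ks)) ts1 (Run ks) ts2" "represents k ts2 (exec d (exec c s)) w"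
    using Seq.IH(2)[OF _ _ 1(2), of ks] Seq.prems by auto
  show ?case using reach_trans[OF 0(1) reach_trans[OF 1(1) 2(1)]] 2(2) by auto
next
  case (IfDec r c d)
  show ?case
  proof (cases "s r = 0")
    case True
    obtain ts0 where 0: "reach (Run (IfDec r c d # ks)) ts (Run (d # ks)) ts0" "represents k ts0 s w"
      using reach_Zero[OF IfDec.prems(3) _ _ True, of "IfDec r c d # ks" "Run (d # ks)"] IfDec.prems by auto
    obtain ts1 where 1: "reach (Run (d # ks)) ts0 (Run ks) ts1" "represents k ts1 (exec d s) w"
      using IfDec.IH(2)[OF _ _ 0(2), of ks] IfDec.prems by auto
    show ?thesis using reach_trans[OF 0(1) 1(1)] 1(2) True by auto
  next
    case False
    have sub: "loop_program c" "regs c \<subseteq> {0<..<k}" using IfDec.prems by auto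
    obtain ts0 where 0: "reach (Run (IfDec r c d # ks)) ts (Run (c # ks)) ts0"
        "represents k ts0 (s(r := s r - 1)) w"
      using reach_Dec[OF IfDec.prems(3), of r "IfDec r c d # ks" "Run (c # ks)"] False IfDec.prems by auto
    obtain ts1 where 1: "reach (Run (c # ks)) ts0 (Run ks) ts1"
        "represents k ts1 (exec c (s(r := s r - 1))) w"
      using IfDec.IH(1)[OF sub 0(2), of ks] by blast
    have "exec (IfDec r c d) s = exec c (s(r := s r - 1))" using False by simp
    then show ?thesis using reach_trans[OF 0(1) 1(1)] 1(2) by metis
  qed
next
  case (Loop r c)
  have r: "0 < r" "r < k" "r \<notin> regs c" using Loop.prems by auto
  have sub: "loop_program c" "regs c \<subseteq> {0<..<k}" using Loop.prems by auto
  have "\<exists>ts'. reach (Run (Loop r c # ks)) ts (Run ks) ts' \<and> represents k ts' (exec (Loop r c) s) w"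
    if "s r = n" "represents k ts s w" for n ts s
    using that
  proof (induction n arbitrary: ts s)
    case 0
    then have "exec (Loop r c) s = s" by auto
    then show ?case
      using reach_Zero[OF 0(2) r(1,2) 0(1), of "Loop r c # ks" "Run ks"] by simp
  next
    case (Suc n)
    obtain ts0 where 0: "reach (Run (Loop r c # ks)) ts (Run (c # Loop r c # ks)) ts0"
        "represents k ts0 (s(r := n)) w"
      using reach_Dec[OF Suc.prems(2) r(1,2), of "Loop r c # ks" "Run (c # Loop r c # ks)"] Suc.prems
      by auto
    obtain ts1 where 1: "reach (Run (c # Loop r c # ks)) ts0 (Run (Loop r c # ks)) ts1"
        "represents k ts1 (exec c (s(r := n))) w"
      using Loop.IH[OF sub 0(2), of "Loop r c # ks"] by blast
    have fr: "exec c (s(r := v)) = (exec c s)(r := v)" for v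
      using Loop.prems r by (intro exec_frame) auto
    have at_r: "exec c (s(r := n)) r = n" unfolding fr by simp
    obtain ts2 where 2: "reach (Run (Loop r c # ks)) ts1 (Run ks) ts2"
        "represents k ts2 (exec (Loop r c) (exec c (s(r := n)))) w"
      using Suc.IH[OF at_r 1(2)] by blast
    have "exec (Loop r c) (exec c (s(r := n))) = exec (Loop r c) s"
      by (simp only: exec.simps Suc.prems(1) fr fun_upd_same fun_upd_upd funpow_Suc_right comp_apply)
    then show ?case using reach_trans[OF 0(1) reach_trans[OF 1(1) 2(1)]] 2(2) by metis
  qed
  then show ?case using Loop.prems(3) by blast
qed auto

lemma simulation_ReadAll:
  assumes "\<And>a. a \<in> set w \<Longrightarrow> loop_program (h a) \<and> regs (h a) \<subseteq> {0<..<k}" "represents k ts s w"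
  shows "\<exists>ts'. reach (Run (ReadAll # ks)) ts (Run ks) ts' \<and>
    represents k ts' (fold (\<lambda>a. exec (h a)) w s) []"
  using assms
proof (induction w arbitrary: ts s)
  case Nil
  then have len: "0 < length ts" and u: "unread (ts ! 0) = []"
    by (auto simp: represents_def)
  then have "scan (snd (ts ! 0)) = Blank"
    by (auto simp: unread_def scan_def split: list.splits if_splits)
  then have "reach (Run (ReadAll # ks)) ts (Run ks) (map stay ts)"
    using len by (intro reach_keep) simp
  then show ?case using represents_stay[OF Nil(2)] by auto
next
  case (Cons a w)
  then have len: "0 < length ts" and u: "unread (ts ! 0) = Letter a # map Letter w"
    by (auto simp: represents_def)
  have sc: "scan (snd (ts ! 0)) = Letter a"
    using u by (auto simp: unread_def scan_def split: list.splits if_splits)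
  let ?ts0 = "(map stay ts)[0 := write_and_move (Blank, MoveRight) (ts ! 0)]"
  have 0: "reach (Run (ReadAll # ks)) ts (Run (h a # ReadAll # ks)) ?ts0"
    using len sc by (intro reach_update) simp_all
  have r0: "represents k ?ts0 s w"
    using Cons.prems(2) unread_advance[OF u] by (auto simp: represents_def)
  obtain ts1 where 1: "reach (Run (h a # ReadAll # ks)) ?ts0 (Run (ReadAll # ks)) ts1"
      "represents k ts1 (exec (h a) s) w"
    using simulation[OF _ _ r0, of "h a" "ReadAll # ks"] Cons.prems(1) by auto
  obtain ts2 where 2: "reach (Run (ReadAll # ks)) ts1 (Run ks) ts2"
      "represents k ts2 (fold (\<lambda>a. exec (h a)) w (exec (h a) s)) []"
    using Cons.IH[OF _ 1(2)] Cons.prems(1) by auto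
  show ?case using reach_trans[OF 0 reach_trans[OF 1(1) 2(1)]] 2(2) by auto
qed

end

text \<open>
  The form in which computable functions are used on a machine: the argument is placed in register
  \<open>b\<close>, and the registers below \<open>b\<close> may hold other data. Register 0 is avoided, as tape 0 is the input.
\<close>

definition computes_at :: "nat \<Rightarrow> cmd \<Rightarrow> ('a::codable \<Rightarrow> 'b::codable) \<Rightarrow> bool" where
  "computes_at b c f \<longleftrightarrow> loop_program c \<and> regs c \<subseteq> {0<..} \<and>
    (\<forall>s x. (\<forall>i\<ge>b. s i = 0) \<longrightarrow> exec c (s(b := enc x)) = s(b := enc (f x)))"

lemma computable_cmd:
  assumes "computable f" "b > 0"
  shows "\<exists>c. computes_at b c f"
proof -
  obtain g where g: "loopable g" "\<And>x. g (enc x) = enc (f x)"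
    using assms unfolding computable_def by blast
  obtain c where c: "loop_program c" "regs c \<subseteq> {b..}"
    "\<And>s. (\<forall>i>b. s i = 0) \<Longrightarrow> exec c s = s(b := g (s b))"
    using g(1) unfolding loopable_def loop_computes_def by blast
  have "exec c (s(b := enc x)) = s(b := enc (f x))" if "\<forall>i\<ge>b. s i = 0" for s x
    using that by (subst c(3)) (auto simp: g(2))
  then show ?thesis
    using c(1,2) assms(2) unfolding computes_at_def by (intro exI[of _ c]) fastforce
qed

lemma computes_atD:
  assumes "computes_at b c f"
  shows "loop_program c" "regs c \<subseteq> {0<..}"
    "(\<And>i. i \<ge> b \<Longrightarrow> s i = 0) \<Longrightarrow> exec c (s(b := enc x)) = s(b := enc (f x))"
  using assms unfolding computes_at_def by blast+

lemma loop_program_not_reads: "loop_program c \<Longrightarrow> \<not> reads c"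
  by (induction c) auto

text \<open>
  The machine first collects the input in register 1, pushing each letter on the front of a list,
  which reverses the word. Then register 1 holds the word together with \<open>n = 0, 1, 2, \<dots>\<close>, and each round
  runs the two tests on a copy in register 2. A failed test leaves 0 there, so that the next one finds an
  empty workspace.
\<close>

lemma decidable_by_search:
  fixes accepting rejecting :: "nat list \<times> nat \<Rightarrow> bool" and code :: "'c \<Rightarrow> nat"
  assumes fin: "finite \<Sigma>" and L: "L \<subseteq> lists \<Sigma>"
    and comp: "computable accepting" "computable rejecting"
    and acc: "\<And>w n. w \<in> lists \<Sigma> \<Longrightarrow> accepting (rev (map code w), n) \<Longrightarrow> w \<in> L"
    and rej: "\<And>w n. w \<in> lists \<Sigma> \<Longrightarrow> rejecting (rev (map code w), n) \<Longrightarrow> w \<notin> L"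
    and total: "\<And>w. w \<in> lists \<Sigma> \<Longrightarrow> \<exists>n. accepting (rev (map code w), n) \<or> rejecting (rev (map code w), n)"
  shows "decidable \<Sigma> L"
proof -
  have "\<exists>c. computes_at 1 c (\<lambda>l. code a # l)" for a
    by (intro computable_cmd computable_intros) simp
  then obtain h where h': "\<And>a. computes_at 1 (h a) (\<lambda>l. code a # l)" by metis
  note h = computes_atD[OF h']
  have "\<exists>c. computes_at 1 c (\<lambda>l :: nat list. (l, 0 :: nat))"
    by (intro computable_cmd computable_intros) simp
  then obtain ci where ci': "computes_at 1 ci (\<lambda>l :: nat list. (l, 0 :: nat))" by blast
  note ci = computes_atD[OF ci']
  have "\<exists>c. computes_at 1 c (\<lambda>p :: nat list \<times> nat. (fst p, Suc (snd p)))"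
    by (intro computable_cmd computable_intros) simp
  then obtain cn where cn': "computes_at 1 cn (\<lambda>p :: nat list \<times> nat. (fst p, Suc (snd p)))" by blast
  note cn = computes_atD[OF cn']
  obtain ca where ca': "computes_at 2 ca accepting" using computable_cmd[OF comp(1), of 2] by auto
  note ca = computes_atD[OF ca']
  obtain cr where cr': "computes_at 2 cr rejecting" using computable_cmd[OF comp(2), of 2] by auto
  note cr = computes_atD[OF cr']
  define test where "test c = Seq (copy_cmd 1 2 3) c" for c
  define body where "body = Seq (test ca) (Seq (AcceptIf 2) (Seq (test cr) (Seq (RejectIf 2) cn)))"
  define c where "c = Seq ci (Forever body)"
  have fin_regs: "finite (regs c)" for c by (induction c) auto
  define R where "R = {1, 2, 3} \<union> regs ci \<union> regs cn \<union> regs ca \<union> regs cr \<union> (\<Union>a\<in>\<Sigma>. regs (h a))"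
  have "finite R" using fin fin_regs by (auto simp: R_def)
  define k where "k = Suc (Max R)"
  have R: "r < k" if "r \<in> R" for r
    using \<open>finite R\<close> that by (simp add: k_def le_imp_less_Suc)
  have in_range: "regs d \<subseteq> {0<..<k}" if "regs d \<subseteq> {0<..}" "regs d \<subseteq> R" for d
  proof
    fix r assume "r \<in> regs d"
    then show "r \<in> {0<..<k}" using subsetD[OF that(1)] R[OF subsetD[OF that(2)]] by auto
  qed
  have kr: "regs ci \<subseteq> {0<..<k}" "regs cn \<subseteq> {0<..<k}" "regs ca \<subseteq> {0<..<k}" "regs cr \<subseteq> {0<..<k}"
    by (intro in_range ci(2) cn(2) ca(2) cr(2); simp add: R_def; blast)+
  have kh: "regs (h a) \<subseteq> {0<..<k}" if "a \<in> \<Sigma>" for a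
    using that by (intro in_range h(2)) (auto simp: R_def)
  have k3: "3 < k" by (intro R) (simp add: R_def)
  interpret cmd_simulation k \<Sigma> h c .
  have test: "loop_program (test ca)" "loop_program (test cr)"
    "regs (test ca) \<subseteq> {0<..<k}" "regs (test cr) \<subseteq> {0<..<k}"
    using ca(1) cr(1) kr(3,4) k3 by (auto simp: test_def copy_cmd_props)
  have plain: "plain_tm \<Sigma> M"
    using fin k3 h(1) ci(1) cn(1) test
    by (intro plain_cmd_machine) (auto simp: c_def body_def loop_program_not_reads)
  define z :: "nat \<Rightarrow> nat" where "z = (\<lambda>_. 0)"
  have z [simp]: "z i = 0" for i by (simp add: z_def)
  define st where "st p = z(1 := enc p)" for p :: "nat list \<times> nat"
  have copy: "exec (copy_cmd 1 2 3) (st p) = (st p)(2 := enc p)" for p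
    by (subst exec_copy) (auto simp: st_def)
  have ex_ca: "exec (test ca) (st p) = (st p)(2 := enc (accepting p))" for p
    unfolding test_def exec.simps copy by (rule ca(3)) (simp add: st_def)
  have ex_cr: "exec (test cr) (st p) = (st p)(2 := enc (rejecting p))" for p
    unfolding test_def exec.simps copy by (rule cr(3)) (simp add: st_def)
  have ex_cn: "exec cn (st p) = st (fst p, Suc (snd p))" for p
    unfolding st_def by (rule cn(3)) simp
  have upd: "(st p)(2 := 0) = st p" for p by (auto simp: st_def)
  let ?R1 = "Seq (AcceptIf 2) (Seq (test cr) (Seq (RejectIf 2) cn))"
  let ?R2 = "Seq (test cr) (Seq (RejectIf 2) cn)"
  let ?R3 = "Seq (RejectIf 2) cn"
  let ?F = "[Forever body]"
  note al = reach_always[of _ _ "[]"]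
  have start: "\<exists>ts'. reach (Run ?F) ts (Run (AcceptIf 2 # ?R2 # ?F)) ts' \<and>
      represents k ts' ((st p)(2 := enc (accepting p))) []" if p: "represents k ts (st p) []" for ts p
  proof -
    obtain t1 where 1: "reach (Run ?F) ts (Run (body # ?F)) t1" "represents k t1 (st p) []"
      using al[OF p, of ?F "Run (body # ?F)"] by auto
    obtain t2 where 2: "reach (Run (body # ?F)) t1 (Run (test ca # ?R1 # ?F)) t2" "represents k t2 (st p) []"
      using al[OF 1(2), of "body # ?F" "Run (test ca # ?R1 # ?F)"] by (auto simp: body_def)
    obtain t3 where 3: "reach (Run (test ca # ?R1 # ?F)) t2 (Run (?R1 # ?F)) t3"
        "represents k t3 ((st p)(2 := enc (accepting p))) []"
      using simulation[OF test(1,3) 2(2), of "?R1 # ?F"] by (auto simp: ex_ca)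
    obtain t4 where 4: "reach (Run (?R1 # ?F)) t3 (Run (AcceptIf 2 # ?R2 # ?F)) t4"
        "represents k t4 ((st p)(2 := enc (accepting p))) []"
      using al[OF 3(2), of "?R1 # ?F" "Run (AcceptIf 2 # ?R2 # ?F)"] by auto
    show ?thesis
      using reach_trans[OF 1(1) reach_trans[OF 2(1) reach_trans[OF 3(1) 4(1)]]] 4(2) by blast
  qed
  have accept: "\<exists>ts'. reach (Run ?F) ts Accept ts'" if p: "represents k ts (st p) []" "accepting p" for ts p
  proof -
    obtain t1 where 1: "reach (Run ?F) ts (Run (AcceptIf 2 # ?R2 # ?F)) t1"
        "represents k t1 ((st p)(2 := enc (accepting p))) []" using start[OF p(1)] by blast
    have "scan (snd (t1 ! 2)) = Aux 0" "2 < length t1"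
      using 1(2) k3 p(2) by (auto simp: scan_Aux0_iff represents_def enc_bool_def)
    then have "reach (Run (AcceptIf 2 # ?R2 # ?F)) t1 Accept (map stay t1)"
      by (intro reach_keep) simp
    then show ?thesis using reach_trans[OF 1(1)] by blast
  qed
  have middle: "\<exists>ts'. reach (Run ?F) ts (Run (RejectIf 2 # cn # ?F)) ts' \<and>
      represents k ts' ((st p)(2 := enc (rejecting p))) []"
    if p: "represents k ts (st p) []" "\<not> accepting p" for ts p
  proof -
    obtain t1 where 1: "reach (Run ?F) ts (Run (AcceptIf 2 # ?R2 # ?F)) t1"
        "represents k t1 (st p) []"
      using start[OF p(1)] p(2) by (auto simp: enc_bool_def upd)
    obtain t2 where 2: "reach (Run (AcceptIf 2 # ?R2 # ?F)) t1 (Run (?R2 # ?F)) t2" "represents k t2 (st p) []"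
      using reach_Zero[OF 1(2), of 2 "AcceptIf 2 # ?R2 # ?F" "Run (?R2 # ?F)"] k3 by (auto simp: st_def)
    obtain t3 where 3: "reach (Run (?R2 # ?F)) t2 (Run (test cr # ?R3 # ?F)) t3" "represents k t3 (st p) []"
      using al[OF 2(2), of "?R2 # ?F" "Run (test cr # ?R3 # ?F)"] by auto
    obtain t4 where 4: "reach (Run (test cr # ?R3 # ?F)) t3 (Run (?R3 # ?F)) t4"
        "represents k t4 ((st p)(2 := enc (rejecting p))) []"
      using simulation[OF test(2,4) 3(2), of "?R3 # ?F"] by (auto simp: ex_cr)
    obtain t5 where 5: "reach (Run (?R3 # ?F)) t4 (Run (RejectIf 2 # cn # ?F)) t5"
        "represents k t5 ((st p)(2 := enc (rejecting p))) []"
      using al[OF 4(2), of "?R3 # ?F" "Run (RejectIf 2 # cn # ?F)"] by auto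
    show ?thesis
      using reach_trans[OF 1(1) reach_trans[OF 2(1) reach_trans[OF 3(1) reach_trans[OF 4(1) 5(1)]]]] 5(2)
      by blast
  qed
  have reject: "\<exists>ts'. reach (Run ?F) ts Reject ts'"
    if p: "represents k ts (st p) []" "\<not> accepting p" "rejecting p" for ts p
  proof -
    obtain t1 where 1: "reach (Run ?F) ts (Run (RejectIf 2 # cn # ?F)) t1"
        "represents k t1 ((st p)(2 := enc (rejecting p))) []" using middle[OF p(1,2)] by blast
    have "scan (snd (t1 ! 2)) = Aux 0" "2 < length t1"
      using 1(2) k3 p(3) by (auto simp: scan_Aux0_iff represents_def enc_bool_def)
    then have "reach (Run (RejectIf 2 # cn # ?F)) t1 Reject (map stay t1)"
      by (intro reach_keep) simp
    then show ?thesis using reach_trans[OF 1(1)] by blast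
  qed
  have continue: "\<exists>ts'. reach (Run ?F) ts (Run ?F) ts' \<and> represents k ts' (st (fst p, Suc (snd p))) []"
    if p: "represents k ts (st p) []" "\<not> accepting p" "\<not> rejecting p" for ts p
  proof -
    obtain t1 where 1: "reach (Run ?F) ts (Run (RejectIf 2 # cn # ?F)) t1" "represents k t1 (st p) []"
      using middle[OF p(1,2)] p(3) by (auto simp: enc_bool_def upd)
    obtain t2 where 2: "reach (Run (RejectIf 2 # cn # ?F)) t1 (Run (cn # ?F)) t2" "represents k t2 (st p) []"
      using reach_Zero[OF 1(2), of 2 "RejectIf 2 # cn # ?F" "Run (cn # ?F)"] k3 by (auto simp: st_def)
    obtain t3 where 3: "reach (Run (cn # ?F)) t2 (Run ?F) t3" "represents k t3 (st (fst p, Suc (snd p))) []"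
      using simulation[OF cn(1) kr(2) 2(2), of ?F] by (auto simp: ex_cn)
    show ?thesis using reach_trans[OF 1(1) reach_trans[OF 2(1) 3(1)]] 3(2) by blast
  qed
  have outcome: "if w \<in> L then tm_accepts M {} w else tm_rejects M {} w" if w: "w \<in> lists \<Sigma>" for w
  proof -
    let ?l = "rev (map code w)"
    let ?t0 = "([], map Letter w) # replicate (k - 1) ([], []) :: 'c tape list"
    have init: "tm_init M w = (to_nat (Run [ReadAll, c]), ?t0)"
      by (simp add: tm_init_def cmd_machine_def)
    have r0: "represents k ?t0 (z(1 := enc ([] :: nat list))) w"
      using k3 by (auto simp: represents_def unread_def reg_value_def nth_Cons' takeWhile_eq_all_conv)
    have rd: "fold (\<lambda>a. exec (h a)) u (z(1 := enc l)) = z(1 := enc (rev (map code u) @ l))" for u l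
    proof (induction u arbitrary: l)
      case (Cons a u)
      have "exec (h a) (z(1 := enc l)) = z(1 := enc (code a # l))" by (rule h(3)) simp
      then show ?case by (simp only: fold_Cons comp_apply Cons list.map rev.simps append_assoc append_Cons append_Nil)
    qed simp
    have ci_z: "exec ci (z(1 := enc l)) = st (l, 0)" for l
      unfolding st_def by (rule ci(3)) simp
    obtain t1 where 1: "reach (Run [ReadAll, c]) ?t0 (Run [c]) t1" "represents k t1 (z(1 := enc ?l)) []"
      using simulation_ReadAll[OF _ r0, of "[c]"] h(1) kh w rd[of w "[]"] by (fastforce simp del: One_nat_def fun_upd_apply)
    obtain t2 where 2: "reach (Run [c]) t1 (Run (ci # ?F)) t2" "represents k t2 (z(1 := enc ?l)) []"
      using al[OF 1(2), of "[c]" "Run (ci # ?F)"] by (auto simp: c_def)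
    obtain t3 where 3: "reach (Run (ci # ?F)) t2 (Run ?F) t3" "represents k t3 (st (?l, 0)) []"
      using simulation[OF ci(1) kr(1) 2(2), of ?F] by (auto simp: ci_z simp del: One_nat_def)
    have pre: "reach (Run [ReadAll, c]) ?t0 (Run ?F) t3"
      using reach_trans[OF 1(1) reach_trans[OF 2(1) 3(1)]] .
    define n where "n = (LEAST n. accepting (?l, n) \<or> rejecting (?l, n))"
    have n: "accepting (?l, n) \<or> rejecting (?l, n)"
      unfolding n_def by (rule LeastI_ex) (rule total[OF w])
    have less: "\<not> accepting (?l, m)" "\<not> rejecting (?l, m)" if "m < n" for m
      using not_less_Least[OF that[unfolded n_def]] by auto
    have "\<exists>ts. reach (Run [ReadAll, c]) ?t0 (Run ?F) ts \<and> represents k ts (st (?l, m)) []"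
      if "m \<le> n" for m
      using that
    proof (induction m)
      case 0
      then show ?case using pre 3(2) by blast
    next
      case (Suc m)
      then obtain ts where ts: "reach (Run [ReadAll, c]) ?t0 (Run ?F) ts" "represents k ts (st (?l, m)) []"
        by auto
      then show ?case using continue[OF ts(2)] less[of m] Suc.prems reach_trans[OF ts(1)] by fastforce
    qed
    then obtain ts where ts: "reach (Run [ReadAll, c]) ?t0 (Run ?F) ts" "represents k ts (st (?l, n)) []"
      by blast
    show ?thesis
    proof (cases "accepting (?l, n)")
      case True
      then obtain ts' where "reach (Run [ReadAll, c]) ?t0 Accept ts'"
        using accept[OF ts(2)] reach_trans[OF ts(1)] by blast
      then have "tm_accepts M {} w"
        unfolding reach_def tm_accepts_def init by (metis cmd_machine_def fst_conv select_convs(5))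
      then show ?thesis using acc[OF w True] by simp
    next
      case False
      then obtain ts' where "reach (Run [ReadAll, c]) ?t0 Reject ts'"
        using n reject[OF ts(2)] reach_trans[OF ts(1)] by blast
      then have "tm_rejects M {} w"
        unfolding reach_def tm_rejects_def init by (metis cmd_machine_def fst_conv select_convs(6))
      then show ?thesis using rej[OF w] n False by auto
    qed
  qed
  show ?thesis
    unfolding decidable_def using L plain outcome by blast
qed

section \<open>Refuting systems of clauses\<close>

text \<open>
  A labelling assigns a natural number to every word over the naturals. A clause is a finite list of
  pairs of a word and a label, and forbids that all the words carry their labels.
\<close>

text \<open>
  The list \<open>l\<close> gives the labels of the words with codes \<open>0, 1, 2, \<dots>\<close>; words beyond its length are
  unlabelled and match nothing.
\<close>

definition matches :: "nat list \<Rightarrow> (nat list \<times> nat) list \<Rightarrow> bool" where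
  "matches l c \<longleftrightarrow> (\<forall>p\<in>set c. enc (fst p) < length l \<and> l ! enc (fst p) = snd p)"

text \<open>
  A decidable approximation of unsatisfiability: only words with codes below \<open>N\<close> are labelled, and
  only the first \<open>N\<close> lists of clauses are consulted.
\<close>

definition refuted :: "nat list \<Rightarrow> (nat \<Rightarrow> (nat list \<times> nat) list list) \<Rightarrow> nat \<Rightarrow> bool" where
  "refuted B cls N \<longleftrightarrow> (\<forall>l\<in>set (List.n_lists N B). \<exists>k<N. \<exists>c\<in>set (cls k). matches l c)"

definition satisfies :: "(nat list \<Rightarrow> nat) \<Rightarrow> nat list \<Rightarrow> (nat \<Rightarrow> (nat list \<times> nat) list list) \<Rightarrow> bool" where
  "satisfies f B cls \<longleftrightarrow> range f \<subseteq> set B \<and> (\<forall>k. \<forall>c\<in>set (cls k). \<exists>p\<in>set c. f (fst p) \<noteq> snd p)"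

text \<open>
  A prefix is good if it starts infinitely many of the lists. By the pigeonhole principle every good
  prefix has a good extension by one entry.
\<close>

lemma koenig:
  fixes f :: "nat \<Rightarrow> 'a list"
  assumes len: "\<And>N. length (f N) = N" and B: "\<And>N. set (f N) \<subseteq> B" and fin: "finite B"
  shows "\<exists>m. range m \<subseteq> B \<and> (\<forall>j. infinite {N. take j (f N) = map m [0..<j]})"
proof -
  define I where "I p \<longleftrightarrow> infinite {N. take (length p) (f N) = p}" for p
  have step: "\<exists>a\<in>B. I (p @ [a])" if "I p" for p
  proof (rule ccontr)
    assume no: "\<not> (\<exists>a\<in>B. I (p @ [a]))"
    have "{N. take (length p) (f N) = p} \<subseteq> {..length p} \<union>
        (\<Union>a\<in>B. {N. take (length (p @ [a])) (f N) = p @ [a]})"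
    proof
      fix N assume N: "N \<in> {N. take (length p) (f N) = p}"
      show "N \<in> {..length p} \<union> (\<Union>a\<in>B. {N. take (length (p @ [a])) (f N) = p @ [a]})"
      proof (cases "N \<le> length p")
        case False
        then have "f N ! length p \<in> B" using B[of N] len[of N] by (auto intro!: subsetD[OF B] nth_mem)
        moreover have "take (length (p @ [f N ! length p])) (f N) = p @ [f N ! length p]"
          using N False len[of N] by (simp add: take_Suc_conv_app_nth)
        ultimately show ?thesis by blast
      qed simp
    qed
    moreover have "finite ({..length p} \<union> (\<Union>a\<in>B. {N. take (length (p @ [a])) (f N) = p @ [a]}))"
      using no fin by (auto simp: I_def)
    ultimately show False using \<open>I p\<close> finite_subset by (auto simp: I_def)
  qed
  have "\<exists>P. \<forall>n. (length (P n) = n \<and> I (P n)) \<and> (\<exists>a\<in>B. P (Suc n) = P n @ [a])"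
  proof (rule dependent_nat_choice)
    show "\<exists>p :: 'a list. length p = 0 \<and> I p" by (simp add: I_def)
    fix p n assume "length p = n \<and> I p"
    then show "\<exists>q. (length q = Suc n \<and> I q) \<and> (\<exists>a\<in>B. q = p @ [a])"
      using step[of p] by (metis length_append_singleton)
  qed
  then obtain P where P: "\<And>n. length (P n) = n" "\<And>n. I (P n)" "\<And>n. \<exists>a\<in>B. P (Suc n) = P n @ [a]"
    by blast
  have P_map: "P n = map (\<lambda>i. last (P (Suc i))) [0..<n]" for n
  proof (induction n)
    case 0
    then show ?case using P(1)[of 0] by simp
  next
    case (Suc n)
    obtain a where a: "P (Suc n) = P n @ [a]" using P(3) by blast
    then have "P (Suc n) = P n @ [last (P (Suc n))]" by simp
    then show ?case using Suc by simp
  qed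
  show ?thesis
  proof (intro exI[of _ "\<lambda>i. last (P (Suc i))"] conjI allI subsetI)
    fix x assume "x \<in> range (\<lambda>i. last (P (Suc i)))"
    then obtain i where x: "x = last (P (Suc i))" by blast
    show "x \<in> B" using P(3)[of i] x by auto
  next
    fix j
    show "infinite {N. take j (f N) = map (\<lambda>i. last (P (Suc i))) [0..<j]}"
      using P(2)[of j] unfolding I_def P(1) P_map[of j, symmetric] .
  qed
qed

text \<open>
  Compactness: labellings of longer and longer parts that violate none of the clauses examined so
  far have a limit, and a clause only sees a finite part of the limit.
\<close>

lemma refuted_iff:
  "(\<exists>N. refuted B cls N) \<longleftrightarrow> (\<nexists>f. satisfies f B cls)"
proof
  assume "\<exists>N. refuted B cls N"
  then obtain N where N: "refuted B cls N" by blast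
  show "\<nexists>f. satisfies f B cls"
  proof
    assume "\<exists>f. satisfies f B cls"
    then obtain f where f: "satisfies f B cls" by blast
    let ?l = "map (\<lambda>i. f (list_decode i)) [0..<N]"
    have "?l \<in> set (List.n_lists N B)"
      using f by (auto simp: set_n_lists satisfies_def)
    then obtain k c where c: "c \<in> set (cls k)" "matches ?l c"
      using N unfolding refuted_def by blast
    have "f (fst p) = snd p" if "p \<in> set c" for p
      using c(2) that by (auto simp: matches_def enc_nat_list)
    then show False using f c(1) unfolding satisfies_def by blast
  qed
next
  assume unsat: "\<nexists>f. satisfies f B cls"
  show "\<exists>N. refuted B cls N"
  proof (rule ccontr)
    assume none: "\<nexists>N. refuted B cls N"
    have "\<exists>l. length l = N \<and> set l \<subseteq> set B \<and> (\<forall>k<N. \<forall>c\<in>set (cls k). \<not> matches l c)" for N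
    proof -
      have "\<not> refuted B cls N" using none by simp
      then have "\<exists>l\<in>set (List.n_lists N B). \<not> (\<exists>k<N. \<exists>c\<in>set (cls k). matches l c)"
        unfolding refuted_def by simp
      then obtain l where "l \<in> set (List.n_lists N B)" "\<not> (\<exists>k<N. \<exists>c\<in>set (cls k). matches l c)"
        by (rule bexE)
      then show ?thesis unfolding set_n_lists by (intro exI[of _ l]) simp
    qed
    then obtain l where l': "\<And>N. length (l N) = N \<and> set (l N) \<subseteq> set B \<and>
        (\<forall>k<N. \<forall>c\<in>set (cls k). \<not> matches (l N) c)" by metis
    have l: "\<And>N. length (l N) = N" "\<And>N. set (l N) \<subseteq> set B"
        "\<And>N k c. k < N \<Longrightarrow> c \<in> set (cls k) \<Longrightarrow> \<not> matches (l N) c" using l' by simp_all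
    obtain m where m: "range m \<subseteq> set B" "\<And>j. infinite {N. take j (l N) = map m [0..<j]}"
      using koenig[OF l(1,2)] by auto
    have "\<exists>p\<in>set c. m (enc (fst p)) \<noteq> snd p" if c: "c \<in> set (cls k)" for k c
    proof (rule ccontr)
      assume "\<not> (\<exists>p\<in>set c. m (enc (fst p)) \<noteq> snd p)"
      then have eq: "m (enc (fst p)) = snd p" if "p \<in> set c" for p using that by blast
      define j where "j = Suc (Max (insert 0 ((\<lambda>p. enc (fst p)) ` set c)))"
      have j: "enc (fst p) < j" if "p \<in> set c" for p
        using that unfolding j_def less_Suc_eq_le by (intro Max_ge) auto
      obtain N where N: "N > max j k" "take j (l N) = map m [0..<j]"
      proof -
        have "\<exists>N>max j k. N \<in> {N. take j (l N) = map m [0..<j]}"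
          using m(2)[of j] unfolding infinite_nat_iff_unbounded by (rule spec)
        then show ?thesis using that by blast
      qed
      have lm: "l N ! i = m i" if "i < j" for i
        using arg_cong[OF N(2), of "\<lambda>xs. xs ! i"] that by simp
      have "matches (l N) c"
        unfolding matches_def
      proof
        fix p assume p: "p \<in> set c"
        have "enc (fst p) < length (l N)" using j[OF p] N(1) by (simp add: l(1))
        moreover have "l N ! enc (fst p) = snd p" using lm[OF j[OF p]] eq[OF p] by simp
        ultimately show "enc (fst p) < length (l N) \<and> l N ! enc (fst p) = snd p" ..
      qed
      then show False using l(3)[of k N c] N(1) c by simp
    qed
    moreover have "range (\<lambda>u. m (enc u)) \<subseteq> set B"
      using m(1) by blast
    ultimately have "satisfies (\<lambda>u. m (enc u)) B cls"
      by (simp add: satisfies_def)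
    then show False using unsat by blast
  qed
qed

definition quadruple :: "nat \<Rightarrow> nat list \<times> nat list \<times> nat list \<times> nat" where
  "quadruple k = (list_decode (fst (prod_decode k)),
     list_decode (fst (prod_decode (snd (prod_decode k)))),
     list_decode (fst (prod_decode (snd (prod_decode (snd (prod_decode k)))))),
     snd (prod_decode (snd (prod_decode (snd (prod_decode k))))))"

lemma quadruple_surj: "\<exists>k. quadruple k = (x, r, y, n)"
  by (rule exI[of _ "prod_encode (list_encode x, prod_encode (list_encode r, prod_encode (list_encode y, n)))"])
    (simp add: quadruple_def)

lemma computable_quadruple [computable_intros]: "computable f \<Longrightarrow> computable (\<lambda>x. quadruple (f x))"
  unfolding quadruple_def by (intro computable_intros)

definition translate :: "nat list \<Rightarrow> (nat list \<times> nat) list \<Rightarrow> (nat list \<times> nat) list" where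
  "translate x c = map (\<lambda>p. (x @ fst p, snd p)) c"

lemma computable_translate [computable_intros]:
  "computable f \<Longrightarrow> computable c \<Longrightarrow> computable (\<lambda>x. translate (f x) (c x))"
  by (rule computable_comp2[of translate]) (unfold translate_def, intro computable_intros)

definition equality_clauses ::
    "nat list \<Rightarrow> nat list \<Rightarrow> nat list \<Rightarrow> (nat list \<times> nat) list list" where
  "equality_clauses B u v =
     concat (map (\<lambda>a. concat (map (\<lambda>b. if a = b then [] else [[(u, a), (v, b)]]) B)) B)"

lemma computable_equality_clauses [computable_intros]:
  "computable f \<Longrightarrow> computable g \<Longrightarrow> computable (\<lambda>x. equality_clauses B (f x) (g x))"
  by (rule computable_comp2[of "equality_clauses B"]) (unfold equality_clauses_def, intro computable_intros)

text \<open>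
  The index \<open>k\<close> encodes words \<open>x\<close>, \<open>r\<close>, \<open>y\<close> and a bound \<open>n\<close>. If \<open>n\<close> certifies \<open>r\<close> as a relator, then \<open>x @ y\<close> and \<open>x @ r @ y\<close> must
  not get different labels. The clauses of \<open>F\<close> are imposed at every word \<open>x\<close>, those of \<open>Q\<close> at the empty word only.
\<close>

definition clauses :: "(nat \<Rightarrow> nat list \<Rightarrow> bool) \<Rightarrow> nat list \<Rightarrow> (nat list \<times> nat) list list \<Rightarrow>
    (nat list \<times> nat) list list \<Rightarrow> nat \<Rightarrow> (nat list \<times> nat) list list" where
  "clauses rel B F Q k = (let t = quadruple k; x = fst t; r = fst (snd t); y = fst (snd (snd t)) in
     (if rel (snd (snd (snd t))) r then equality_clauses B (x @ y) (x @ r @ y) else []) @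
     map (translate x) F @ Q)"

lemma satisfies_clauses_iff:
  "satisfies f B (clauses rel B F Q) \<longleftrightarrow>
     range f \<subseteq> set B \<and>
     (\<forall>n r x y. rel n r \<longrightarrow> f (x @ r @ y) = f (x @ y)) \<and>
     (\<forall>c\<in>set F. \<forall>x. \<exists>p\<in>set c. f (x @ fst p) \<noteq> snd p) \<and>
     (\<forall>c\<in>set Q. \<exists>p\<in>set c. f (fst p) \<noteq> snd p)" (is "_ \<longleftrightarrow> ?R")
proof -
  let ?ok = "\<lambda>c. \<exists>p\<in>set c. f (fst p) \<noteq> snd p"
  have quad: "(\<forall>k. P (quadruple k)) \<longleftrightarrow> (\<forall>x r y n. P (x, r, y, n))" for P
    by (metis quadruple_surj surj_pair)
  have tr: "?ok (translate x c) \<longleftrightarrow> (\<exists>p\<in>set c. f (x @ fst p) \<noteq> snd p)" for x c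
    by (simp add: translate_def)
  have eq: "(\<forall>c\<in>set (equality_clauses B u v). ?ok c) \<longleftrightarrow> f v = f u" if "range f \<subseteq> set B" for u v
  proof
    assume ok: "\<forall>c\<in>set (equality_clauses B u v). ?ok c"
    show "f v = f u"
    proof (rule ccontr)
      assume "f v \<noteq> f u"
      then have "[(u, f u), (v, f v)] \<in> set (equality_clauses B u v)"
        using that by (auto simp: equality_clauses_def intro!: bexI[of _ "f u"] bexI[of _ "f v"])
      then show False using ok by fastforce
    qed
  next
    assume "f v = f u"
    then show "\<forall>c\<in>set (equality_clauses B u v). ?ok c"
      by (auto simp: equality_clauses_def split: if_splits)
  qed
  define good where "good t \<longleftrightarrow> (\<forall>c\<in>set (
      (if rel (snd (snd (snd t))) (fst (snd t))
       then equality_clauses B (fst t @ fst (snd (snd t))) (fst t @ fst (snd t) @ fst (snd (snd t)))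
       else []) @ map (translate (fst t)) F @ Q). ?ok c)" for t
  have cl: "(\<forall>c\<in>set (clauses rel B F Q k). ?ok c) \<longleftrightarrow> good (quadruple k)" for k
    unfolding clauses_def good_def Let_def ..
  have good: "good (x, r, y, n) \<longleftrightarrow>
      (rel n r \<longrightarrow> (\<forall>c\<in>set (equality_clauses B (x @ y) (x @ r @ y)). ?ok c)) \<and>
      (\<forall>c\<in>set F. ?ok (translate x c)) \<and> (\<forall>c\<in>set Q. ?ok c)" for x r y n
    unfolding good_def by (cases "rel n r") (simp_all add: ball_Un)
  have all: "(\<forall>k. \<forall>c\<in>set (clauses rel B F Q k). ?ok c) \<longleftrightarrow>
     (\<forall>x r y n. (rel n r \<longrightarrow> (\<forall>c\<in>set (equality_clauses B (x @ y) (x @ r @ y)). ?ok c)) \<and>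
        (\<forall>c\<in>set F. ?ok (translate x c)) \<and> (\<forall>c\<in>set Q. ?ok c))"
    unfolding cl good[symmetric] by (rule quad)
  show ?thesis
  proof (cases "range f \<subseteq> set B")
    case True
    show ?thesis
      unfolding satisfies_def all tr eq[OF True] by blast
  qed (simp add: satisfies_def)
qed

lemma computable_refuted:
  assumes rel: "computable (\<lambda>p. rel (fst p) (snd p))" and Q: "computable Q"
  shows "computable (\<lambda>p. refuted B (clauses rel B F (Q (fst p))) (snd p))"
proof -
  have rel': "computable a \<Longrightarrow> computable b \<Longrightarrow> computable (\<lambda>x. rel (a x) (b x))" for a b
    by (rule computable_comp2[OF rel])
  have Q': "computable a \<Longrightarrow> computable (\<lambda>x. Q (a x))" for a
    by (rule computable_comp[OF _ Q])
  show ?thesis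
    unfolding refuted_def clauses_def matches_def Let_def
    by (intro computable_intros rel' Q')
qed


section \<open>Bounded runs of Turing machines are computable\<close>

lemma computable_member:
  assumes "finite D" "computable l" shows "computable (\<lambda>x. l x \<in> D)"
proof -
  have "(\<lambda>x. if l x \<in> D then True else False) = (\<lambda>x. l x \<in> D)" by auto
  then show ?thesis using computable_table[OF assms, of "\<lambda>_. True" False] by simp
qed

definition move_code :: "direction \<Rightarrow> nat" where
  "move_code d = (case d of MoveLeft \<Rightarrow> 0 | Stay \<Rightarrow> 1 | MoveRight \<Rightarrow> 2)"

definition coded_scan :: "nat \<Rightarrow> nat list \<Rightarrow> nat" where
  "coded_scan b cells = (if cells = [] then b else hd cells)"

definition coded_write :: "nat \<Rightarrow> nat \<times> nat \<Rightarrow> nat list \<times> nat list \<Rightarrow> nat list \<times> nat list" where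
  "coded_write b a t =
     (if snd a = 0 then (tl (fst t), coded_scan b (fst t) # fst a # tl (snd t))
      else if snd a = 1 then (fst t, fst a # tl (snd t))
      else (fst a # fst t, tl (snd t)))"

lemma computable_coded_scan [computable_intros]:
  "computable f \<Longrightarrow> computable (\<lambda>x. coded_scan b (f x))"
  unfolding coded_scan_def by (intro computable_intros)

lemma computable_coded_write [computable_intros]:
  "computable f \<Longrightarrow> computable g \<Longrightarrow> computable (\<lambda>x. coded_write b (f x) (g x))"
  unfolding coded_write_def by (intro computable_intros)

definition code_tape :: "('c tape_symbol \<Rightarrow> nat) \<Rightarrow> 'c tape \<Rightarrow> nat list \<times> nat list" where
  "code_tape sy t = (map sy (fst t), map sy (snd t))"

lemma coded_scan_code: "coded_scan (sy Blank) (map sy cells) = sy (scan cells)"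
  by (cases cells) (auto simp: coded_scan_def scan_def)

lemma coded_write_code:
  "coded_write (sy Blank) (sy s, move_code d) (code_tape sy t) = code_tape sy (write_and_move (s, d) t)"
  by (cases t; cases d) (auto simp: coded_write_def code_tape_def move_code_def coded_scan_code map_tl)

text \<open>
  Symbols are coded by an injection on the finite alphabet of \<open>M\<close>, so that the transition function
  becomes a finite table. A recursively enumerable set thereby becomes the set of all \<open>r\<close> for which a
  computable predicate holds of \<open>(n, r)\<close> for some \<open>n\<close>.
\<close>

lemma plain_tm_acceptance_computable:
  fixes M :: "'c tm" and decode :: "nat \<Rightarrow> 'c"
  assumes plain: "plain_tm \<Sigma> M" and I: "finite I" "decode ` I \<subseteq> \<Sigma>"
  shows "\<exists>f :: nat \<times> nat list \<Rightarrow> bool. computable f \<and> (\<forall>n r. r \<in> lists I \<longrightarrow>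
    f (n, r) \<longleftrightarrow> fst ((tm_step M {} ^^ n) (tm_init M (map decode r))) = tm_accept M)"
proof -
  let ?A = "tm_symbols M"
  have M: "finite (tm_states M)" "finite ?A" "Blank \<in> ?A" "Letter ` \<Sigma> \<subseteq> ?A" "tm_start M \<in> tm_states M"
    "tm_queries M = {}" "1 \<le> tm_tapes M"
    using plain unfolding plain_tm_def oracle_tm_def by simp_all
  have trans: "q' \<in> tm_states M \<and> length acts = tm_tapes M \<and> fst ` set acts \<subseteq> ?A"
    if "q \<in> tm_states M" "length ss = tm_tapes M" "set ss \<subseteq> ?A" "tm_trans M q ss = (q', acts)"
    for q ss q' acts
  proof -
    have "case tm_trans M q ss of (q', acts) \<Rightarrow>
        q' \<in> tm_states M \<and> length acts = tm_tapes M \<and> fst ` set acts \<subseteq> ?A"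
      using plain that(1-3) unfolding plain_tm_def oracle_tm_def by simp
    then show ?thesis unfolding that(4) by simp
  qed
  obtain sy :: "'c tape_symbol \<Rightarrow> nat" where sy: "inj_on sy ?A"
    using finite_imp_inj_to_nat_seg[OF M(2)] by blast
  let ?b = "sy Blank"
  define D where "D = tm_states M \<times> {l \<in> lists (sy ` ?A). length l = tm_tapes M}"
  have "finite {l \<in> lists (sy ` ?A). length l = tm_tapes M}"
    using finite_lists_length_eq[of "sy ` ?A" "tm_tapes M"] M(2) by (simp add: in_lists_conv_set subset_eq conj_commute)
  then have finD: "finite D" using M(1) by (simp add: D_def)
  define T where "T p = (case tm_trans M (fst p) (map (inv_into ?A sy) (snd p)) of
      (q', acts) \<Rightarrow> (q', map (\<lambda>a. (sy (fst a), move_code (snd a))) acts))" for p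
  define U where "U p = (if p \<in> D then T p else (0, []))" for p
  define step where "step c = (if fst c = tm_accept M \<or> fst c = tm_reject M then c else
      (fst (U (fst c, map (\<lambda>t. coded_scan ?b (snd t)) (snd c))),
       map (\<lambda>z. coded_write ?b (fst z) (snd z))
         (zip (snd (U (fst c, map (\<lambda>t. coded_scan ?b (snd t)) (snd c)))) (snd c))))"
    for c :: "nat \<times> (nat list \<times> nat list) list"
  define start where "start r = (tm_start M,
      ([] :: nat list, map (\<lambda>i. if i \<in> I then sy (Letter (decode i)) else 0) r) #
        replicate (tm_tapes M - 1) ([], []))" for r :: "nat list"
  define f where "f p \<longleftrightarrow> fst ((step ^^ fst p) (start (snd p))) = tm_accept M" for p :: "nat \<times> nat list"
  have U: "computable g \<Longrightarrow> computable (\<lambda>x. U (g x))" for g :: "'x::codable \<Rightarrow> _"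
    unfolding U_def by (rule computable_table[OF finD])
  have "computable f"
    unfolding f_def step_def start_def
    by (intro computable_intros U computable_table[OF I(1)])
  define cd where "cd c = (fst c, map (code_tape sy) (snd c))" for c :: "'c tm_config"
  define valid where "valid c \<longleftrightarrow> fst c \<in> tm_states M \<and> length (snd c) = tm_tapes M \<and>
      (\<forall>t\<in>set (snd c). set (fst t) \<subseteq> ?A \<and> set (snd t) \<subseteq> ?A)" for c :: "'c tm_config"
  have scan_in: "scan l \<in> ?A" if "set l \<subseteq> ?A" for l
    using that M(3) by (cases l) (auto simp: scan_def)
  have tl_in: "set (tl l) \<subseteq> ?A" if "set l \<subseteq> ?A" for l
    using that by (cases l) auto
  have wm_in: "set (fst (write_and_move a t)) \<subseteq> ?A \<and> set (snd (write_and_move a t)) \<subseteq> ?A"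
    if "fst a \<in> ?A" "set (fst t) \<subseteq> ?A" "set (snd t) \<subseteq> ?A" for a t
  proof (cases t)
    case (Pair l r)
    obtain s d where a: "a = (s, d)" by (cases a)
    show ?thesis
      using that scan_in[of l] tl_in[of l] tl_in[of r] by (cases d) (simp_all add: Pair a)
  qed
  have step_ok: "step (cd c) = cd (tm_step M {} c) \<and> valid (tm_step M {} c)" if v: "valid c" for c
  proof (cases "fst c = tm_accept M \<or> fst c = tm_reject M")
    case True
    then have "tm_step M {} c = c" by (cases c) auto
    then show ?thesis using True v by (simp add: step_def cd_def)
  next
    case False
    obtain q ts where c: "c = (q, ts)" by (cases c)
    let ?ss = "map (scan \<circ> snd) ts"
    obtain q' acts where tr: "tm_trans M q ?ss = (q', acts)" by fastforce
    have ss: "set ?ss \<subseteq> ?A" "length ?ss = tm_tapes M" "q \<in> tm_states M"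
      using v scan_in by (auto simp: valid_def c)
    have acts: "q' \<in> tm_states M" "length acts = tm_tapes M" "fst ` set acts \<subseteq> ?A"
      using trans[OF ss(3,2,1) tr] by auto
    have st: "tm_step M {} c = (q', map2 write_and_move acts ts)"
      using False M(6) tr by (simp add: c)
    have codes: "map (\<lambda>t. coded_scan ?b (snd t)) (map (code_tape sy) ts) = map sy ?ss"
      by (simp add: code_tape_def coded_scan_code)
    have inD: "(q, map sy ?ss) \<in> D"
    proof -
      have "map sy ?ss \<in> lists (sy ` ?A)"
        using image_mono[OF ss(1), of sy] by (simp only: lists_eq_set mem_Collect_eq set_map)
      then show ?thesis
        unfolding D_def by (intro SigmaI CollectI conjI ss(3)) (use ss(2) in simp_all)
    qed
    have "map (inv_into ?A sy) (map sy ?ss) = ?ss"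
      using ss(1) sy by (intro nth_equalityI) (auto simp: inv_into_f_f subset_eq)
    then have "U (q, map sy ?ss) = (q', map (\<lambda>a. (sy (fst a), move_code (snd a))) acts)"
      using inD tr by (simp only: U_def if_True T_def fst_conv snd_conv prod.case)
    then have "step (cd c) = (q', map (\<lambda>z. coded_write ?b (fst z) (snd z))
        (zip (map (\<lambda>a. (sy (fst a), move_code (snd a))) acts) (map (code_tape sy) ts)))"
      using False by (simp only: step_def cd_def c fst_conv snd_conv codes if_False)
    also have "\<dots> = cd (tm_step M {} c)"
      unfolding st cd_def fst_conv snd_conv
      by (auto simp: zip_map_map coded_write_code split_beta)
    finally have "step (cd c) = cd (tm_step M {} c)" .
    moreover have "valid (tm_step M {} c)"
      unfolding st valid_def fst_conv snd_conv
    proof (intro conjI ballI)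
      show "length (map2 write_and_move acts ts) = tm_tapes M"
        using acts(2) v by (simp add: valid_def c)
      fix t assume "t \<in> set (map2 write_and_move acts ts)"
      then obtain a t0 where t: "t = write_and_move a t0" "(a, t0) \<in> set (zip acts ts)" by auto
      then have "a \<in> set acts" "t0 \<in> set ts" by (auto dest: set_zip_leftD set_zip_rightD)
      then have "fst a \<in> ?A" "set (fst t0) \<subseteq> ?A" "set (snd t0) \<subseteq> ?A"
        using acts(3) v by (auto simp: valid_def c)
      then show "set (fst t) \<subseteq> ?A" "set (snd t) \<subseteq> ?A" using wm_in t(1) by blast+
    qed (rule acts(1))
    ultimately show ?thesis ..
  qed
  have run: "(step ^^ n) (cd c) = cd ((tm_step M {} ^^ n) c) \<and> valid ((tm_step M {} ^^ n) c)"
    if "valid c" for n c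
    using that by (induction n) (auto simp: step_ok)
  have "f (n, r) \<longleftrightarrow> fst ((tm_step M {} ^^ n) (tm_init M (map decode r))) = tm_accept M"
    if r: "r \<in> lists I" for n r
  proof -
    have r_in: "i \<in> I" if "i \<in> set r" for i using r that by auto
    have "cd (tm_init M (map decode r)) = start r"
      using r_in by (auto simp: cd_def tm_init_def start_def code_tape_def)
    moreover have "valid (tm_init M (map decode r))"
      using r_in M(4,5,7) I(2) by (auto simp: valid_def tm_init_def image_subset_iff)
    ultimately show ?thesis
      using run[of "tm_init M (map decode r)" n] by (auto simp: f_def cd_def)
  qed
  with \<open>computable f\<close> show ?thesis by blast
qed

section \<open>The word problem as an unsatisfiability problem\<close>

lemma (in group) word_value_closed: "u \<in> lists (carrier G) \<Longrightarrow> word_value G u \<in> carrier G"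
  by (induction u) (auto simp: word_value_def)

lemma (in group) word_value_append:
  "u \<in> lists (carrier G) \<Longrightarrow> v \<in> lists (carrier G) \<Longrightarrow>
    word_value G (u @ v) = word_value G u \<otimes> word_value G v"
proof (induction u)
  case Nil
  then show ?case using word_value_closed[of v] by (simp add: word_value_def)
next
  case (Cons a u)
  then show ?case
    using word_value_closed[of u] word_value_closed[of v] by (simp add: word_value_def m_assoc)
qed

lemma (in group) word_value_surj:
  assumes "finite_symmetric_generators G S" "g \<in> carrier G"
  shows "\<exists>w\<in>lists S. word_value G w = g"
proof -
  have S: "S \<subseteq> carrier G" "\<And>s. s \<in> S \<Longrightarrow> inv s \<in> S" "generate G S = carrier G"
    using assms(1) by (auto simp: finite_symmetric_generators_def)
  have lists: "w \<in> lists S \<Longrightarrow> w \<in> lists (carrier G)" for w using S(1) by (auto dest: lists_mono)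
  from assms(2) have "g \<in> generate G S" using S(3) by simp
  then show ?thesis
  proof (induction g)
    case one
    then show ?case by (intro bexI[of _ "[]"]) (auto simp: word_value_def)
  next
    case (incl h)
    then show ?case using S(1) by (intro bexI[of _ "[h]"]) (auto simp: word_value_def)
  next
    case (inv h)
    then show ?case using S(1,2) by (intro bexI[of _ "[inv h]"]) (auto simp: word_value_def)
  next
    case (eng g h)
    then obtain u v where "u \<in> lists S" "word_value G u = g" "v \<in> lists S" "word_value G v = h" by blast
    then show ?case using word_value_append[of u v] lists by (intro bexI[of _ "u @ v"]) auto
  qed
qed

text \<open>
  Here \<open>rel n r\<close> means that \<open>n\<close> certifies \<open>r\<close> as a relator, and every list of naturals is a word. That the relators present
  the group is expressed by \<open>rel_complete\<close>: a labelling that is unchanged by inserting relators depends only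
  on the value of a word.
\<close>

locale coded_presentation = group G for G :: "('g, 'm) monoid_scheme" (structure) +
  fixes val :: "nat list \<Rightarrow> 'g" and rel :: "nat \<Rightarrow> nat list \<Rightarrow> bool"
  assumes val_closed [simp]: "val u \<in> carrier G"
    and val_append: "val (u @ v) = val u \<otimes> val v"
    and val_surj: "g \<in> carrier G \<Longrightarrow> \<exists>u. val u = g"
    and rel_computable: "computable (\<lambda>p. rel (fst p) (snd p))"
    and rel_sound: "rel n r \<Longrightarrow> val r = \<one>"
    and rel_complete: "(\<forall>n r x y. rel n r \<longrightarrow> f (x @ r @ y) = (f (x @ y) :: nat)) \<Longrightarrow>
      val u = val v \<Longrightarrow> f u = f v"
begin

lemma val_Nil: "val [] = \<one>"
proof -
  have "val [] \<otimes> val [] = val []" using val_append[of "[]" "[]"] by simp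
  then show ?thesis using l_cancel_one[of "val []" "val []"] by simp
qed

definition labelling :: "nat list \<Rightarrow> (nat list \<times> nat) list list \<Rightarrow> (nat list \<times> nat) list list \<Rightarrow>
    ('g \<Rightarrow> nat) \<Rightarrow> bool" where
  "labelling B F Q z \<longleftrightarrow> (\<forall>g\<in>carrier G. z g \<in> set B) \<and>
     (\<forall>c\<in>set F. \<forall>g\<in>carrier G. \<exists>p\<in>set c. z (g \<otimes> val (fst p)) \<noteq> snd p) \<and>
     (\<forall>c\<in>set Q. \<exists>p\<in>set c. z (val (fst p)) \<noteq> snd p)"

text \<open>
  The equality clauses make a satisfying labelling of words factor through \<open>val\<close>, that is, come from a
  labelling of the group; the clauses of \<open>F\<close> and \<open>Q\<close> turn into forbidden patterns.
\<close>

lemma satisfiable_iff_labelling: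
  "(\<exists>f. satisfies f B (clauses rel B F Q)) \<longleftrightarrow> (\<exists>z. labelling B F Q z)"
proof
  assume "\<exists>f. satisfies f B (clauses rel B F Q)"
  then obtain f where "satisfies f B (clauses rel B F Q)" ..
  then have B: "range f \<subseteq> set B" and inv: "\<forall>n r x y. rel n r \<longrightarrow> f (x @ r @ y) = f (x @ y)"
    and F: "\<And>c x. c \<in> set F \<Longrightarrow> \<exists>p\<in>set c. f (x @ fst p) \<noteq> snd p"
    and Q: "\<And>c. c \<in> set Q \<Longrightarrow> \<exists>p\<in>set c. f (fst p) \<noteq> snd p"
    unfolding satisfies_clauses_iff by auto
  define z where "z g = f (SOME u. val u = g)" for g
  have z: "z (val u) = f u" for u
  proof -
    have "val (SOME v. val v = val u) = val u" by (rule someI[of _ u]) simp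
    from rel_complete[of f, OF inv this] show ?thesis unfolding z_def .
  qed
  have "labelling B F Q z"
    unfolding labelling_def
  proof (intro conjI ballI)
    fix g assume "g \<in> carrier G"
    then obtain u where "val u = g" using val_surj by blast
    then show "z g \<in> set B" using z[of u] B by auto
  next
    fix c g assume c: "c \<in> set F" "g \<in> carrier G"
    then obtain u where u: "val u = g" using val_surj by blast
    obtain p where p: "p \<in> set c" "f (u @ fst p) \<noteq> snd p" using F[OF c(1), of u] by blast
    then show "\<exists>p\<in>set c. z (g \<otimes> val (fst p)) \<noteq> snd p"
      by (intro bexI[OF _ p(1)]) (simp add: u[symmetric] val_append[symmetric] z)
  next
    fix c assume "c \<in> set Q"
    then show "\<exists>p\<in>set c. z (val (fst p)) \<noteq> snd p" using Q by (simp add: z)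
  qed
  then show "\<exists>z. labelling B F Q z" by blast
next
  assume "\<exists>z. labelling B F Q z"
  then obtain z where z: "labelling B F Q z" ..
  have "satisfies (\<lambda>u. z (val u)) B (clauses rel B F Q)"
    unfolding satisfies_clauses_iff
  proof (intro conjI allI ballI impI)
    show "range (\<lambda>u. z (val u)) \<subseteq> set B" using z by (auto simp: labelling_def)
    fix n r x y assume "rel n r"
    then show "z (val (x @ r @ y)) = z (val (x @ y))" by (simp add: val_append rel_sound)
  next
    fix c x assume "c \<in> set F"
    then show "\<exists>p\<in>set c. z (val (x @ fst p)) \<noteq> snd p"
      using z by (simp add: labelling_def val_append)
  next
    fix c assume "c \<in> set Q"
    then show "\<exists>p\<in>set c. z (val (fst p)) \<noteq> snd p" using z by (simp add: labelling_def)
  qed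
  then show "\<exists>f. satisfies f B (clauses rel B F Q)" by blast
qed

lemma refuted_iff_no_labelling:
  "(\<exists>N. refuted B (clauses rel B F Q) N) \<longleftrightarrow> (\<nexists>z. labelling B F Q z)"
  unfolding refuted_iff satisfiable_iff_labelling ..

text \<open>
  Hence \<open>w\<close> is trivial if and only if the clauses asking for different labels on \<open>w\<close> and the empty word
  are refutable.
\<close>

lemma labelling_separating:
  "(\<exists>z. labelling [0, 1] [] [[([], 1)], [(w, 0)]] z) \<longleftrightarrow> val w \<noteq> \<one>"
proof
  assume "\<exists>z. labelling [0, 1] [] [[([], 1)], [(w, 0)]] z"
  then obtain z where z: "labelling [0, 1] [] [[([], 1)], [(w, 0)]] z" ..
  then have "z (val w) \<noteq> 0" "z (val []) \<noteq> 1" and "\<forall>g\<in>carrier G. z g \<in> {0, 1}"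
    by (simp_all add: labelling_def)
  moreover from this(3) have "z (val w) \<in> {0, 1}" by (rule bspec) simp
  ultimately show "val w \<noteq> \<one>" using val_Nil by auto
next
  assume "val w \<noteq> \<one>"
  then have "labelling [0, 1] [] [[([], 1)], [(w, 0)]] (\<lambda>g. if g = \<one> then 0 else 1)"
    by (simp add: labelling_def val_Nil)
  then show "\<exists>z. labelling [0, 1] [] [[([], 1)], [(w, 0)]] z" by blast
qed

lemma labelling_append_translate:
  "labelling B F (Q @ map (translate w) Q) z \<longleftrightarrow> labelling B F Q z \<and>
    (\<forall>c\<in>set Q. \<exists>p\<in>set c. z (val w \<otimes> val (fst p)) \<noteq> snd p)"
proof -
  have "(\<exists>p\<in>set (translate w c). z (val (fst p)) \<noteq> snd p) \<longleftrightarrow>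
      (\<exists>p\<in>set c. z (val w \<otimes> val (fst p)) \<noteq> snd p)" for c
    by (simp add: translate_def val_append)
  then show ?thesis by (simp add: labelling_def ball_Un)
qed

text \<open>
  The premise \<open>sep\<close> says that the clauses \<open>F\<close>, together with \<open>Q\<close> at the identity and at \<open>g\<close>, are satisfiable for
  \<open>g = \<one>\<close> and for no other \<open>g\<close>. Refuting them for the value of \<open>w\<close> therefore witnesses that \<open>w\<close> is nontrivial, while refuting the separation
  of \<open>w\<close> from the empty word witnesses that it is trivial, and one of the two refutations exists. The generating set
  \<open>S\<close> need not be the one of the presentation: each generator is first spelled out as a word of the latter.
\<close>

theorem decidable_word_problem:
  assumes S: "finite_symmetric_generators G S"
    and sep: "\<And>g. g \<in> carrier G \<Longrightarrow>
      (\<exists>z. labelling B F Q z \<and> (\<forall>c\<in>set Q. \<exists>p\<in>set c. z (g \<otimes> val (fst p)) \<noteq> snd p)) \<longleftrightarrow> g = \<one>"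
  shows "decidable S (word_problem G S)"
proof -
  have "finite S" and SG: "S \<subseteq> carrier G" using S by (auto simp: finite_symmetric_generators_def)
  obtain code :: "'g \<Rightarrow> nat" where code: "inj_on code S"
    using finite_imp_inj_to_nat_seg[OF \<open>finite S\<close>] by blast
  define t where "t g = (SOME u. val u = g)" for g
  have t: "val (t g) = g" if "g \<in> carrier G" for g
    using val_surj[OF that] unfolding t_def by (rule someI_ex)
  define spell where "spell i = (if i \<in> code ` S then t (inv_into S code i) else [])" for i
  define W where "W l = concat (map spell (rev l))" for l
  have W: "val (W (rev (map code w))) = word_value G w" if "w \<in> lists S" for w
    using that
  proof (induction w)
    case Nil
    then show ?case by (simp add: W_def word_value_def val_Nil)
  next
    case (Cons a w)
    have "spell (code a) = t a" using Cons code by (simp add: spell_def inv_into_f_f)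
    then show ?case
      using Cons t[of a] SG by (auto simp: W_def word_value_def val_append)
  qed
  have spell: "computable spell"
    unfolding spell_def by (rule computable_table) (use \<open>finite S\<close> in \<open>auto intro: computable_id\<close>)
  have compW: "computable W"
    unfolding W_def by (intro computable_intros computable_comp[OF _ spell])
  define acc where "acc p = refuted [0, 1] (clauses rel [0, 1] [] [[([], 1)], [(W (fst p), 0)]]) (snd p)" for p
  define rej where "rej p = refuted B (clauses rel B F (Q @ map (translate (W (fst p))) Q)) (snd p)" for p
  have comp_acc: "computable acc"
    unfolding acc_def
    by (rule computable_refuted[OF rel_computable, of "\<lambda>l. [[([], 1)], [(W l, 0)]]"])
      (intro computable_intros computable_comp[OF _ compW])
  have comp_rej: "computable rej"
    unfolding rej_def
    by (rule computable_refuted[OF rel_computable, of "\<lambda>l. Q @ map (translate (W l)) Q"])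
      (intro computable_intros computable_comp[OF _ compW])
  have acc_iff: "(\<exists>n. acc (rev (map code w), n)) \<longleftrightarrow> w \<in> word_problem G S" if "w \<in> lists S" for w
    unfolding acc_def fst_conv snd_conv refuted_iff_no_labelling labelling_separating W[OF that]
    using that by (simp add: word_problem_def)
  have rej_iff: "(\<exists>n. rej (rev (map code w), n)) \<longleftrightarrow> w \<notin> word_problem G S" if "w \<in> lists S" for w
  proof -
    have "word_value G w \<in> carrier G" using that SG lists_mono[OF SG] by (intro word_value_closed) auto
    from sep[OF this] show ?thesis
      unfolding rej_def fst_conv snd_conv refuted_iff_no_labelling labelling_append_translate W[OF that]
      using that by (simp add: word_problem_def)
  qed
  show ?thesis
  proof (rule decidable_by_search[OF \<open>finite S\<close> _ comp_acc comp_rej, of _ code])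
    show "word_problem G S \<subseteq> lists S" by (auto simp: word_problem_def)
    fix w assume w: "w \<in> lists S"
    show "w \<in> word_problem G S" if "acc (rev (map code w), n)" for n
      using acc_iff[OF w] that by blast
    show "w \<notin> word_problem G S" if "rej (rev (map code w), n)" for n
      using rej_iff[OF w] that by blast
    show "\<exists>n. acc (rev (map code w), n) \<or> rej (rev (map code w), n)"
      using acc_iff[OF w] rej_iff[OF w] by blast
  qed
qed

end

text \<open>
  Relators are certified by the number of steps after which the enumerating machine accepts; the
  pairs of a generator and its inverse are added as a finite set. Naturals that code no
  generator are made trivial by declaring them relators, so that every list of naturals is a word.
\<close>

lemma (in group) presented_group_coded:
  assumes pres: "is_presentation G T R" and re: "recursively_enumerable T R"
  shows "\<exists>val rel. coded_presentation G val rel"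
proof -
  have T: "finite T" "T \<subseteq> carrier G" "\<And>s. s \<in> T \<Longrightarrow> inv s \<in> T" "R \<subseteq> lists T"
    and fsg: "finite_symmetric_generators G T"
    and eq: "\<And>u v. u \<in> lists T \<Longrightarrow> v \<in> lists T \<Longrightarrow>
      word_value G u = word_value G v \<longleftrightarrow> presented_eq G T R u v"
    using pres by (auto simp: is_presentation_def finite_symmetric_generators_def)
  obtain M where M: "plain_tm T M" "\<And>w. w \<in> lists T \<Longrightarrow> tm_accepts M {} w \<longleftrightarrow> w \<in> R"
    using re unfolding recursively_enumerable_def by blast
  obtain code :: "'a \<Rightarrow> nat" where code: "inj_on code T"
    using finite_imp_inj_to_nat_seg[OF T(1)] by blast
  define I where "I = code ` T"
  define letter where "letter i = (if i \<in> I then inv_into T code i else \<one>)" for i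
  have letter_code: "letter (code s) = s" if "s \<in> T" for s
    using that code by (simp add: letter_def I_def inv_into_f_f)
  have letter_in: "letter i \<in> T" if "i \<in> I" for i using that letter_code by (auto simp: I_def)
  have letter_G: "letter i \<in> carrier G" for i
    using letter_in[of i] T(2) by (cases "i \<in> I") (auto simp: letter_def)
  have "finite I" "letter ` I \<subseteq> T" using T(1) letter_in by (auto simp: I_def)
  from plain_tm_acceptance_computable[OF M(1) this]
  obtain f where comp_f: "computable f" and f: "\<forall>n r. r \<in> lists I \<longrightarrow>
      f (n, r) = (fst ((tm_step M {} ^^ n) (tm_init M (map letter r))) = tm_accept M)"
    by (elim exE conjE)
  define val where "val u = word_value G (map letter u)" for u
  define C where "C = (\<lambda>s. [code s, code (inv s)]) ` T"
  define rel where "rel n r \<longleftrightarrow> r \<in> C \<or> (length r = 1 \<and> hd r \<notin> I) \<or> ((\<forall>a\<in>set r. a \<in> I) \<and> f (n, r))" for n r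
  have letters: "map letter u \<in> lists (carrier G)" for u using letter_G by auto
  have val_code: "val (map code v) = word_value G v" if "v \<in> lists T" for v
  proof -
    have "map letter (map code v) = v" using that by (induction v) (auto simp: letter_code)
    then show ?thesis by (simp only: val_def)
  qed
  have "coded_presentation G val rel"
  proof (unfold_locales)
    show "val u \<in> carrier G" for u unfolding val_def by (rule word_value_closed[OF letters])
    show "val (u @ v) = val u \<otimes> val v" for u v
      unfolding val_def map_append by (rule word_value_append[OF letters letters])
    show "\<exists>u. val u = g" if "g \<in> carrier G" for g
      using word_value_surj[OF fsg that] val_code by blast
    show "computable (\<lambda>p. rel (fst p) (snd p))"
    proof -
      have len1: "length r = 1 \<longleftrightarrow> r \<noteq> [] \<and> tl r = []" for r :: "nat list"
        by (cases r) auto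
      show ?thesis
        unfolding rel_def len1
        by (intro computable_intros computable_member computable_comp[OF _ comp_f] \<open>finite I\<close>)
          (simp add: C_def T(1))
    qed
  next
    fix n r assume "rel n r"
    then consider "r \<in> C" | i where "r = [i]" "i \<notin> I" | "r \<in> lists I" "f (n, r)"
      unfolding rel_def by (cases r) auto
    then show "val r = \<one>"
    proof cases
      case 1
      then obtain s where "s \<in> T" "r = [code s, code (inv s)]" by (auto simp: C_def)
      then show ?thesis using T(2,3) by (auto simp: val_def letter_code word_value_def)
    next
      case 2
      then show ?thesis by (simp add: val_def letter_def word_value_def)
    next
      case 3
      then have "fst ((tm_step M {} ^^ n) (tm_init M (map letter r))) = tm_accept M" using f by simp
      then have "tm_accepts M {} (map letter r)" unfolding tm_accepts_def by (rule exI)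
      moreover have mr: "map letter r \<in> lists T" using 3 letter_in by auto
      ultimately have "map letter r \<in> R" using M(2) by blast
      then have "presented_eq G T R (map letter r) []" by (rule presented_eq.relator)
      then have "word_value G (map letter r) = word_value G []" using eq[OF mr] by simp
      then show ?thesis by (simp add: val_def word_value_def)
    qed
  next
    fix h :: "nat list \<Rightarrow> nat" and u v
    assume "\<forall>n r x y. rel n r \<longrightarrow> h (x @ r @ y) = h (x @ y)" and uv: "val u = val v"
    then have inv: "\<And>n r x y. rel n r \<Longrightarrow> h (x @ r @ y) = h (x @ y)" by simp
    have "\<forall>x y. h (x @ map code u @ y) = h (x @ map code v @ y)" if "presented_eq G T R u v" for u v
      using that
    proof induction
      case (cancel s)
      then have "rel 0 [code s, code (inv s)]" by (auto simp: rel_def C_def)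
      from inv[OF this] show ?case by simp
    next
      case (relator r)
      then have r: "r \<in> lists T" using T(4) by blast
      then have "tm_accepts M {} r" using M(2) relator by blast
      then obtain n where n: "fst ((tm_step M {} ^^ n) (tm_init M r)) = tm_accept M"
        unfolding tm_accepts_def by blast
      have "map letter (map code r) = r" using r by (induction r) (auto simp: letter_code)
      moreover have cr: "map code r \<in> lists I" using r by (auto simp: I_def)
      ultimately have "f (n, map code r)" using f n by simp
      then have "rel n (map code r)" using cr by (auto simp: rel_def)
      from inv[OF this] show ?case by simp
    next
      case (congruence x y u v)
      show ?case
      proof (intro allI)
        fix x' y'
        show "h (x' @ map code (x @ u @ y) @ y') = h (x' @ map code (x @ v @ y) @ y')"
          using congruence.IH[rule_format, of "x' @ map code x" "map code y @ y'"] by simp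
      qed
    qed auto
    then have pe: "h (map code u) = h (map code v)" if "presented_eq G T R u v" for u v
      using that by (metis append_Nil append_Nil2)
    \<comment> \<open>Letters that code no generator can be deleted, which leaves a word over the presentation.\<close>
    define clean where "clean u = filter (\<lambda>i. i \<in> I) u" for u
    have drop: "h (x @ clean u) = h (x @ u)" for x u
    proof (induction u arbitrary: x)
      case (Cons i u)
      show ?case
      proof (cases "i \<in> I")
        case True
        then show ?thesis using Cons[of "x @ [i]"] by (simp add: clean_def)
      next
        case False
        then have "rel 0 [i]" by (simp add: rel_def)
        then have "h (x @ [i] @ u) = h (x @ u)" by (rule inv)
        then show ?thesis using False Cons[of x] by (simp add: clean_def)
      qed
    qed (simp add: clean_def)
    have clean_T: "map letter (clean u) \<in> lists T" for u using letter_in by (auto simp: clean_def)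
    have code_letter: "map code (map letter (clean u)) = clean u" for u
    proof -
      have "code (letter i) = i" if "i \<in> I" for i
        using that letter_code by (auto simp: I_def)
      then show ?thesis by (intro nth_equalityI) (auto simp: clean_def dest!: nth_mem)
    qed
    have val_clean: "word_value G (map letter (clean u)) = val u" for u
    proof (induction u)
      case (Cons i u)
      have "word_value G (map letter u) \<in> carrier G" by (rule word_value_closed[OF letters])
      then show ?case using Cons by (auto simp: clean_def val_def word_value_def letter_def)
    qed (simp add: clean_def val_def)
    have "presented_eq G T R (map letter (clean u)) (map letter (clean v))"
      using eq[OF clean_T clean_T] uv by (simp add: val_clean)
    from pe[OF this] show "h u = h v"
      unfolding code_letter using drop[of "[]" u] drop[of "[]" v] by simp
  qed
  then show ?thesis by blast
qed

section \<open>Local rules of sofic subshifts\<close>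

definition occurs :: "('g \<rightharpoonup> 'a) \<Rightarrow> ('g \<Rightarrow> 'a) \<Rightarrow> bool" where
  "occurs p z \<longleftrightarrow> (\<forall>h\<in>dom p. z h = the (p h))"

lemma topspace_config: "topspace (config_topology G A) = configs G A"
  by (simp add: config_topology_def configs_def)

lemma compact_config: "finite A \<Longrightarrow> compact_space (config_topology G A)"
  by (simp add: config_topology_def compact_space_product_topology compact_space_discrete_topology)

lemma continuous_letter:
  "g \<in> carrier G \<Longrightarrow> continuous_map (config_topology G A) (discrete_topology A) (\<lambda>x. x g)"
  unfolding config_topology_def by (rule continuous_map_product_projection)

lemma dom_restrict_config [simp]: "dom ((Some \<circ> z) |` J) = J"
  by (auto simp: restrict_map_def dom_def)

lemma pattern_of_config:
  assumes "z \<in> configs G A" "finite J" "J \<subseteq> carrier G"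
  shows "pattern G A ((Some \<circ> z) |` J)"
proof -
  have "ran ((Some \<circ> z) |` J) \<subseteq> A"
    using assms by (auto simp: configs_def ran_def restrict_map_def split: if_splits)
  then show ?thesis using assms(2,3) unfolding pattern_def dom_restrict_config by simp
qed

lemma occurs_restrict: "occurs ((Some \<circ> z) |` J) y \<longleftrightarrow> (\<forall>h\<in>J. y h = z h)"
  unfolding occurs_def dom_restrict_config by (simp add: restrict_map_def)

lemma open_occurs:
  assumes "pattern G A p"
  shows "openin (config_topology G A) {y \<in> configs G A. occurs p y}"
proof -
  let ?U = "\<lambda>i. if i \<in> dom p then {the (p i)} else A"
  have dom: "finite (dom p)" "dom p \<subseteq> carrier G" and ran: "\<And>i. i \<in> dom p \<Longrightarrow> the (p i) \<in> A"
    using assms by (auto simp: pattern_def ran_def subset_eq)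
  have "{y \<in> configs G A. occurs p y} = (\<Pi>\<^sub>E i\<in>carrier G. ?U i)"
  proof (rule equalityI; rule subsetI)
    fix y assume "y \<in> {y \<in> configs G A. occurs p y}"
    then show "y \<in> (\<Pi>\<^sub>E i\<in>carrier G. ?U i)"
      by (intro PiE_I) (simp_all add: configs_def occurs_def PiE_iff extensional_def)
  next
    fix y assume y: "y \<in> (\<Pi>\<^sub>E i\<in>carrier G. ?U i)"
    have U: "y i \<in> ?U i" if "i \<in> carrier G" for i using PiE_mem[OF y that] .
    have "y i = the (p i)" if "i \<in> dom p" for i
      using U[of i] dom(2) that by (simp add: subset_eq)
    moreover have "y i \<in> A" if "i \<in> carrier G" for i
      using U[OF that] ran[of i] by (cases "i \<in> dom p") simp_all
    ultimately show "y \<in> {y \<in> configs G A. occurs p y}"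
      using y by (simp add: configs_def occurs_def PiE_iff)
  qed
  moreover have "finite {i \<in> carrier G. ?U i \<noteq> topspace (discrete_topology A)}"
    by (rule finite_subset[OF _ dom(1)]) auto
  ultimately show ?thesis
    unfolding config_topology_def using ran by (simp add: openin_PiE_gen)
qed

lemma open_pattern_neighbourhood:
  assumes "openin (config_topology G A) W" "z \<in> W"
  shows "\<exists>p. pattern G A p \<and> occurs p z \<and> {y \<in> configs G A. occurs p y} \<subseteq> W"
proof -
  obtain U where U: "finite {i \<in> carrier G. U i \<noteq> A}" "z \<in> Pi\<^sub>E (carrier G) U" "Pi\<^sub>E (carrier G) U \<subseteq> W"
    using assms unfolding config_topology_def openin_product_topology_alt
    by (force simp: topspace_discrete_topology)
  let ?J = "{i \<in> carrier G. U i \<noteq> A}"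
  have "z \<in> configs G A" using assms openin_subset topspace_config by blast
  then have "pattern G A ((Some \<circ> z) |` ?J)" by (rule pattern_of_config[OF _ U(1)]) auto
  moreover have "occurs ((Some \<circ> z) |` ?J) z" by (simp add: occurs_restrict)
  moreover have "{y \<in> configs G A. occurs ((Some \<circ> z) |` ?J) y} \<subseteq> W"
  proof
    fix y assume y: "y \<in> {y \<in> configs G A. occurs ((Some \<circ> z) |` ?J) y}"
    have "y \<in> Pi\<^sub>E (carrier G) U"
    proof (rule PiE_I)
      fix i assume i: "i \<in> carrier G"
      show "y i \<in> U i"
      proof (cases "U i = A")
        case True
        then show ?thesis using y i by (auto simp: configs_def)
      next
        case False
        then have "y i = z i" using y i by (simp add: occurs_restrict)
        then show ?thesis using U(2) i by auto
      qed
    qed (use y in \<open>auto simp: configs_def\<close>)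
    then show "y \<in> W" using U(3) by blast
  qed
  ultimately show ?thesis by blast
qed

text \<open>
  The neighbourhoods given by patterns inside \<open>W\<close> cover the compact set \<open>E\<close>; a finite subcover is the
  required set of patterns.
\<close>

lemma closed_open_patterns:
  assumes A: "finite A" and E: "closedin (config_topology G A) E"
    and W: "openin (config_topology G A) W" "E \<subseteq> W"
  shows "\<exists>P. finite P \<and> (\<forall>p\<in>P. pattern G A p \<and> {y \<in> configs G A. occurs p y} \<subseteq> W) \<and>
    (\<forall>z\<in>E. \<exists>p\<in>P. occurs p z)"
proof -
  have "\<forall>z\<in>E. \<exists>p. pattern G A p \<and> occurs p z \<and> {y \<in> configs G A. occurs p y} \<subseteq> W"
    using open_pattern_neighbourhood[OF W(1)] W(2) by blast
  then obtain p where p: "\<And>z. z \<in> E \<Longrightarrow> pattern G A (p z)" "\<And>z. z \<in> E \<Longrightarrow> occurs (p z) z"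
    "\<And>z. z \<in> E \<Longrightarrow> {y \<in> configs G A. occurs (p z) y} \<subseteq> W" by metis
  let ?N = "\<lambda>z. {y \<in> configs G A. occurs (p z) y}"
  have "compactin (config_topology G A) E"
    by (rule closedin_compact_space[OF compact_config[OF A] E])
  moreover have "\<forall>U\<in>?N ` E. openin (config_topology G A) U" using open_occurs p(1) by blast
  moreover have "E \<subseteq> \<Union>(?N ` E)"
    using closedin_subset[OF E] p(2) unfolding topspace_config by blast
  ultimately obtain \<F> where F: "finite \<F>" "\<F> \<subseteq> ?N ` E" "E \<subseteq> \<Union>\<F>"
    unfolding compactin_def by meson
  obtain D where D: "D \<subseteq> E" "finite D" "\<F> = ?N ` D"
    using finite_subset_image[OF F(1,2)] by blast
  show ?thesis
  proof (intro exI[of _ "p ` D"] conjI ballI)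
    show "finite (p ` D)" using D(2) by simp
    show "pattern G A q" "{y \<in> configs G A. occurs q y} \<subseteq> W" if "q \<in> p ` D" for q
      using that p(1,3) D(1) by auto
    show "\<exists>q\<in>p ` D. occurs q z" if "z \<in> E" for z
      using F(3) D(3) that by blast
  qed
qed

text \<open>
  One half of the Curtis-Hedlund-Lyndon theorem. The set of points with \<open>\<phi> z g \<noteq> a\<close> is closed and open
  in \<open>Z\<close>, hence cut out by finitely many patterns.
\<close>

lemma local_rule:
  assumes B: "finite B" and Z: "closedin (config_topology G B) Z"
    and cont: "continuous_map (subtopology (config_topology G B) Z) (subtopology (config_topology G A) Y) \<phi>"
    and g: "g \<in> carrier G"
  shows "\<exists>P. finite P \<and> (\<forall>p\<in>P. pattern G B p) \<and> (\<forall>z\<in>Z. \<phi> z g \<noteq> a \<longleftrightarrow> (\<exists>p\<in>P. occurs p z))"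
proof -
  let ?T = "config_topology G B"
  have ZB: "Z \<subseteq> configs G B" using closedin_subset[OF Z] by (simp add: topspace_config)
  have ts: "topspace (subtopology ?T Z) = Z" using ZB by (auto simp: topspace_config)
  have "continuous_map (subtopology ?T Z) (config_topology G A) \<phi>"
    using cont by (rule continuous_map_into_fulltopology)
  then have c: "continuous_map (subtopology ?T Z) (discrete_topology A) (\<lambda>z. \<phi> z g)"
    using continuous_map_compose[OF _ continuous_letter[OF g]] by (simp add: comp_def)
  let ?E = "{z \<in> Z. \<phi> z g \<noteq> a}"
  have E: "?E = {z \<in> topspace (subtopology ?T Z). \<phi> z g \<in> A - {a}}"
    using continuous_map_image_subset_topspace[OF c] unfolding ts by auto
  have "closedin (subtopology ?T Z) ?E"
    unfolding E by (rule closedin_continuous_map_preimage[OF c]) simp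
  then have cl: "closedin ?T ?E" using Z by (rule closedin_trans_full)
  have "openin (subtopology ?T Z) ?E"
    unfolding E by (rule openin_continuous_map_preimage[OF c]) simp
  then obtain W where W: "openin ?T W" "?E = W \<inter> Z"
    unfolding openin_subtopology by auto
  have EW: "?E \<subseteq> W" unfolding W(2) by (rule Int_lower1)
  from closed_open_patterns[OF B cl W(1) EW] obtain P where "finite P"
    and P: "\<forall>p\<in>P. pattern G B p \<and> {y \<in> configs G B. occurs p y} \<subseteq> W"
    and cover: "\<forall>z\<in>?E. \<exists>p\<in>P. occurs p z" by (elim exE conjE)
  have "\<phi> z g \<noteq> a \<longleftrightarrow> (\<exists>p\<in>P. occurs p z)" if z: "z \<in> Z" for z
  proof
    assume "\<exists>p\<in>P. occurs p z"
    then obtain p where p: "p \<in> P" "occurs p z" ..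
    have "z \<in> {y \<in> configs G B. occurs p y}" using ZB z p(2) by auto
    then have "z \<in> W \<inter> Z" using P p(1) z by blast
    then show "\<phi> z g \<noteq> a" unfolding W(2)[symmetric] by simp
  next
    assume "\<phi> z g \<noteq> a"
    then have "z \<in> ?E" using z by simp
    then show "\<exists>p\<in>P. occurs p z" by (rule bspec[OF cover])
  qed
  with \<open>finite P\<close> P show ?thesis by (intro exI[of _ P]) simp
qed

definition at_most_one :: "('g, 'm) monoid_scheme \<Rightarrow> ('g \<Rightarrow> nat) set" where
  "at_most_one G = {x \<in> configs G {0, 1}.
     \<forall>g\<in>carrier G. \<forall>h\<in>carrier G. x g = 1 \<and> x h = 1 \<longrightarrow> g = h}"

lemma (in group) at_most_one_subshift: "subshift G {0, 1} (at_most_one G)"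
  unfolding subshift_def
proof (intro conjI ballI)
  let ?T = "config_topology G {0, 1 :: nat}"
  let ?one = "\<lambda>g. {x \<in> topspace ?T. x g \<in> {1}}"
  have op: "openin ?T (?one g)" if "g \<in> carrier G" for g
    by (rule openin_continuous_map_preimage[OF continuous_letter[OF that]]) simp
  let ?bad = "\<Union>g\<in>carrier G. \<Union>h\<in>carrier G - {g}. ?one g \<inter> ?one h"
  have "openin ?T ?bad"
    using op by (intro openin_Union ballI) auto
  moreover have "at_most_one G = topspace ?T - ?bad"
    unfolding at_most_one_def topspace_config by auto
  ultimately show "closedin ?T (at_most_one G)" by (simp add: closedin_diff)
  fix g x assume g: "g \<in> carrier G" and x: "x \<in> at_most_one G"
  show "shift G g x \<in> at_most_one G"
    unfolding at_most_one_def
  proof (intro CollectI conjI ballI impI)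
    show "shift G g x \<in> configs G {0, 1}"
      unfolding shift_def configs_def
    proof (rule restrict_PiE[THEN iffD2], rule Pi_I)
      fix h assume "h \<in> carrier G"
      then show "x (inv g \<otimes> h) \<in> {0, 1}"
        using x g by (intro PiE_mem[of x "carrier G"]) (simp_all add: at_most_one_def configs_def)
    qed
    fix h k assume hk: "h \<in> carrier G" "k \<in> carrier G" and "shift G g x h = 1 \<and> shift G g x k = 1"
    then have "x (inv g \<otimes> h) = 1 \<and> x (inv g \<otimes> k) = 1" by (simp add: shift_def)
    then have "inv g \<otimes> h = inv g \<otimes> k" using x g hk by (auto simp: at_most_one_def)
    then show "h = k" using g hk by simp
  qed
qed simp

context coded_presentation
begin

lemma pattern_clause:
  assumes "pattern G B p"
  shows "\<exists>c. \<forall>z. \<forall>g\<in>carrier G.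
    (\<exists>q\<in>set c. z (g \<otimes> val (fst q)) \<noteq> snd q) \<longleftrightarrow> \<not> (\<forall>h\<in>dom p. z (g \<otimes> h) = the (p h))"
proof -
  have "finite (dom p)" and G: "dom p \<subseteq> carrier G" using assms by (auto simp: pattern_def)
  obtain hs where hs: "set hs = dom p" using finite_list[OF \<open>finite (dom p)\<close>] by blast
  define word where "word h = (SOME u. val u = h)" for h
  have word: "val (word h) = h" if "h \<in> dom p" for h
    unfolding word_def using val_surj[OF subsetD[OF G that]] by (rule someI_ex)
  show ?thesis
    by (rule exI[of _ "map (\<lambda>h. (word h, the (p h))) hs"]) (simp add: hs word del: domIff)
qed

lemma pattern_clauses:
  assumes "finite P" "\<forall>p\<in>P. pattern G B p"
  shows "\<exists>Q. \<forall>z. \<forall>g\<in>carrier G. (\<forall>c\<in>set Q. \<exists>q\<in>set c. z (g \<otimes> val (fst q)) \<noteq> snd q) \<longleftrightarrow>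
    (\<forall>p\<in>P. \<not> (\<forall>h\<in>dom p. z (g \<otimes> h) = the (p h)))"
proof -
  obtain ps where ps: "set ps = P" using finite_list[OF assms(1)] by blast
  have "\<forall>p\<in>P. \<exists>c. \<forall>z. \<forall>g\<in>carrier G.
      (\<exists>q\<in>set c. z (g \<otimes> val (fst q)) \<noteq> snd q) \<longleftrightarrow> \<not> (\<forall>h\<in>dom p. z (g \<otimes> h) = the (p h))"
    by (intro ballI pattern_clause[where B = B] bspec[OF assms(2)])
  from bchoice[OF this] obtain c where c: "\<forall>p\<in>P. \<forall>z. \<forall>g\<in>carrier G.
      (\<exists>q\<in>set (c p). z (g \<otimes> val (fst q)) \<noteq> snd q) \<longleftrightarrow> \<not> (\<forall>h\<in>dom p. z (g \<otimes> h) = the (p h))" ..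
  show ?thesis
  proof (intro exI[of _ "map c ps"] allI ballI)
    fix z g assume g: "g \<in> carrier G"
    have "(\<forall>c'\<in>set (map c ps). \<exists>q\<in>set c'. z (g \<otimes> val (fst q)) \<noteq> snd q) \<longleftrightarrow>
        (\<forall>p\<in>P. \<exists>q\<in>set (c p). z (g \<otimes> val (fst q)) \<noteq> snd q)"
      by (simp add: ps)
    also have "\<dots> \<longleftrightarrow> (\<forall>p\<in>P. \<not> (\<forall>h\<in>dom p. z (g \<otimes> h) = the (p h)))"
      by (rule ball_cong[OF HOL.refl]) (rule c[rule_format, OF _ g])
    finally show "(\<forall>c'\<in>set (map c ps). \<exists>q\<in>set c'. z (g \<otimes> val (fst q)) \<noteq> snd q) \<longleftrightarrow>
        (\<forall>p\<in>P. \<not> (\<forall>h\<in>dom p. z (g \<otimes> h) = the (p h)))" .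
  qed
qed

text \<open>
  Let \<open>Q\<close> be the patterns with which the factor map decides, at the identity, that the image is not
  1. By equivariance, avoiding \<open>Q\<close> at \<open>g\<close> means that the image is 1 at \<open>g\<close>. A point avoiding \<open>Q\<close> at the identity and at \<open>g\<close> would
  be mapped to a configuration with ones at both places, which forces \<open>g = \<one>\<close>; conversely a preimage of the
  configuration with a single 1 at the identity serves for \<open>g = \<one>\<close>.
\<close>

theorem sofic_at_most_one_decidable:
  assumes sofic: "sofic G {0, 1} (at_most_one G)" and S: "finite_symmetric_generators G S"
  shows "decidable S (word_problem G S)"
proof -
  let ?X = "at_most_one G"
  obtain B :: "nat set" and Z \<phi> where Z: "finite_type G B Z"
    and cont: "continuous_map (subtopology (config_topology G B) Z)
      (subtopology (config_topology G {0, 1}) ?X) \<phi>"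
    and equiv: "\<And>g z. g \<in> carrier G \<Longrightarrow> z \<in> Z \<Longrightarrow> \<phi> (shift G g z) = shift G g (\<phi> z)"
    and onto: "\<phi> ` Z = ?X"
    using sofic unfolding sofic_def by blast
  obtain \<F> where F: "finite \<F>" "\<forall>p\<in>\<F>. pattern G B p" "Z = avoiding G B \<F>"
    using Z unfolding finite_type_def by blast
  have B: "finite B" and Zcl: "closedin (config_topology G B) Z"
    and Zsh: "\<And>g z. g \<in> carrier G \<Longrightarrow> z \<in> Z \<Longrightarrow> shift G g z \<in> Z"
    using Z by (auto simp: finite_type_def subshift_def)
  obtain P where P: "finite P" "\<forall>p\<in>P. pattern G B p" "\<And>z. z \<in> Z \<Longrightarrow> \<phi> z \<one> \<noteq> 1 \<longleftrightarrow> (\<exists>p\<in>P. occurs p z)"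
    using local_rule[OF B Zcl cont one_closed] by metis
  obtain Fc where Fc: "\<And>z g. g \<in> carrier G \<Longrightarrow>
      (\<forall>c\<in>set Fc. \<exists>q\<in>set c. z (g \<otimes> val (fst q)) \<noteq> snd q) \<longleftrightarrow>
      (\<forall>p\<in>\<F>. \<not> (\<forall>h\<in>dom p. z (g \<otimes> h) = the (p h)))"
    using pattern_clauses[OF F(1,2)] by metis
  obtain Q where Q: "\<And>z g. g \<in> carrier G \<Longrightarrow>
      (\<forall>c\<in>set Q. \<exists>q\<in>set c. z (g \<otimes> val (fst q)) \<noteq> snd q) \<longleftrightarrow>
      (\<forall>p\<in>P. \<not> (\<forall>h\<in>dom p. z (g \<otimes> h) = the (p h)))"
    using pattern_clauses[OF P(1,2)] by metis
  obtain Bs where Bs: "set Bs = B" using finite_list[OF B] by blast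
  have Z_iff: "z \<in> Z \<longleftrightarrow> z \<in> configs G B \<and>
      (\<forall>g\<in>carrier G. \<forall>c\<in>set Fc. \<exists>q\<in>set c. z (g \<otimes> val (fst q)) \<noteq> snd q)" for z
    unfolding F(3) avoiding_def cylinder_def using Fc by auto
  have Q_one: "(\<forall>c\<in>set Q. \<exists>q\<in>set c. z (val (fst q)) \<noteq> snd q) \<longleftrightarrow> \<phi> z \<one> = 1" if "z \<in> Z" for z
  proof -
    have dom: "h \<in> carrier G" if "p \<in> P" "h \<in> dom p" for p h using P(2) that by (auto simp: pattern_def)
    have "(\<forall>c\<in>set Q. \<exists>q\<in>set c. z (\<one> \<otimes> val (fst q)) \<noteq> snd q) \<longleftrightarrow> (\<forall>p\<in>P. \<not> occurs p z)"
      unfolding Q[OF one_closed] occurs_def using dom by (auto cong: ball_cong)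
    then show ?thesis using P(3)[OF that] by auto
  qed
  have Q_at: "(\<forall>c\<in>set Q. \<exists>q\<in>set c. z (g \<otimes> val (fst q)) \<noteq> snd q) \<longleftrightarrow> \<phi> z g = 1"
    if z: "z \<in> Z" and g: "g \<in> carrier G" for z g
  proof -
    have "shift G (inv g) z \<in> Z" using Zsh z g by simp
    moreover have "shift G (inv g) z (val u) = z (g \<otimes> val u)" for u
      using g by (simp add: shift_def)
    moreover have "\<phi> (shift G (inv g) z) \<one> = \<phi> z g"
      using equiv[of "inv g" z] z g by (simp add: shift_def)
    ultimately show ?thesis using Q_one[of "shift G (inv g) z"] by simp
  qed
  have "(\<exists>z. labelling Bs Fc Q z \<and> (\<forall>c\<in>set Q. \<exists>p\<in>set c. z (g \<otimes> val (fst p)) \<noteq> snd p)) \<longleftrightarrow> g = \<one>"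
    if g: "g \<in> carrier G" for g
  proof
    assume "\<exists>z. labelling Bs Fc Q z \<and> (\<forall>c\<in>set Q. \<exists>p\<in>set c. z (g \<otimes> val (fst p)) \<noteq> snd p)"
    then obtain z where z: "labelling Bs Fc Q z" "\<forall>c\<in>set Q. \<exists>p\<in>set c. z (g \<otimes> val (fst p)) \<noteq> snd p"
      by blast
    let ?z = "restrict z (carrier G)"
    have "?z \<in> Z"
      unfolding Z_iff using z(1) by (auto simp: labelling_def Bs configs_def)
    moreover have "\<forall>c\<in>set Q. \<exists>q\<in>set c. ?z (val (fst q)) \<noteq> snd q"
      using z(1) by (simp add: labelling_def)
    moreover have "\<forall>c\<in>set Q. \<exists>q\<in>set c. ?z (g \<otimes> val (fst q)) \<noteq> snd q"
      using z(2) g by simp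
    ultimately have "\<phi> ?z \<one> = 1" "\<phi> ?z g = 1" "\<phi> ?z \<in> ?X"
      using Q_one[of ?z] Q_at[of ?z g] g onto by auto
    then show "g = \<one>" using g unfolding at_most_one_def by blast
  next
    assume "g = \<one>"
    let ?x = "\<lambda>h\<in>carrier G. if h = \<one> then 1 else 0 :: nat"
    have "?x \<in> ?X" by (auto simp: at_most_one_def configs_def)
    then obtain z where z: "z \<in> Z" "\<phi> z = ?x" using onto by (metis imageE)
    have "\<phi> z \<one> = 1" using z(2) by simp
    then have "labelling Bs Fc Q z"
      using Q_one[OF z(1)] z(1) unfolding Z_iff labelling_def Bs configs_def by auto
    moreover have "\<forall>c\<in>set Q. \<exists>p\<in>set c. z (g \<otimes> val (fst p)) \<noteq> snd p"
      using Q_at[OF z(1) g] \<open>\<phi> z \<one> = 1\<close> \<open>g = \<one>\<close> by simp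
    ultimately show "\<exists>z. labelling Bs Fc Q z \<and> (\<forall>c\<in>set Q. \<exists>p\<in>set c. z (g \<otimes> val (fst p)) \<noteq> snd p)"
      by blast
  qed
  then show ?thesis by (rule decidable_word_problem[OF S])
qed

end

section \<open>Recognising codings with the word problem as oracle\<close>

text \<open>
  A one-tape machine: its only tape is both the input and the oracle tape. It walks to the right end
  and then visits the blocks of the coding from right to left. The delimiter of a block is overwritten by
  a blank, so that with the head on the first letter of the block the oracle is asked about
  exactly this block. The last two flags of a state record whether a block with letter 1 has been found
  that is trivial, respectively nontrivial; the first flag of \<open>Block\<close> and \<open>Query\<close> tells whether the letter of the
  current block is 1.
\<close>

datatype scanner =
    Forward
  | Delimiter bool bool
  | Block bool bool bool
  | Query bool bool bool
  | Back bool bool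
  | Yes
  | No

instance scanner :: countable
  by countable_datatype

lemma finite_scanner: "finite (UNIV :: scanner set)"
proof -
  have "(UNIV :: scanner set) \<subseteq> {Forward, Yes, No} \<union> range (\<lambda>p. Delimiter (fst p) (snd p)) \<union>
      range (\<lambda>p. Block (fst p) (fst (snd p)) (snd (snd p))) \<union>
      range (\<lambda>p. Query (fst p) (fst (snd p)) (snd (snd p))) \<union> range (\<lambda>p. Back (fst p) (snd p))"
  proof
    fix q :: scanner
    show "q \<in> {Forward, Yes, No} \<union> range (\<lambda>p. Delimiter (fst p) (snd p)) \<union>
      range (\<lambda>p. Block (fst p) (fst (snd p)) (snd (snd p))) \<union>
      range (\<lambda>p. Query (fst p) (fst (snd p)) (snd (snd p))) \<union> range (\<lambda>p. Back (fst p) (snd p))"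
      by (cases q) (force simp: image_iff)+
  qed
  then show ?thesis by (rule finite_subset) simp
qed

fun scanner_step :: "scanner \<Rightarrow> ('g + nat) tape_symbol \<Rightarrow> scanner \<times> ('g + nat) tape_symbol \<times> direction" where
  "scanner_step Forward s = (if s = Blank then (Delimiter False False, s, MoveLeft) else (Forward, s, MoveRight))"
| "scanner_step (Delimiter e n) s = (case s of
     Letter (Inr a) \<Rightarrow> (Block (a = 1) e n, Blank, MoveLeft)
   | Letter (Inl _) \<Rightarrow> (No, s, Stay)
   | _ \<Rightarrow> (if e \<and> n then Yes else No, s, Stay))"
| "scanner_step (Block a e n) s = (case s of
     Letter (Inl _) \<Rightarrow> (Block a e n, s, MoveLeft)
   | _ \<Rightarrow> (Query a e n, s, MoveRight))"
| "scanner_step (Back e n) s = (Delimiter e n, s, MoveLeft)"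
| "scanner_step q s = (No, s, Stay)"

definition scanner_answer :: "scanner \<Rightarrow> bool \<Rightarrow> scanner" where
  "scanner_answer q b = (case q of Query a e n \<Rightarrow> Back (e \<or> a \<and> b) (n \<or> a \<and> \<not> b) | _ \<Rightarrow> No)"

definition scanner_machine :: "('g + nat) set \<Rightarrow> ('g + nat) tm" where
  "scanner_machine \<Sigma> =
     \<lparr>tm_tapes = 1, tm_states = range (to_nat :: scanner \<Rightarrow> nat),
      tm_symbols = insert Blank (Letter ` \<Sigma>),
      tm_start = to_nat Forward, tm_accept = to_nat Yes, tm_reject = to_nat No,
      tm_queries = to_nat ` {Query a e n |a e n. True},
      tm_trans = (\<lambda>q ss. case scanner_step (from_nat q) (hd ss) of (q', act) \<Rightarrow> (to_nat q', [act])),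
      tm_answer = (\<lambda>q b. to_nat (scanner_answer (from_nat q) b))\<rparr>"

lemma scanner_step_symbol: "fst (snd (scanner_step q s)) \<in> {s, Blank}"
  by (induction q s rule: scanner_step.induct) (auto split: tape_symbol.splits sum.splits)

lemma oracle_scanner_machine:
  assumes "finite \<Sigma>" shows "oracle_tm \<Sigma> (scanner_machine \<Sigma>)"
proof -
  have "fst ` set [snd (scanner_step q (hd ss))] \<subseteq> insert Blank (Letter ` \<Sigma>)"
    if "length ss = 1" "set ss \<subseteq> insert Blank (Letter ` \<Sigma>)" for q ss
    using scanner_step_symbol[of q "hd ss"] that by (cases ss) auto
  then show ?thesis
    using assms finite_scanner by (auto simp: oracle_tm_def scanner_machine_def split_beta)
qed

text \<open>
  The head is on the last letter of \<open>p\<close>, or on the blank to the left of the input if \<open>p\<close> is empty.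
\<close>

definition tape_before :: "('g + nat) list \<Rightarrow> ('g + nat) tape_symbol list \<Rightarrow> ('g + nat) tape" where
  "tape_before p X = (tl (rev (map Letter p)), scan (rev (map Letter p)) # X)"

lemma tape_before_snoc: "tape_before (p @ [c]) X = (rev (map Letter p), Letter c # X)"
  by (simp add: tape_before_def scan_def)

lemma write_left: "write_and_move (s, MoveLeft) (rev (map Letter p), t # X) = tape_before p (s # X)"
  by (simp add: tape_before_def)

locale scanner_run =
  fixes \<Sigma> :: "('g + nat) set" and W :: "'g list set"
begin

abbreviation M where "M \<equiv> scanner_machine \<Sigma>"
abbreviation \<O> where "\<O> \<equiv> map Inl ` W :: ('g + nat) list set"

definition reach :: "scanner \<Rightarrow> ('g + nat) tape \<Rightarrow> scanner \<Rightarrow> ('g + nat) tape \<Rightarrow> bool" where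
  "reach q t q' t' \<longleftrightarrow> (\<exists>n. (tm_step M \<O> ^^ n) (to_nat q, [t]) = (to_nat q', [t']))"

lemma reach_refl: "reach q t q t"
  unfolding reach_def by (rule exI[of _ 0]) simp

lemma reach_trans:
  assumes "reach q t q' t'" "reach q' t' q'' t''" shows "reach q t q'' t''"
proof -
  obtain m n where "(tm_step M \<O> ^^ m) (to_nat q, [t]) = (to_nat q', [t'])"
    "(tm_step M \<O> ^^ n) (to_nat q', [t']) = (to_nat q'', [t''])"
    using assms unfolding reach_def by blast
  then have "(tm_step M \<O> ^^ (n + m)) (to_nat q, [t]) = (to_nat q'', [t''])"
    by (simp add: funpow_add)
  then show ?thesis unfolding reach_def by blast
qed

lemma reach_step:
  assumes "q \<noteq> Yes" "q \<noteq> No" "\<And>a e n. q \<noteq> Query a e n"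
    and "scanner_step q (scan (snd t)) = (q', act)"
  shows "reach q t q' (write_and_move act t)"
proof -
  have "tm_step M \<O> (to_nat q, [t]) = (to_nat q', [write_and_move act t])"
    using assms by (auto simp: scanner_machine_def)
  then show ?thesis unfolding reach_def by (intro exI[of _ 1]) simp
qed

lemma reach_query:
  "reach (Query a e n) t (Back (e \<or> a \<and> query_positive \<O> [t]) (n \<or> a \<and> \<not> query_positive \<O> [t])) t"
proof -
  have "tm_step M \<O> (to_nat (Query a e n), [t]) =
      (to_nat (Back (e \<or> a \<and> query_positive \<O> [t]) (n \<or> a \<and> \<not> query_positive \<O> [t])), [t])"
    by (simp add: scanner_machine_def scanner_answer_def)
  then show ?thesis unfolding reach_def by (intro exI[of _ 1]) simp
qed

lemma reach_end: "reach Forward (l, map Letter w) Forward (rev (map Letter w) @ l, [])"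
proof (induction w arbitrary: l)
  case Nil
  then show ?case by (simp add: reach_refl)
next
  case (Cons c w)
  have "reach Forward (l, map Letter (c # w)) Forward (Letter c # l, map Letter w)"
    using reach_step[of Forward "(l, map Letter (c # w))" Forward "(Letter c, MoveRight)"]
    by (simp add: scan_def)
  from reach_trans[OF this Cons[of "Letter c # l"]] show ?case by simp
qed

lemma reach_last: "reach Forward ([], map Letter w) (Delimiter False False) (tape_before w [Blank])"
proof -
  have "reach Forward (rev (map Letter w), []) (Delimiter False False) (tape_before w [Blank])"
    using reach_step[of Forward "(rev (map Letter w), [])" "Delimiter False False" "(Blank, MoveLeft)"]
    by (simp add: scan_def tape_before_def)
  with reach_end[of "[]" w] show ?thesis by (simp add: reach_trans)
qed

lemma reach_block_start:
  "reach (Block a e n) (tape_before (p @ map Inl u) X) (Block a e n)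
    (tape_before p (map Letter (map Inl u) @ X))"
proof (induction u arbitrary: X rule: rev_induct)
  case Nil
  then show ?case by (simp add: reach_refl)
next
  case (snoc s u)
  have "reach (Block a e n) (tape_before (p @ map Inl (u @ [s])) X) (Block a e n)
      (tape_before (p @ map Inl u) (Letter (Inl s) # X))"
    using reach_step[of "Block a e n" "tape_before ((p @ map Inl u) @ [Inl s]) X" "Block a e n"
        "(Letter (Inl s), MoveLeft)"]
    by (simp only: tape_before_snoc write_left) (simp add: scan_def tape_before_snoc[of "p @ map Inl u", simplified])
  from reach_trans[OF this snoc] show ?case by simp
qed

definition at_delimiter :: "('g + nat) list \<Rightarrow> bool" where
  "at_delimiter p \<longleftrightarrow> p = [] \<or> (\<exists>a. last p = Inr a)"

lemma reach_round:
  assumes "at_delimiter p"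
  shows "reach (Delimiter e n) (tape_before (p @ map Inl u @ [Inr a]) X)
    (Delimiter (e \<or> a = 1 \<and> u \<in> W) (n \<or> a = 1 \<and> u \<notin> W))
    (tape_before p (map Letter (map Inl u) @ Blank # X))"
proof -
  let ?Y = "map Letter (map Inl u) @ Blank # X"
  let ?c = "scan (rev (map Letter p))" and ?l = "tl (rev (map Letter p))"
  have 1: "reach (Delimiter e n) (tape_before ((p @ map Inl u) @ [Inr a]) X) (Block (a = 1) e n)
      (tape_before (p @ map Inl u) (Blank # X))"
    using reach_step[of "Delimiter e n" "tape_before ((p @ map Inl u) @ [Inr a]) X" "Block (a = 1) e n"
        "(Blank, MoveLeft)"]
    unfolding tape_before_snoc write_left by (simp add: scan_def)
  have 2: "reach (Block (a = 1) e n) (tape_before (p @ map Inl u) (Blank # X)) (Block (a = 1) e n)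
      (tape_before p ?Y)"
    by (rule reach_block_start)
  have "scanner_step (Block (a = 1) e n) ?c = (Query (a = 1) e n, ?c, MoveRight)"
  proof (cases p rule: rev_cases)
    case (snoc p' d)
    then obtain b where "d = Inr b" using assms by (auto simp: at_delimiter_def)
    then show ?thesis using snoc by (simp add: scan_def)
  qed (simp add: scan_def)
  then have 3: "reach (Block (a = 1) e n) (tape_before p ?Y) (Query (a = 1) e n) (?c # ?l, ?Y)"
    using reach_step[of "Block (a = 1) e n" "tape_before p ?Y" "Query (a = 1) e n" "(?c, MoveRight)"]
    by (simp add: tape_before_def scan_def[of "_ # _"])
  have "takeWhile (\<lambda>s. s \<noteq> Blank) ?Y = map Letter (map Inl u)"
    by (induction u) auto
  moreover have "map Letter (map Inl u) \<in> map Letter ` \<O> \<longleftrightarrow> u \<in> W"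
  proof -
    have "inj (map (Letter \<circ> (Inl :: 'g \<Rightarrow> 'g + nat)))"
      by (intro inj_mapI injI) simp
    then have "(map (Letter \<circ> (Inl :: 'g \<Rightarrow> 'g + nat))) u \<in> map (Letter \<circ> Inl) ` W \<longleftrightarrow> u \<in> W"
      by (rule inj_image_mem_iff)
    then show ?thesis by (simp add: image_image)
  qed
  ultimately have qp: "query_positive \<O> [(?c # ?l, ?Y)] \<longleftrightarrow> u \<in> W"
    unfolding query_positive_def by simp
  let ?e = "e \<or> a = 1 \<and> u \<in> W" and ?n = "n \<or> a = 1 \<and> u \<notin> W"
  have 4: "reach (Query (a = 1) e n) (?c # ?l, ?Y) (Back ?e ?n) (?c # ?l, ?Y)"
    using reach_query[of "a = 1" e n "(?c # ?l, ?Y)"] unfolding qp .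
  \<comment> \<open>The rest of the tape is nonempty because of the blank that replaced the delimiter.\<close>
  have "scan ?Y # tl ?Y = ?Y" by (cases u) (simp_all add: scan_def)
  then have 5: "reach (Back ?e ?n) (?c # ?l, ?Y) (Delimiter ?e ?n) (tape_before p ?Y)"
    using reach_step[of "Back ?e ?n" "(?c # ?l, ?Y)" "Delimiter ?e ?n" "(scan ?Y, MoveLeft)"]
    by (simp add: tape_before_def scan_def[of "_ # _"])
  show ?thesis
    using reach_trans[OF 1 reach_trans[OF 2 reach_trans[OF 3 reach_trans[OF 4 5]]]] by simp
qed

lemma at_delimiter_coding_word: "at_delimiter (coding_word cs)"
  by (cases cs rule: rev_cases) (auto simp: at_delimiter_def coding_word_def split_beta)

lemma reach_start:
  "\<exists>X'. reach (Delimiter e n) (tape_before (coding_word cs) X)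
    (Delimiter (e \<or> (\<exists>u\<in>W. (u, 1) \<in> set cs)) (n \<or> (\<exists>u. u \<notin> W \<and> (u, 1) \<in> set cs))) (tape_before [] X')"
proof (induction cs arbitrary: e n X rule: rev_induct)
  case Nil
  then show ?case by (auto simp: coding_word_def intro: reach_refl)
next
  case (snoc p cs)
  obtain u a where p: "p = (u, a)" by (cases p)
  let ?e = "e \<or> a = 1 \<and> u \<in> W" and ?n = "n \<or> a = 1 \<and> u \<notin> W"
  have s1: "reach (Delimiter e n) (tape_before (coding_word (cs @ [p])) X) (Delimiter ?e ?n)
      (tape_before (coding_word cs) (map Letter (map Inl u) @ Blank # X))"
    using reach_round[OF at_delimiter_coding_word, of e n cs u a X] by (simp add: coding_word_def p)
  obtain X' where s2: "reach (Delimiter ?e ?n)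
      (tape_before (coding_word cs) (map Letter (map Inl u) @ Blank # X))
      (Delimiter (?e \<or> (\<exists>u\<in>W. (u, 1) \<in> set cs)) (?n \<or> (\<exists>u. u \<notin> W \<and> (u, 1) \<in> set cs))) (tape_before [] X')"
    using snoc[of ?e ?n] by blast
  have flags: "(?e \<or> (\<exists>u\<in>W. (u, 1) \<in> set cs)) = (e \<or> (\<exists>u\<in>W. (u, 1) \<in> set (cs @ [p])))"
    "(?n \<or> (\<exists>u. u \<notin> W \<and> (u, 1) \<in> set cs)) = (n \<or> (\<exists>u. u \<notin> W \<and> (u, 1) \<in> set (cs @ [p])))"
    by (auto simp: p)
  show ?case
    using reach_trans[OF s1 s2] unfolding flags by (rule exI)
qed

lemma reach_verdict:
  "\<exists>t. reach Forward ([], map Letter (coding_word cs))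
    (if (\<exists>u\<in>W. (u, 1) \<in> set cs) \<and> (\<exists>u. u \<notin> W \<and> (u, 1) \<in> set cs) then Yes else No) t"
proof -
  let ?e = "\<exists>u\<in>W. (u, 1) \<in> set cs" and ?n = "\<exists>u. u \<notin> W \<and> (u, 1) \<in> set cs"
  obtain X where X: "reach (Delimiter False False) (tape_before (coding_word cs) [Blank])
      (Delimiter ?e ?n) (tape_before [] X)"
    using reach_start[of False False cs "[Blank]"] by auto
  have "reach (Delimiter ?e ?n) (tape_before [] X) (if ?e \<and> ?n then Yes else No)
      (write_and_move (Blank, Stay) (tape_before [] X))"
    by (rule reach_step) (simp_all add: tape_before_def scan_def)
  then show ?thesis using reach_trans[OF reach_last reach_trans[OF X]] by blast
qed

text \<open>
  A word that ends in a generator is not a coding word; the machine finds this out before it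
  overwrites anything.
\<close>

lemma reach_No_if_incomplete: "\<exists>t. reach Forward ([], map Letter (w @ [Inl s])) No t"
proof -
  have "reach (Delimiter False False) (tape_before (w @ [Inl s]) [Blank]) No
      (write_and_move (Letter (Inl s), Stay) (tape_before (w @ [Inl s]) [Blank]))"
    by (rule reach_step) (simp_all add: tape_before_snoc scan_def)
  then show ?thesis using reach_trans[OF reach_last] by blast
qed

lemma halted:
  assumes "(tm_step M \<O> ^^ n) c = (q, t)" "q = tm_accept M \<or> q = tm_reject M" "n \<le> k"
  shows "(tm_step M \<O> ^^ k) c = (q, t)"
proof -
  have stop: "(tm_step M \<O> ^^ m) (q, t) = (q, t)" for m
    by (induction m) (use assms(2) in auto)
  obtain d where "k = d + n" using assms(3) by (metis le_add_diff_inverse2)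
  then show ?thesis by (simp add: funpow_add assms(1) stop)
qed

lemma init: "tm_init M w = (to_nat Forward, [([], map Letter w)])"
  by (simp add: tm_init_def scanner_machine_def)

lemma accepts_if_Yes: "reach Forward ([], map Letter w) Yes t \<Longrightarrow> tm_accepts M \<O> w"
proof -
  assume "reach Forward ([], map Letter w) Yes t"
  then obtain n where "(tm_step M \<O> ^^ n) (tm_init M w) = (to_nat Yes, [t])"
    unfolding reach_def init by blast
  then have "fst ((tm_step M \<O> ^^ n) (tm_init M w)) = tm_accept M"
    by (simp only: fst_conv) (simp add: scanner_machine_def)
  then show ?thesis unfolding tm_accepts_def by (rule exI)
qed

lemma not_accepts_if_No:
  assumes "reach Forward ([], map Letter w) No t" shows "\<not> tm_accepts M \<O> w"
proof
  assume "tm_accepts M \<O> w"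
  then obtain n ts where n: "(tm_step M \<O> ^^ n) (tm_init M w) = (tm_accept M, ts)"
    unfolding tm_accepts_def by (metis prod.collapse)
  obtain m where m: "(tm_step M \<O> ^^ m) (tm_init M w) = (tm_reject M, [t])"
    using assms unfolding reach_def init by (auto simp: scanner_machine_def)
  have "tm_accept M = tm_reject M"
    using halted[OF n, of "max m n"] halted[OF m, of "max m n"] by simp
  then show False by (simp add: scanner_machine_def)
qed

end

lemma coding_word_exists:
  "\<exists>cs u. w = coding_word cs @ map Inl u"
proof (induction w rule: rev_induct)
  case Nil
  then show ?case by (intro exI[of _ "[]"]) (simp add: coding_word_def)
next
  case (snoc c w)
  then obtain cs u where w: "w = coding_word cs @ map Inl u" by blast
  show ?case
  proof (cases c)
    case (Inl s)
    then show ?thesis using w by (intro exI[of _ cs] exI[of _ "u @ [s]"]) simp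
  next
    case (Inr a)
    then show ?thesis using w
      by (intro exI[of _ "cs @ [(u, a)]"] exI[of _ "[]"]) (simp add: coding_word_def)
  qed
qed

lemma set_coding_word: "set (coding_word cs) = (\<Union>p\<in>set cs. Inl ` set (fst p) \<union> {Inr (snd p)})"
  by (auto simp: coding_word_def split_beta)

text \<open>
  Two ones at \<open>g\<close> and \<open>g v\<close> are forbidden by the coding with words \<open>[]\<close> and \<open>v\<close>. The set \<open>C\<close> below contains all
  codings that put the letter 1 on some trivial and on some nontrivial word. Taking all of them, rather
  than the pairs alone, lets a machine that keeps two flags recognise every listing of a coding,
  whatever the order and the repetitions.
\<close>

theorem (in group) at_most_one_effectively_closed:
  assumes S: "finite_symmetric_generators G S"
  shows "effectively_closed G S {0, 1} (at_most_one G)"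
proof -
  let ?A = "{0, 1 :: nat}"
  let ?W = "word_problem G S"
  have "finite S" and SG: "S \<subseteq> carrier G" using S by (auto simp: finite_symmetric_generators_def)
  have lists_G: "u \<in> lists (carrier G)" if "u \<in> lists S" for u
    using that lists_mono[OF SG] by blast
  define C where "C = {c. pattern_coding S ?A c \<and> (\<exists>u\<in>?W. (u, 1) \<in> c) \<and> (\<exists>u. u \<notin> ?W \<and> (u, 1) \<in> c)}"
  interpret scanner_run "S <+> ?A" ?W .
  have cs_in: "pattern_coding S ?A (set cs)" if "coding_word cs \<in> lists (S <+> ?A)" for cs
  proof -
    have "Inl ` set u \<union> {Inr a} \<subseteq> S <+> ?A" if "(u, a) \<in> set cs" for u a
      using \<open>coding_word cs \<in> lists (S <+> ?A)\<close> that unfolding in_lists_conv_set set_coding_word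
      by fastforce
    then show ?thesis unfolding pattern_coding_def by fastforce
  qed
  have L_sub: "coding_language C \<subseteq> lists (S <+> ?A)"
  proof
    fix w assume "w \<in> coding_language C"
    then obtain cs where cs: "w = coding_word cs" "pattern_coding S ?A (set cs)"
      by (auto simp: coding_language_def C_def)
    have "Inl ` set (fst p) \<union> {Inr (snd p)} \<subseteq> S <+> ?A" if "p \<in> set cs" for p
      using cs(2) that unfolding pattern_coding_def by fastforce
    then show "w \<in> lists (S <+> ?A)"
      unfolding cs(1) in_lists_conv_set set_coding_word by blast
  qed
  have "tm_accepts M \<O> w \<longleftrightarrow> w \<in> coding_language C" if w: "w \<in> lists (S <+> ?A)" for w
  proof
    assume "w \<in> coding_language C"
    then obtain cs where "w = coding_word cs" "\<exists>u\<in>?W. (u, 1) \<in> set cs" "\<exists>u. u \<notin> ?W \<and> (u, 1) \<in> set cs"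
      by (auto simp: coding_language_def C_def)
    then show "tm_accepts M \<O> w" using reach_verdict[of cs] accepts_if_Yes by auto
  next
    assume acc: "tm_accepts M \<O> w"
    obtain cs u where cs: "w = coding_word cs @ map Inl u" using coding_word_exists by blast
    have "u = []"
    proof (cases u rule: rev_cases)
      case (snoc v s)
      then have "w = (coding_word cs @ map Inl v) @ [Inl s]" using cs by simp
      then show ?thesis using reach_No_if_incomplete not_accepts_if_No acc by metis
    qed
    then have wcs: "w = coding_word cs" using cs by simp
    have "(\<exists>u\<in>?W. (u, 1) \<in> set cs) \<and> (\<exists>u. u \<notin> ?W \<and> (u, 1) \<in> set cs)"
    proof (rule ccontr)
      assume "\<not> ((\<exists>u\<in>?W. (u, 1) \<in> set cs) \<and> (\<exists>u. u \<notin> ?W \<and> (u, 1) \<in> set cs))"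
      then obtain t where "reach Forward ([], map Letter w) No t"
        using reach_verdict[of cs] unfolding wcs by (auto simp only: if_False)
      then show False using not_accepts_if_No acc by blast
    qed
    then have "set cs \<in> C" using cs_in[of cs] w wcs by (simp add: C_def)
    then show "w \<in> coding_language C" using wcs by (auto simp: coding_language_def)
  qed
  then have re: "re_with_oracle \<O> (S <+> ?A) (coding_language C)"
    unfolding re_with_oracle_def using L_sub oracle_scanner_machine[of "S <+> ?A"] \<open>finite S\<close> by auto
  have eq: "coded_shift G ?A C = at_most_one G"
  proof (rule equalityI; rule subsetI)
    fix x assume x: "x \<in> coded_shift G ?A C"
    show "x \<in> at_most_one G"
      unfolding at_most_one_def
    proof (intro CollectI conjI ballI impI)
      show xc: "x \<in> configs G ?A" using x by (simp add: coded_shift_def)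
      fix g h assume gh: "g \<in> carrier G" "h \<in> carrier G" "x g = 1 \<and> x h = 1"
      show "g = h"
      proof (rule ccontr)
        assume "g \<noteq> h"
        obtain v where v: "v \<in> lists S" "word_value G v = inv g \<otimes> h"
          using word_value_surj[OF S, of "inv g \<otimes> h"] gh by auto
        have "inv g \<otimes> h \<noteq> \<one>" using \<open>g \<noteq> h\<close> gh by (metis inv_closed inv_equality inv_inv)
        then have "v \<notin> ?W" using v by (simp add: word_problem_def)
        moreover have "[] \<in> ?W" by (simp add: word_problem_def word_value_def)
        ultimately have "{([], 1), (v, 1)} \<in> C"
          using v(1) unfolding C_def pattern_coding_def by blast
        then have "\<not> (\<forall>(w, a)\<in>{([], 1), (v, 1)}. x \<in> cylinder G ?A a (g \<otimes> word_value G w))"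
          using x gh(1) unfolding coded_shift_def by blast
        moreover have "g \<otimes> (inv g \<otimes> h) = h" using gh by (simp add: m_assoc[symmetric])
        ultimately show False
          using xc gh v(2) by (simp add: cylinder_def word_value_def)
      qed
    qed
  next
    fix x assume x: "x \<in> at_most_one G"
    show "x \<in> coded_shift G ?A C"
      unfolding coded_shift_def
    proof (intro CollectI conjI ballI notI)
      show "x \<in> configs G ?A" using x by (simp add: at_most_one_def)
      fix c g assume c: "c \<in> C" and g: "g \<in> carrier G"
        and all: "\<forall>(w, a)\<in>c. x \<in> cylinder G ?A a (g \<otimes> word_value G w)"
      obtain u v where uv: "u \<in> ?W" "(u, 1) \<in> c" "v \<notin> ?W" "(v, 1) \<in> c" "v \<in> lists S"
        using c unfolding C_def pattern_coding_def by blast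
      have "word_value G u = \<one>" "word_value G v \<noteq> \<one>" "word_value G v \<in> carrier G"
        using uv word_value_closed[OF lists_G[OF uv(5)]] by (auto simp: word_problem_def)
      moreover have ones: "x (g \<otimes> word_value G u) = 1" "x (g \<otimes> word_value G v) = 1"
        using all uv(2,4) by (auto simp: cylinder_def)
      moreover have "\<forall>g\<in>carrier G. \<forall>h\<in>carrier G. x g = 1 \<and> x h = 1 \<longrightarrow> g = h"
        using x unfolding at_most_one_def by blast
      from this[rule_format, of "g \<otimes> word_value G u" "g \<otimes> word_value G v"]
      have "g \<otimes> word_value G u = g \<otimes> word_value G v"
        using ones g calculation(1,3) by simp
      ultimately show False using g by simp
    qed
  qed
  show ?thesis
    unfolding effectively_closed_def
  proof (intro conjI exI[of _ C])
    show "\<forall>c\<in>C. pattern_coding S ?A c" by (simp add: C_def)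
  qed (rule at_most_one_subshift re eq[symmetric])+
qed

section \<open>A subshift that is effectively closed but not sofic\<close>

theorem theorem2p14:
  fixes G :: "('g, 'm) monoid_scheme" and S :: "'g set"
  assumes "group G"
    and "finite_symmetric_generators G S"
    and "recursively_presented G"
    and "\<not> decidable S (word_problem G S)"
  shows "\<exists>(A :: nat set) X. finite A \<and> effectively_closed G S A X \<and> \<not> sofic G A X"
proof -
  interpret group G by fact
  obtain T R where "is_presentation G T R" "recursively_enumerable T R"
    using assms(3) unfolding recursively_presented_def by blast
  then obtain val rel where "coded_presentation G val rel"
    using presented_group_coded by blast
  then interpret coded_presentation G val rel .
  have "\<not> sofic G {0, 1} (at_most_one G)"
    using sofic_at_most_one_decidable assms(2,4) by blast
  moreover have "effectively_closed G S {0, 1} (at_most_one G)"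
    by (rule at_most_one_effectively_closed[OF assms(2)])
  ultimately show ?thesis by (intro exI[of _ "{0, 1}"] exI[of _ "at_most_one G"]) simp
qed

end
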